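(* Let $(M,[g])$ be a conformal manifold (Riemannian or pseudo-Riemannian signature) of dimension $n\ge 3$, with conformal metric $\boldsymbol{g}$. There is a 1-1 correspondence between conformal scales $\sigma\in\mathcal{E}[1]$ (nowhere vanishing sections) such that the metric $\sigma^{-2}\boldsymbol{g}$ is Einstein, and parallel standard tractors $\mathbb{I}$ (sections $\mathbb{I}^A$ of the standard tractor bundle $\mathcal{E}^A$ parallel for the tractor connection) with the property that $X_A\mathbb{I}^A$ is nowhere vanishing. The mapping from Einstein scales to parallel tractors is given by $\sigma\mapsto \frac1n D_A\sigma$, while the inverse is $\mathbb{I}^A\mapsto X_A\mathbb{I}^A$.
   Context: All objects are smooth; abstract index notation is used. Curvature. For a metric $g$ with Levi-Civita connection $\nabla$, $(\nabla_a\nabla_b-\nabla_b\nabla_a)V^c=R_{ab}{}^c{}_dV^d$. The totally trace-free Weyl tensor $C_{abcd}$ and symmetric Schouten tensor $P_{ab}$ are defined by $R_{abcd}=C_{abcd}+2g_{c[a}P_{b]d}+2g_{d[b}P_{a]c}$; $J:=P^a{}_a$; $\Delta:=\nabla^a\nabla_a$. The metric is Einstein if $P_{ab}-\frac1n Jg_{ab}=0$. Densities. $[g]$ is a class of metrics modulo multiplication by positive smooth functions. $\mathcal{E}[w]$ is the line bundle whose sections correspond to functions $f(x,g)$ of a point and a metric in the class with $f(x,\Omega^2g)=\Omega^wf(x,g)$. $\boldsymbol{g}_{ab}$, a section of $\mathcal{E}_{(ab)}[2]$, is the tautological conformal metric; a nowhere vanishing $\sigma\in\mathcal{E}[1]$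 (a conformal scale) determines the metric $\sigma^{-2}\boldsymbol{g}$ in the class. Indices are raised and lowered with $\boldsymbol{g}$. A choice of $g\in[g]$ trivialises the density bundles, and $\nabla$ acts on densities through this trivialisation. Tractors. The standard tractor bundle $\mathcal{E}^A$ is the quotient of the 2-jet bundle $J^2\mathcal{E}[1]$ by the image of the trace-free symmetric part $\mathcal{E}_{(ab)_0}[1]$ in $J^2\mathcal{E}[1]$. The operator $\frac1nD:\mathcal{E}[1]\to\mathcal{E}^A$ is induced by the universal 2-jet operator followed by the projection; a choice of $g\in[g]$ splits $\mathcal{E}^A$ as $\mathcal{E}[1]\oplus\mathcal{E}_a[1]\oplus\mathcal{E}[-1]$ so that $\frac1nD\sigma=(\sigma,\nabla_a\sigma,-\frac1n(\Delta+J)\sigma)$. The canonical projection $X_A:\mathcal{E}^A\to\mathcal{E}[1]$ is $(\sigma,\mu_a,\rho)\mapsto\sigma$. The (conformally invariant) tractor connection is $$\nabla_a(\sigma,\mu_b,\rho)=(\nabla_a\sigma-\mu_a,\ \nabla_a\mu_b+\boldsymbol{g}_{ab}\rho+P_{ab}\sigma,\ \nabla_a\rho-P_{ab}\mu^b),$$ and it preserves the conformally invariant tractor metric $h$ given by $h(V,V)=2\sigma\rho+\boldsymbol{g}^{ab}\mu_a\mu_b$ for $V=(\sigma,\mu_a,\rho)$, which is used to raise and lower tractor indices. *)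

theory Defs
  imports "HOL-Analysis.Analysis"
begin

section \<open>Smooth manifolds\<close>

fun Ck_on :: "nat \<Rightarrow> 'a::real_normed_vector set \<Rightarrow> ('a \<Rightarrow> 'b::real_normed_vector) \<Rightarrow> bool" where
  "Ck_on 0 S f \<longleftrightarrow> continuous_on S f"
| "Ck_on (Suc k) S f \<longleftrightarrow>
     f differentiable_on S \<and> (\<forall>v. Ck_on k S (\<lambda>x. frechet_derivative f (at x) v))"

text \<open>Used only on open sets.\<close>

definition smooth_on :: "'a::real_normed_vector set \<Rightarrow> ('a \<Rightarrow> 'b::real_normed_vector) \<Rightarrow> bool" where
  "smooth_on S f \<longleftrightarrow> (\<forall>k. Ck_on k S f)"

text \<open>A chart is a pair of its domain and its coordinate map. The dimension is \<open>CARD('n)\<close>, and the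
  manifold is the whole type \<open>'m\<close>, required below to be Hausdorff and second countable.\<close>

type_synonym ('m, 'n) chart = "'m set \<times> ('m \<Rightarrow> real ^ 'n)"

abbreviation chart_dom :: "('m, 'n) chart \<Rightarrow> 'm set" where "chart_dom \<equiv> fst"
abbreviation coords :: "('m, 'n) chart \<Rightarrow> 'm \<Rightarrow> real ^ 'n" where "coords \<equiv> snd"

definition chart_inv :: "('m, 'n) chart \<Rightarrow> real ^ 'n \<Rightarrow> 'm" where
  "chart_inv c = inv_into (chart_dom c) (coords c)"

definition smooth_atlas ::
  "('m::{t2_space,second_countable_topology}, 'n::finite) chart set \<Rightarrow> bool" where
  "smooth_atlas A \<longleftrightarrow>
     (\<Union>c\<in>A. chart_dom c) = UNIV \<and>
     (\<forall>c\<in>A. open (chart_dom c) \<and> open (coords c ` chart_dom c) \<and>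
        homeomorphism (chart_dom c) (coords c ` chart_dom c) (coords c) (chart_inv c)) \<and>
     (\<forall>c\<in>A. \<forall>d\<in>A. smooth_on (coords c ` (chart_dom c \<inter> chart_dom d)) (coords d \<circ> chart_inv c))"

definition charts_at :: "('m, 'n) chart set \<Rightarrow> 'm \<Rightarrow> ('m, 'n) chart set" where
  "charts_at A x = {c \<in> A. x \<in> chart_dom c}"

definition smooth_fn :: "('m, 'n::finite) chart set \<Rightarrow> 'm set \<Rightarrow> ('m \<Rightarrow> real) \<Rightarrow> bool" where
  "smooth_fn A W f \<longleftrightarrow> (\<forall>c\<in>A. smooth_on (coords c ` (chart_dom c \<inter> W)) (f \<circ> chart_inv c))"

text \<open>The coordinate derivative $\partial_a f$ in the chart \<open>c\<close>, as a function on the manifold.\<close>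

definition pd :: "('m, 'n::finite) chart \<Rightarrow> 'n \<Rightarrow> ('m \<Rightarrow> real) \<Rightarrow> 'm \<Rightarrow> real" where
  "pd c a f x = frechet_derivative (f \<circ> chart_inv c) (at (coords c x)) (axis a 1)"


section \<open>Metrics and conformal classes\<close>

text \<open>A covariant 2-tensor at a point is the family of its component matrices in all charts around
  that point, related by the transformation law. Components in all other charts are set to 0, so
  that equality of tensors is equality of functions.\<close>

type_synonym ('m, 'n) tensor2 = "('m, 'n) chart \<Rightarrow> real ^ 'n ^ 'n"

type_synonym ('m, 'n) tensor2_field = "'m \<Rightarrow> ('m, 'n) tensor2"

definition tensor2_at :: "('m, 'n::finite) chart set \<Rightarrow> 'm \<Rightarrow> ('m, 'n) tensor2 set" where
  "tensor2_at A x = {T.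
     (\<forall>c. c \<notin> charts_at A x \<longrightarrow> T c = 0) \<and>
     (\<forall>c\<in>charts_at A x. \<forall>d\<in>charts_at A x. \<forall>a b.
        T c $ a $ b = (\<Sum>i\<in>UNIV. \<Sum>j\<in>UNIV.
          pd c a (\<lambda>y. coords d y $ i) x * pd c b (\<lambda>y. coords d y $ j) x * T d $ i $ j))}"

definition has_signature :: "nat \<Rightarrow> real ^ 'n::finite ^ 'n \<Rightarrow> bool" where
  "has_signature p Q \<longleftrightarrow> (\<exists>B (d :: 'n \<Rightarrow> real). invertible B \<and> (\<forall>i. d i = 1 \<or> d i = -1) \<and>
     card {i. d i = 1} = p \<and>
     transpose B ** Q ** B = (\<chi> i j. if i = j then d i else 0))"

definition metric :: "('m, 'n::finite) chart set \<Rightarrow> ('m, 'n) tensor2_field \<Rightarrow> bool" where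
  "metric A g \<longleftrightarrow>
     (\<forall>x. g x \<in> tensor2_at A x) \<and>
     (\<forall>c\<in>A. \<forall>a b. smooth_fn A (chart_dom c) (\<lambda>x. g x c $ a $ b)) \<and>
     (\<forall>x. \<forall>c\<in>charts_at A x. transpose (g x c) = g x c) \<and>
     (\<exists>p. \<forall>x. \<forall>c\<in>charts_at A x. has_signature p (g x c))"

definition rescale :: "('m \<Rightarrow> real) \<Rightarrow> ('m, 'n::finite) tensor2_field \<Rightarrow> ('m, 'n) tensor2_field" where
  "rescale f g = (\<lambda>x c. f x *\<^sub>R g x c)"

definition pos_smooth :: "('m, 'n::finite) chart set \<Rightarrow> ('m \<Rightarrow> real) \<Rightarrow> bool" where
  "pos_smooth A \<Omega> \<longleftrightarrow> smooth_fn A UNIV \<Omega> \<and> (\<forall>x. \<Omega> x > 0)"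

definition conformal_class ::
  "('m, 'n::finite) chart set \<Rightarrow> ('m, 'n) tensor2_field set \<Rightarrow> bool" where
  "conformal_class A G \<longleftrightarrow>
     (\<exists>g. metric A g \<and> G = {rescale (\<lambda>x. (\<Omega> x)\<^sup>2) g | \<Omega>. pos_smooth A \<Omega>})"


section \<open>Curvature\<close>

text \<open>All of these are components at \<open>x\<close> in the chart \<open>c\<close>; derivative indices come first.\<close>

definition inv_metric :: "('m, 'n::finite) tensor2_field \<Rightarrow> ('m, 'n) chart \<Rightarrow> 'm \<Rightarrow> real ^ 'n ^ 'n" where
  "inv_metric g c x = matrix_inv (g x c)"

text \<open>\<open>christoffel g c a b d x\<close> is $\Gamma^a{}_{bd}$.\<close>

definition christoffel ::
  "('m, 'n::finite) tensor2_field \<Rightarrow> ('m, 'n) chart \<Rightarrow> 'n \<Rightarrow> 'n \<Rightarrow> 'n \<Rightarrow> 'm \<Rightarrow> real" where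
  "christoffel g c a b d x = (\<Sum>e\<in>UNIV. inv_metric g c x $ a $ e *
     (pd c b (\<lambda>y. g y c $ e $ d) x + pd c d (\<lambda>y. g y c $ b $ e) x - pd c e (\<lambda>y. g y c $ b $ d) x)) / 2"

text \<open>The Levi-Civita derivatives $\nabla_a \mu_b$, $\nabla_a V^b$ and $\nabla_a W_b{}^d$.\<close>

definition nabla_covec ::
  "('m, 'n::finite) tensor2_field \<Rightarrow> ('m, 'n) chart \<Rightarrow> 'n \<Rightarrow> 'n \<Rightarrow> ('m \<Rightarrow> real ^ 'n) \<Rightarrow> 'm \<Rightarrow> real" where
  "nabla_covec g c a b \<mu> x =
     pd c a (\<lambda>y. \<mu> y $ b) x - (\<Sum>e\<in>UNIV. christoffel g c e a b x * \<mu> x $ e)"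

definition nabla_vec ::
  "('m, 'n::finite) tensor2_field \<Rightarrow> ('m, 'n) chart \<Rightarrow> 'n \<Rightarrow> 'n \<Rightarrow> ('m \<Rightarrow> real ^ 'n) \<Rightarrow> 'm \<Rightarrow> real" where
  "nabla_vec g c a b V x =
     pd c a (\<lambda>y. V y $ b) x + (\<Sum>e\<in>UNIV. christoffel g c b a e x * V x $ e)"

definition nabla_11 ::
  "('m, 'n::finite) tensor2_field \<Rightarrow> ('m, 'n) chart \<Rightarrow> 'n \<Rightarrow> 'n \<Rightarrow> 'n \<Rightarrow> ('m \<Rightarrow> real ^ 'n ^ 'n) \<Rightarrow>
     'm \<Rightarrow> real" where
  "nabla_11 g c a b d W x =
     pd c a (\<lambda>y. W y $ b $ d) x
     - (\<Sum>e\<in>UNIV. christoffel g c e a b x * W x $ e $ d)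
     + (\<Sum>e\<in>UNIV. christoffel g c d a e x * W x $ b $ e)"

definition nabla2_vec ::
  "('m, 'n::finite) tensor2_field \<Rightarrow> ('m, 'n) chart \<Rightarrow> 'n \<Rightarrow> 'n \<Rightarrow> 'n \<Rightarrow> ('m \<Rightarrow> real ^ 'n) \<Rightarrow> 'm \<Rightarrow> real" where
  "nabla2_vec g c a b d V x = nabla_11 g c a b d (\<lambda>y. \<chi> i j. nabla_vec g c i j V y) x"

text \<open>\<open>riem g c a b k d x\<close> is $R_{ab}{}^k{}_d$, obtained from
  $(\nabla_a\nabla_b - \nabla_b\nabla_a)V^k = R_{ab}{}^k{}_l V^l$ with \<open>V\<close> the \<open>d\<close>-th coordinate
  vector field.\<close>

definition riem ::
  "('m, 'n::finite) tensor2_field \<Rightarrow> ('m, 'n) chart \<Rightarrow> 'n \<Rightarrow> 'n \<Rightarrow> 'n \<Rightarrow> 'n \<Rightarrow> 'm \<Rightarrow> real" where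
  "riem g c a b k d x =
     nabla2_vec g c a b k (\<lambda>_. axis d 1) x - nabla2_vec g c b a k (\<lambda>_. axis d 1) x"

definition riem_low ::
  "('m, 'n::finite) tensor2_field \<Rightarrow> ('m, 'n) chart \<Rightarrow> 'n \<Rightarrow> 'n \<Rightarrow> 'n \<Rightarrow> 'n \<Rightarrow> 'm \<Rightarrow> real" where
  "riem_low g c a b k d x = (\<Sum>e\<in>UNIV. g x c $ k $ e * riem g c a b e d x)"

definition totally_trace_free :: "real ^ 'n::finite ^ 'n \<Rightarrow> ('n \<Rightarrow> 'n \<Rightarrow> 'n \<Rightarrow> 'n \<Rightarrow> real) \<Rightarrow> bool" where
  "totally_trace_free h C \<longleftrightarrow> (\<forall>k l.
     (\<Sum>i\<in>UNIV. \<Sum>j\<in>UNIV. h $ i $ j * C i j k l) = 0 \<and>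
     (\<Sum>i\<in>UNIV. \<Sum>j\<in>UNIV. h $ i $ j * C i k j l) = 0 \<and>
     (\<Sum>i\<in>UNIV. \<Sum>j\<in>UNIV. h $ i $ j * C i k l j) = 0 \<and>
     (\<Sum>i\<in>UNIV. \<Sum>j\<in>UNIV. h $ i $ j * C k i j l) = 0 \<and>
     (\<Sum>i\<in>UNIV. \<Sum>j\<in>UNIV. h $ i $ j * C k i l j) = 0 \<and>
     (\<Sum>i\<in>UNIV. \<Sum>j\<in>UNIV. h $ i $ j * C k l i j) = 0)"

text \<open>$C_{abkd} = R_{abkd} - 2g_{k[a}P_{b]d} - 2g_{d[b}P_{a]k}$.\<close>

definition weyl_of ::
  "('m, 'n::finite) tensor2_field \<Rightarrow> ('m, 'n) chart \<Rightarrow> 'm \<Rightarrow> real ^ 'n ^ 'n \<Rightarrow>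
     'n \<Rightarrow> 'n \<Rightarrow> 'n \<Rightarrow> 'n \<Rightarrow> real" where
  "weyl_of g c x P a b k d = riem_low g c a b k d x
     - (g x c $ k $ a * P $ b $ d - g x c $ k $ b * P $ a $ d)
     - (g x c $ d $ b * P $ a $ k - g x c $ d $ a * P $ b $ k)"

definition schouten :: "('m, 'n::finite) tensor2_field \<Rightarrow> ('m, 'n) chart \<Rightarrow> 'm \<Rightarrow> real ^ 'n ^ 'n" where
  "schouten g c x = (THE P. transpose P = P \<and>
     totally_trace_free (inv_metric g c x) (weyl_of g c x P))"

definition J_trace :: "('m, 'n::finite) tensor2_field \<Rightarrow> ('m, 'n) chart \<Rightarrow> 'm \<Rightarrow> real" where
  "J_trace g c x = (\<Sum>a\<in>UNIV. \<Sum>b\<in>UNIV. inv_metric g c x $ a $ b * schouten g c x $ a $ b)"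

definition laplacian ::
  "('m, 'n::finite) tensor2_field \<Rightarrow> ('m, 'n) chart \<Rightarrow> ('m \<Rightarrow> real) \<Rightarrow> 'm \<Rightarrow> real" where
  "laplacian g c f x = (\<Sum>a\<in>UNIV. \<Sum>b\<in>UNIV.
     inv_metric g c x $ a $ b * nabla_covec g c a b (\<lambda>y. \<chi> e. pd c e f y) x)"

definition einstein :: "('m, 'n::finite) chart set \<Rightarrow> ('m, 'n) tensor2_field \<Rightarrow> bool" where
  "einstein A g \<longleftrightarrow> (\<forall>x. \<forall>c\<in>charts_at A x.
     schouten g c x - (J_trace g c x / real CARD('n)) *\<^sub>R g x c = 0)"


section \<open>Densities\<close>

text \<open>The fibre of $\mathcal{E}[w]$ at \<open>x\<close>: functions of a metric in the class \<open>G\<close>. They are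
  extensional on \<open>G\<close>, so that sections are equal when they agree on the class.\<close>

definition density_at ::
  "('m, 'n::finite) chart set \<Rightarrow> ('m, 'n) tensor2_field set \<Rightarrow> real \<Rightarrow> 'm \<Rightarrow>
     (('m, 'n) tensor2_field \<Rightarrow> real) set" where
  "density_at A G w x = {f \<in> extensional G. \<forall>g\<in>G. \<forall>\<Omega>. pos_smooth A \<Omega> \<longrightarrow>
     f (rescale (\<lambda>y. (\<Omega> y)\<^sup>2) g) = \<Omega> x powr w * f g}"

type_synonym ('m, 'n) density = "'m \<Rightarrow> ('m, 'n) tensor2_field \<Rightarrow> real"

definition density_section ::
  "('m, 'n::finite) chart set \<Rightarrow> ('m, 'n) tensor2_field set \<Rightarrow> real \<Rightarrow> 'm set \<Rightarrow>
     ('m, 'n) density \<Rightarrow> bool" where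
  "density_section A G w W s \<longleftrightarrow>
     (\<forall>x\<in>W. s x \<in> density_at A G w x) \<and> (\<forall>g\<in>G. smooth_fn A W (\<lambda>x. s x g))"

definition nowhere_vanishing :: "('m, 'n) tensor2_field set \<Rightarrow> ('m, 'n) density \<Rightarrow> bool" where
  "nowhere_vanishing G s \<longleftrightarrow> (\<forall>x. \<forall>g\<in>G. s x g \<noteq> 0)"

definition conformal_scale ::
  "('m, 'n::finite) chart set \<Rightarrow> ('m, 'n) tensor2_field set \<Rightarrow> ('m, 'n) density \<Rightarrow> bool" where
  "conformal_scale A G \<sigma> \<longleftrightarrow> density_section A G 1 UNIV \<sigma> \<and> nowhere_vanishing G \<sigma>"

text \<open>The conformal metric $\boldsymbol{g}$ is the density-valued tensor whose value at \<open>g\<close> is \<open>g\<close>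
  itself, so this is the weight 0 tensor $\sigma^{-2}\boldsymbol{g}$ evaluated at \<open>g\<close>. The lemma says
  that it does not depend on \<open>g\<close>.\<close>

definition scale_metric ::
  "('m, 'n::finite) density \<Rightarrow> ('m, 'n) tensor2_field \<Rightarrow> ('m, 'n) tensor2_field" where
  "scale_metric \<sigma> g = rescale (\<lambda>x. 1 / (\<sigma> x g)\<^sup>2) g"

lemma scale_metric_independent:
  assumes G: "conformal_class A G" and \<sigma>: "density_section A G 1 UNIV \<sigma>"
    and g: "g1 \<in> G" "g2 \<in> G"
  shows "scale_metric \<sigma> g1 = scale_metric \<sigma> g2"
proof -
  have smooth1: "smooth_fn A UNIV (\<lambda>_. 1)"
  proof -
    have const: "Ck_on k S (\<lambda>_. r)" for k and S :: "(real ^ 'b) set" and r :: real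
      by (induction k arbitrary: r) (simp_all add: frechet_derivative_const)
    show ?thesis
      using const[of _ _ 1] by (simp add: smooth_fn_def smooth_on_def comp_def)
  qed
  obtain g0 where G0: "G = {rescale (\<lambda>x. (\<Omega> x)\<^sup>2) g0 | \<Omega>. pos_smooth A \<Omega>}"
    using G by (auto simp: conformal_class_def)
  have "rescale (\<lambda>x. ((\<lambda>_. 1) x)\<^sup>2) g0 \<in> G"
    unfolding G0 using smooth1 by (auto simp: pos_smooth_def intro!: exI[of _ "\<lambda>_. 1"])
  then have g0: "g0 \<in> G"
    by (simp add: rescale_def)
  have "scale_metric \<sigma> g = scale_metric \<sigma> g0" if gG: "g \<in> G" for g
  proof -
    obtain \<Omega> where \<Omega>: "pos_smooth A \<Omega>" "g = rescale (\<lambda>x. (\<Omega> x)\<^sup>2) g0"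
      using gG G0 by auto
    have pos: "\<Omega> x > 0" for x
      using \<Omega> by (simp add: pos_smooth_def)
    have "\<sigma> x g = \<Omega> x * \<sigma> x g0" for x
      using \<sigma> g0 \<Omega> pos[of x] by (auto simp: density_section_def density_at_def)
    then show ?thesis
      using pos by (auto simp: scale_metric_def rescale_def \<Omega>(2) fun_eq_iff power_mult_distrib
          less_imp_neq[THEN not_sym])
  qed
  then show ?thesis
    using g by metis
qed

definition einstein_scale ::
  "('m, 'n::finite) chart set \<Rightarrow> ('m, 'n) tensor2_field set \<Rightarrow> ('m, 'n) density \<Rightarrow> bool" where
  "einstein_scale A G \<sigma> \<longleftrightarrow>
     conformal_scale A G \<sigma> \<and> (\<forall>g\<in>G. einstein A (scale_metric \<sigma> g))"

text \<open>The fibre of $\mathcal{E}_{(ab)_0}[w]$ at \<open>x\<close>.\<close>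

definition tf_sym_at ::
  "('m, 'n::finite) chart set \<Rightarrow> ('m, 'n) tensor2_field set \<Rightarrow> real \<Rightarrow> 'm \<Rightarrow>
     (('m, 'n) tensor2_field \<Rightarrow> ('m, 'n) tensor2) set" where
  "tf_sym_at A G w x = {S \<in> extensional G.
     (\<forall>g\<in>G. S g \<in> tensor2_at A x) \<and>
     (\<forall>g\<in>G. \<forall>c\<in>charts_at A x. transpose (S g c) = S g c \<and>
        (\<Sum>a\<in>UNIV. \<Sum>b\<in>UNIV. inv_metric g c x $ a $ b * S g c $ a $ b) = 0) \<and>
     (\<forall>g\<in>G. \<forall>\<Omega>. pos_smooth A \<Omega> \<longrightarrow>
        S (rescale (\<lambda>y. (\<Omega> y)\<^sup>2) g) = (\<lambda>c. (\<Omega> x powr w) *\<^sub>R S g c))}"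


section \<open>2-jets and standard tractors\<close>

text \<open>A jet at \<open>x\<close> is the set of all sections of $\mathcal{E}[1]$ near \<open>x\<close> representing it, and a
  tractor at \<open>x\<close> is an equivalence class of jets.\<close>

type_synonym ('m, 'n) jet = "('m, 'n) density set"
type_synonym ('m, 'n) tractor = "('m, 'n) jet set"

definition local_sections ::
  "('m::topological_space, 'n::finite) chart set \<Rightarrow> ('m, 'n) tensor2_field set \<Rightarrow> 'm \<Rightarrow>
     ('m, 'n) density set" where
  "local_sections A G x = {s. \<exists>W. open W \<and> x \<in> W \<and> density_section A G 1 W s}"

definition jet2 ::
  "('m::topological_space, 'n::finite) chart set \<Rightarrow> ('m, 'n) tensor2_field set \<Rightarrow> 'm \<Rightarrow>
     ('m, 'n) density \<Rightarrow> ('m, 'n) jet" where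
  "jet2 A G x s = {s' \<in> local_sections A G x. \<forall>g\<in>G. \<forall>c\<in>charts_at A x.
     s' x g = s x g \<and>
     (\<forall>a. pd c a (\<lambda>y. s' y g) x = pd c a (\<lambda>y. s y g) x) \<and>
     (\<forall>a b. pd c a (pd c b (\<lambda>y. s' y g)) x = pd c a (pd c b (\<lambda>y. s y g)) x)}"

definition J2_at ::
  "('m::topological_space, 'n::finite) chart set \<Rightarrow> ('m, 'n) tensor2_field set \<Rightarrow> 'm \<Rightarrow>
     ('m, 'n) jet set" where
  "J2_at A G x = jet2 A G x ` local_sections A G x"

text \<open>The embedding of $\mathcal{E}_{(ab)}[1]$ in $J^2\mathcal{E}[1]$: \<open>S\<close> is sent to the jet with
  vanishing 1-jet part and Hessian \<open>S\<close>.\<close>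

definition jet_incl ::
  "('m::topological_space, 'n::finite) chart set \<Rightarrow> ('m, 'n) tensor2_field set \<Rightarrow> 'm \<Rightarrow>
     (('m, 'n) tensor2_field \<Rightarrow> ('m, 'n) tensor2) \<Rightarrow> ('m, 'n) jet" where
  "jet_incl A G x S = {s \<in> local_sections A G x. \<forall>g\<in>G. \<forall>c\<in>charts_at A x.
     s x g = 0 \<and>
     (\<forall>a. pd c a (\<lambda>y. s y g) x = 0) \<and>
     (\<forall>a b. pd c a (pd c b (\<lambda>y. s y g)) x = S g c $ a $ b)}"

text \<open>Two jets are identified if their difference lies in the image of $\mathcal{E}_{(ab)_0}[1]$.\<close>

definition tractor_rel ::
  "('m::topological_space, 'n::finite) chart set \<Rightarrow> ('m, 'n) tensor2_field set \<Rightarrow> 'm \<Rightarrow>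
     (('m, 'n) jet \<times> ('m, 'n) jet) set" where
  "tractor_rel A G x = {(j1, j2). j1 \<in> J2_at A G x \<and> j2 \<in> J2_at A G x \<and>
     (\<exists>s1\<in>j1. \<exists>s2\<in>j2.
        jet2 A G x (\<lambda>y. \<lambda>g\<in>G. s1 y g - s2 y g) \<in> jet_incl A G x ` tf_sym_at A G 1 x)}"

definition tractor_at ::
  "('m::topological_space, 'n::finite) chart set \<Rightarrow> ('m, 'n) tensor2_field set \<Rightarrow> 'm \<Rightarrow>
     ('m, 'n) tractor set" where
  "tractor_at A G x = J2_at A G x // tractor_rel A G x"

text \<open>The operator $\frac1n D$.\<close>

definition thomas_D ::
  "('m::topological_space, 'n::finite) chart set \<Rightarrow> ('m, 'n) tensor2_field set \<Rightarrow>
     ('m, 'n) density \<Rightarrow> 'm \<Rightarrow> ('m, 'n) tractor" where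
  "thomas_D A G s x = tractor_rel A G x `` {jet2 A G x s}"

text \<open>$(\sigma, \nabla_a\sigma, -\frac1n(\Delta + J)\sigma)$, with densities trivialised by \<open>g\<close> and
  the middle slot in the chart \<open>c\<close>.\<close>

definition D_triple ::
  "('m, 'n::finite) tensor2_field \<Rightarrow> ('m, 'n) chart \<Rightarrow> 'm \<Rightarrow> ('m, 'n) density \<Rightarrow>
     real \<times> (real ^ 'n) \<times> real" where
  "D_triple g c x s =
     (s x g,
      (\<chi> a. pd c a (\<lambda>y. s y g) x),
      - (laplacian g c (\<lambda>y. s y g) x + J_trace g c x * s x g) / real CARD('n))"

text \<open>The splitting of the tractor bundle by \<open>g\<close>: the triple shared by all representatives of the
  tractor \<open>t\<close>.\<close>

definition split_tractor ::
  "('m, 'n::finite) tensor2_field \<Rightarrow> ('m, 'n) chart \<Rightarrow> 'm \<Rightarrow> ('m, 'n) tractor \<Rightarrow>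
     real \<times> (real ^ 'n) \<times> real" where
  "split_tractor g c x t = (THE v. \<forall>s\<in>\<Union>t. D_triple g c x s = v)"

definition slot_top :: "real \<times> (real ^ 'n) \<times> real \<Rightarrow> real" where "slot_top v = fst v"
definition slot_mid :: "real \<times> (real ^ 'n) \<times> real \<Rightarrow> real ^ 'n" where "slot_mid v = fst (snd v)"
definition slot_bot :: "real \<times> (real ^ 'n) \<times> real \<Rightarrow> real" where "slot_bot v = snd (snd v)"

definition tractor_section ::
  "('m::topological_space, 'n::finite) chart set \<Rightarrow> ('m, 'n) tensor2_field set \<Rightarrow>
     ('m \<Rightarrow> ('m, 'n) tractor) \<Rightarrow> bool" where
  "tractor_section A G I \<longleftrightarrow>
     (\<forall>x. I x \<in> tractor_at A G x) \<and>
     (\<forall>g\<in>G. \<forall>c\<in>A.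
        smooth_fn A (chart_dom c) (\<lambda>x. slot_top (split_tractor g c x (I x))) \<and>
        (\<forall>a. smooth_fn A (chart_dom c) (\<lambda>x. slot_mid (split_tractor g c x (I x)) $ a)) \<and>
        smooth_fn A (chart_dom c) (\<lambda>x. slot_bot (split_tractor g c x (I x))))"

text \<open>The canonical projection $X_A : \mathcal{E}^A \to \mathcal{E}[1]$ at \<open>x\<close>, and its contraction
  with a tractor field.\<close>

definition X_proj ::
  "('m, 'n::finite) chart set \<Rightarrow> ('m, 'n) tensor2_field set \<Rightarrow> 'm \<Rightarrow> ('m, 'n) tractor \<Rightarrow>
     ('m, 'n) tensor2_field \<Rightarrow> real" where
  "X_proj A G x t = (\<lambda>g\<in>G. THE r. \<forall>c\<in>charts_at A x. slot_top (split_tractor g c x t) = r)"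

definition X_contr ::
  "('m, 'n::finite) chart set \<Rightarrow> ('m, 'n) tensor2_field set \<Rightarrow> ('m \<Rightarrow> ('m, 'n) tractor) \<Rightarrow>
     ('m, 'n) density" where
  "X_contr A G I = (\<lambda>x. X_proj A G x (I x))"

text \<open>The components of $\nabla_a I$ in the splitting by \<open>g\<close>.\<close>

definition tractor_nabla ::
  "('m, 'n::finite) tensor2_field \<Rightarrow> ('m, 'n) chart \<Rightarrow> 'n \<Rightarrow> ('m \<Rightarrow> ('m, 'n) tractor) \<Rightarrow> 'm \<Rightarrow>
     real \<times> (real ^ 'n) \<times> real" where
  "tractor_nabla g c a I x =
     (let \<sigma> = (\<lambda>y. slot_top (split_tractor g c y (I y)));
          \<mu> = (\<lambda>y. slot_mid (split_tractor g c y (I y)));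
          \<rho> = (\<lambda>y. slot_bot (split_tractor g c y (I y)));
          P = schouten g c x
      in (pd c a \<sigma> x - \<mu> x $ a,
          (\<chi> b. nabla_covec g c a b \<mu> x + g x c $ a $ b * \<rho> x + P $ a $ b * \<sigma> x),
          pd c a \<rho> x - (\<Sum>b\<in>UNIV. P $ a $ b * (\<Sum>e\<in>UNIV. inv_metric g c x $ b $ e * \<mu> x $ e))))"

text \<open>The connection does not depend on the splitting, so the condition is imposed in all of them.\<close>

definition parallel_tractor ::
  "('m::topological_space, 'n::finite) chart set \<Rightarrow> ('m, 'n) tensor2_field set \<Rightarrow>
     ('m \<Rightarrow> ('m, 'n) tractor) \<Rightarrow> bool" where
  "parallel_tractor A G I \<longleftrightarrow> tractor_section A G I \<and>
     (\<forall>g\<in>G. \<forall>x. \<forall>c\<in>charts_at A x. \<forall>a. tractor_nabla g c a I x = (0, 0, 0))"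

definition einstein_scales ::
  "('m, 'n::finite) chart set \<Rightarrow> ('m, 'n) tensor2_field set \<Rightarrow> ('m, 'n) density set" where
  "einstein_scales A G = {\<sigma>. einstein_scale A G \<sigma>}"

definition scale_tractors ::
  "('m::topological_space, 'n::finite) chart set \<Rightarrow> ('m, 'n) tensor2_field set \<Rightarrow>
     ('m \<Rightarrow> ('m, 'n) tractor) set" where
  "scale_tractors A G = {I. parallel_tractor A G I \<and> nowhere_vanishing G (X_contr A G I)}"

end

theory Submission
  imports Defs
begin

text \<open>Write $\rho = -\frac1n(\Delta + J)\sigma$. Under $\hat g = \sigma^{-2}g$ the Schouten tensor
  changes by $\hat P_{ab} = P_{ab} + \sigma^{-1}\nabla_a\nabla_b\sigma
  - \frac12\sigma^{-2}|\nabla\sigma|^2 g_{ab}$, so $\hat g$ is Einstein exactly when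
  $\nabla_a\nabla_b\sigma + P_{ab}\sigma + \rho g_{ab} = 0$, which is the middle slot of
  $\nabla_a(\frac1n D\sigma) = 0$; the top slot says that a parallel tractor is determined by its
  projection. For the bottom slot, $\hat J = -\frac n2(2\sigma\rho + |\nabla\sigma|^2)$ is constant for
  an Einstein metric by the contracted Bianchi identity, and differentiating it gives
  $\sigma(\nabla_a\rho - P_{ab}\nabla^b\sigma) = 0$. This needs neither the conformal invariance of the
  tractor connection nor the prolongation of the middle equation.\<close>

section \<open>Smooth functions on open sets\<close>

text \<open>The change of the Schouten tensor rests on a scalar calculation: with lowered indices,
  both curvatures are polynomial in Christoffel symbols of the first kind and their derivatives, and
  they differ by a Kulkarni-Nomizu product of \<open>g\<close> with one symmetric array
  \<open>Q\<close>. Uniqueness of the Schouten tensor then identifies \<open>Q\<close> with its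
  change. The Einstein equation becomes linear in \<sigma> up to its trace because the quadratic
  term of \<open>Q\<close> cancels once the logarithmic gradient is expressed by \<sigma>.

  The second obstacle is that tractors are classes of jets whose slots are read off by definite
  descriptions. Two densities have the same triple exactly when their difference has vanishing 1-jet
  and trace-free Hessian, and such a Hessian is a tensor of weight 1; so the triple is a complete
  invariant of the class. A tractor field provides only unrelated local representatives at different
  points, so the global scale and its smoothness are recovered from the top slot.\<close>

lemma Ck_on_SucD: "Ck_on (Suc k) S f \<Longrightarrow> Ck_on k S f"
proof (induction k arbitrary: f)
  case 0
  then show ?case by (auto intro: differentiable_imp_continuous_on)
next
  case (Suc k)
  from Suc.prems have "f differentiable_on S"
    and "\<And>v. Ck_on (Suc k) S (\<lambda>x. frechet_derivative f (at x) v)"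
    by (simp_all only: Ck_on.simps(2)[of "Suc k"])
  then show ?case using Suc.IH by simp
qed

lemma smooth_on_deriv:
  "smooth_on S f \<Longrightarrow> smooth_on S (\<lambda>x. frechet_derivative f (at x) v)"
  unfolding smooth_on_def by (metis Ck_on.simps(2))

lemma smooth_on_differentiable:
  assumes "smooth_on S f" "open S" "x \<in> S"
  shows "f differentiable (at x)"
proof -
  have "Ck_on (Suc 0) S f" using assms by (auto simp: smooth_on_def)
  then show ?thesis using assms by (auto simp: differentiable_on_eq_differentiable_at)
qed

lemma smooth_on_continuous: "smooth_on S f \<Longrightarrow> continuous_on S f"
  unfolding smooth_on_def using Ck_on.simps(1) by blast

text \<open>A Frechet derivative sees a neighbourhood of its point, so openness of \<open>S\<close>
  lets agreement on \<open>S\<close> pass to all derivatives. This matters because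
  \<open>chart_inv\<close> is meaningful only on the image of the chart.\<close>

lemma Ck_on_cong:
  assumes "open S" "\<And>x. x \<in> S \<Longrightarrow> f x = g x"
  shows "Ck_on k S f \<Longrightarrow> Ck_on k S g"
  using assms
proof (induction k arbitrary: f g)
  case 0
  then show ?case by (auto cong: continuous_on_cong)
next
  case (Suc k)
  have f: "f differentiable (at x)" if "x \<in> S" for x
    using Suc.prems that by (auto simp: differentiable_on_eq_differentiable_at)
  have eq: "frechet_derivative f (at x) = frechet_derivative g (at x)" if "x \<in> S" for x
    by (rule frechet_derivative_transform_within_open[OF f[OF that] \<open>open S\<close> that])
      (simp add: Suc.prems)
  have "g differentiable (at x)" if "x \<in> S" for x
    using f[OF that] has_derivative_transform_within_open[OF _ \<open>open S\<close> that, of f _ UNIV g] Suc.prems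
    unfolding differentiable_def by blast
  then have "g differentiable_on S"
    using Suc.prems by (simp add: differentiable_on_eq_differentiable_at)
  moreover have "Ck_on k S (\<lambda>x. frechet_derivative g (at x) v)" for v
    by (rule Suc.IH[of "\<lambda>x. frechet_derivative f (at x) v"]) (use Suc.prems eq in auto)
  ultimately show ?case by simp
qed

lemma smooth_on_cong:
  assumes "open S" "\<And>x. x \<in> S \<Longrightarrow> f x = g x"
  shows "smooth_on S f \<longleftrightarrow> smooth_on S g"
  using Ck_on_cong[OF assms(1), of f g] Ck_on_cong[OF assms(1), of g f] assms(2)
  unfolding smooth_on_def by metis

lemma Ck_on_subset: "Ck_on k S f \<Longrightarrow> T \<subseteq> S \<Longrightarrow> Ck_on k T f"
  by (induction k arbitrary: f) (auto intro: continuous_on_subset differentiable_on_subset)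

lemma smooth_on_subset: "smooth_on S f \<Longrightarrow> T \<subseteq> S \<Longrightarrow> smooth_on T f"
  unfolding smooth_on_def using Ck_on_subset by blast

text \<open>Admits an explicit formula in place of \<open>frechet_derivative\<close>, so that each
  closure property reduces to its differentiation rule and the induction hypothesis.\<close>

lemma Ck_on_SucI:
  assumes "open S" "\<And>x. x \<in> S \<Longrightarrow> (f has_derivative f' x) (at x)"
    "\<And>v. Ck_on k S (\<lambda>x. f' x v)"
  shows "Ck_on (Suc k) S f"
proof -
  have "f differentiable_on S"
    using assms by (auto simp: differentiable_on_eq_differentiable_at differentiable_def)
  moreover have "Ck_on k S (\<lambda>x. frechet_derivative f (at x) v)" for v
    by (rule Ck_on_cong[OF assms(1) _ assms(3)[of v]]) (simp add: frechet_derivative_at[OF assms(2)])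
  ultimately show ?thesis by simp
qed

lemma Ck_on_SucE:
  assumes "Ck_on (Suc k) S f" "open S"
  shows "\<And>x. x \<in> S \<Longrightarrow> (f has_derivative frechet_derivative f (at x)) (at x)"
    and "\<And>v. Ck_on k S (\<lambda>x. frechet_derivative f (at x) v)"
  using assms by (auto simp: differentiable_on_eq_differentiable_at frechet_derivative_works)

section \<open>Closure of smoothness under algebra, inversion and composition\<close>

lemma Ck_on_const: "Ck_on k S (\<lambda>_. r)"
  by (induction k arbitrary: r) simp_all

lemma Ck_on_add:
  assumes "open S" "Ck_on k S f" "Ck_on k S g"
  shows "Ck_on k S (\<lambda>x. f x + g x)"
  using assms(2,3)
proof (induction k arbitrary: f g)
  case (Suc k)
  note f = Ck_on_SucE[OF Suc.prems(1) assms(1)] and g = Ck_on_SucE[OF Suc.prems(2) assms(1)]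
  show ?case
    by (rule Ck_on_SucI[OF assms(1) has_derivative_add[OF f(1) g(1)]]) (auto intro: Suc.IH f(2) g(2))
qed (auto intro: continuous_intros)

lemma Ck_on_mult:
  fixes f g :: "'a::real_normed_vector \<Rightarrow> real"
  assumes "open S" "Ck_on k S f" "Ck_on k S g"
  shows "Ck_on k S (\<lambda>x. f x * g x)"
  using assms(2,3)
proof (induction k arbitrary: f g)
  case (Suc k)
  note f = Ck_on_SucE[OF Suc.prems(1) assms(1)] and g = Ck_on_SucE[OF Suc.prems(2) assms(1)]
  show ?case
    by (rule Ck_on_SucI[OF assms(1) has_derivative_mult[OF f(1) g(1)]])
      (auto intro!: Suc.IH Ck_on_add[OF assms(1)] f(2) g(2) Ck_on_SucD[OF Suc.prems(1)]
        Ck_on_SucD[OF Suc.prems(2)])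
qed (auto intro: continuous_intros)

lemma Ck_on_inverse:
  fixes f :: "'a::real_normed_vector \<Rightarrow> real"
  assumes "open S" "Ck_on k S f" "\<And>x. x \<in> S \<Longrightarrow> f x \<noteq> 0"
  shows "Ck_on k S (\<lambda>x. inverse (f x))"
  using assms(2)
proof (induction k)
  case (Suc k)
  note f = Ck_on_SucE[OF Suc.prems(1) assms(1)]
  \<comment> \<open>The derivative of the reciprocal is built from the reciprocal itself and the
    derivative of \<open>f\<close>, so \<open>f\<close> may stay fixed in the induction.\<close>
  have i: "Ck_on k S (\<lambda>x. inverse (f x))" by (rule Suc.IH[OF Ck_on_SucD[OF Suc.prems]])
  have n: "Ck_on k S h \<Longrightarrow> Ck_on k S (\<lambda>x. - h x)" for h :: "'a \<Rightarrow> real"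
    using Ck_on_mult[OF assms(1) Ck_on_const[of k S "-1"], of h] by simp
  show ?case
  proof (rule Ck_on_SucI[OF assms(1)])
    fix x assume "x \<in> S"
    then show "((\<lambda>x. inverse (f x)) has_derivative
      (\<lambda>v. - (inverse (f x) * frechet_derivative f (at x) v * inverse (f x)))) (at x)"
      by (intro Deriv.has_derivative_inverse assms(3) f(1))
  qed (intro n Ck_on_mult assms(1) f(2) i)
qed (use assms in \<open>auto intro: continuous_intros\<close>)

lemma smooth_on_const: "smooth_on S (\<lambda>_. r)"
  by (simp add: smooth_on_def Ck_on_const)

lemma smooth_on_add: "open S \<Longrightarrow> smooth_on S f \<Longrightarrow> smooth_on S g \<Longrightarrow> smooth_on S (\<lambda>x. f x + g x)"
  by (simp add: smooth_on_def Ck_on_add)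

lemma smooth_on_mult:
  fixes f g :: "'a::real_normed_vector \<Rightarrow> real"
  shows "open S \<Longrightarrow> smooth_on S f \<Longrightarrow> smooth_on S g \<Longrightarrow> smooth_on S (\<lambda>x. f x * g x)"
  by (simp add: smooth_on_def Ck_on_mult)

lemma smooth_on_inverse:
  fixes f :: "'a::real_normed_vector \<Rightarrow> real"
  shows "open S \<Longrightarrow> smooth_on S f \<Longrightarrow> (\<And>x. x \<in> S \<Longrightarrow> f x \<noteq> 0) \<Longrightarrow> smooth_on S (\<lambda>x. inverse (f x))"
  by (simp add: smooth_on_def Ck_on_inverse)

lemma Ck_on_component:
  fixes f :: "'a::real_normed_vector \<Rightarrow> real ^ 'n::finite"
  assumes "open S" "Ck_on k S f"
  shows "Ck_on k S (\<lambda>x. f x $ i)"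
  using assms(2)
proof (induction k arbitrary: f)
  case (Suc k)
  note f = Ck_on_SucE[OF Suc.prems(1) assms(1)]
  show ?case
    by (rule Ck_on_SucI[OF assms(1) bounded_linear.has_derivative[OF bounded_linear_vec_nth f(1)]])
      (auto intro: Suc.IH f(2))
qed (auto intro: continuous_intros)

lemma linear_sum_axis:
  fixes L :: "real ^ 'n::finite \<Rightarrow> real"
  assumes "linear L"
  shows "L v = (\<Sum>i\<in>UNIV. L (axis i 1) * v $ i)"
proof -
  have "L v = L (\<Sum>i\<in>UNIV. v $ i *\<^sub>R axis i 1)"
    by (simp add: basis_expansion flip: scalar_mult_eq_scaleR)
  also have "\<dots> = (\<Sum>i\<in>UNIV. L (axis i 1) * v $ i)"
    by (simp add: linear_sum[OF assms] linear_cmul[OF assms] mult.commute)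
  finally show ?thesis .
qed

text \<open>The chain rule is written as a sum over coordinates because the closure rules handle
  finite sums of products; it is also the form needed between charts.\<close>

lemma has_derivative_compose_axis:
  fixes f :: "real ^ 'n::finite \<Rightarrow> real" and h :: "'a::real_normed_vector \<Rightarrow> real ^ 'n"
  assumes "(h has_derivative h') (at x)" "f differentiable (at (h x))"
  shows "((\<lambda>x. f (h x)) has_derivative
    (\<lambda>v. \<Sum>i\<in>UNIV. frechet_derivative f (at (h x)) (axis i 1) * (h' v $ i))) (at x)"
proof -
  have "linear (frechet_derivative f (at (h x)))"
    by (rule linear_frechet_derivative[OF assms(2)])
  note eq = linear_sum_axis[OF this, of "h' _", symmetric]
  show ?thesis
    unfolding eq
    using has_derivative_compose[OF assms(1) assms(2)[unfolded frechet_derivative_works]] .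
qed

text \<open>The partial derivatives of \<open>f\<close> are composed with the same \<open>h\<close>
  again, so the induction generalises \<open>f\<close> alone.\<close>

lemma Ck_on_compose:
  fixes f :: "real ^ 'n::finite \<Rightarrow> real" and h :: "'a::real_normed_vector \<Rightarrow> real ^ 'n"
  assumes "open S" "open T" "h ` S \<subseteq> T" "Ck_on k T f" "smooth_on S h"
  shows "Ck_on k S (\<lambda>x. f (h x))"
  using assms(4)
proof (induction k arbitrary: f)
  case 0
  then show ?case
    using assms(3) continuous_on_compose2 smooth_on_continuous[OF assms(5)] by (metis Ck_on.simps(1))
next
  case (Suc k)
  note f = Ck_on_SucE[OF Suc.prems(1) assms(2)]
  have h: "Ck_on (Suc k) S h" using assms(5) by (auto simp only: smooth_on_def)
  note h' = Ck_on_SucE[OF h assms(1)]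
  show ?case
  proof (rule Ck_on_SucI[OF assms(1) has_derivative_compose_axis[OF h'(1)]])
    fix x assume "x \<in> S"
    then have "h x \<in> T" using assms(3) by auto
    then show "f differentiable (at (h x))" using f(1) by (auto simp: differentiable_def)
  next
    fix v
    have s: "Ck_on k S (\<lambda>x. \<Sum>i\<in>I. frechet_derivative f (at (h x)) (axis i 1) *
        (frechet_derivative h (at x) v $ i))" if "finite I" for I
      using that
      by induction (auto intro!: Ck_on_const Ck_on_add Ck_on_mult assms(1) Suc.IH f(2)
          Ck_on_component h'(2))
    show "Ck_on k S (\<lambda>x. \<Sum>i\<in>UNIV. frechet_derivative f (at (h x)) (axis i 1) *
        (frechet_derivative h (at x) v $ i))" by (rule s) simp
  qed
qed

lemma smooth_on_compose:
  fixes f :: "real ^ 'n::finite \<Rightarrow> real" and h :: "'a::real_normed_vector \<Rightarrow> real ^ 'n"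
  assumes "open S" "open T" "h ` S \<subseteq> T" "smooth_on T f" "smooth_on S h"
  shows "smooth_on S (\<lambda>x. f (h x))"
  using Ck_on_compose[OF assms(1-3) _ assms(5)] assms(4) by (auto simp: smooth_on_def)

lemma smooth_on_component:
  fixes f :: "'a::real_normed_vector \<Rightarrow> real ^ 'n::finite"
  shows "open S \<Longrightarrow> smooth_on S f \<Longrightarrow> smooth_on S (\<lambda>x. f x $ i)"
  by (simp add: smooth_on_def Ck_on_component)

text \<open>The second difference of \<open>f\<close> over a small parallelogram is, by two applications of the mean
  value theorem, a value of the second derivative at a nearby point.\<close>

lemma second_difference:
  fixes f :: "'a::real_normed_vector \<Rightarrow> real"
  assumes S: "\<And>s t. 0 \<le> s \<Longrightarrow> s \<le> h \<Longrightarrow> 0 \<le> t \<Longrightarrow> t \<le> h \<Longrightarrow> x + s *\<^sub>R u + t *\<^sub>R v \<in> S"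
    and h: "h > 0"
    and f: "\<And>y. y \<in> S \<Longrightarrow> (f has_derivative f' y) (at y)"
    and f': "\<And>y. y \<in> S \<Longrightarrow> ((\<lambda>y. f' y u) has_derivative f'' y) (at y)"
  obtains s t where "0 \<le> s" "s \<le> h" "0 \<le> t" "t \<le> h"
    "f (x + h *\<^sub>R u + h *\<^sub>R v) - f (x + h *\<^sub>R u) - f (x + h *\<^sub>R v) + f x
      = h * h * f'' (x + s *\<^sub>R u + t *\<^sub>R v) v"
proof -
  \<comment> \<open>\<phi> is the increment in direction \<open>v\<close> as a function of the step
    in direction \<open>u\<close>. The mean value theorem in \<open>s\<close> leaves a difference in
    direction \<open>v\<close>, to which it is applied again in \<open>t\<close>. The term
    \<open>0 *\<^sub>R v\<close> gives both values the shape required by \<open>d\<close>.\<close>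
  define \<phi> where "\<phi> s = f (x + s *\<^sub>R u + h *\<^sub>R v) - f (x + s *\<^sub>R u + 0 *\<^sub>R v)" for s
  have d: "((\<lambda>s. f (x + s *\<^sub>R u + t *\<^sub>R v)) has_derivative (\<lambda>r. r * f' (x + s *\<^sub>R u
      + t *\<^sub>R v) u)) (at s)"
    if "0 \<le> s" "s \<le> h" "0 \<le> t" "t \<le> h" for s t
  proof -
    have 1: "((\<lambda>s. x + s *\<^sub>R u + t *\<^sub>R v) has_derivative (\<lambda>r. r *\<^sub>R u)) (at s)"
      by (auto intro!: derivative_eq_intros)
    have 2: "linear (f' (x + s *\<^sub>R u + t *\<^sub>R v))"
      using f[OF S[OF that]] has_derivative_linear by blast
    from has_derivative_compose[OF 1 f[OF S[OF that]]] show ?thesis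
      by (simp add: linear_cmul[OF 2])
  qed
  have dd: "((\<lambda>t. f' (x + s *\<^sub>R u + t *\<^sub>R v) u) has_derivative
      (\<lambda>r. r * f'' (x + s *\<^sub>R u + t *\<^sub>R v) v)) (at t)"
    if "0 \<le> s" "s \<le> h" "0 \<le> t" "t \<le> h" for s t
  proof -
    have 1: "((\<lambda>t. x + s *\<^sub>R u + t *\<^sub>R v) has_derivative (\<lambda>r. r *\<^sub>R v)) (at t)"
      by (auto intro!: derivative_eq_intros)
    have 2: "linear (f'' (x + s *\<^sub>R u + t *\<^sub>R v))"
      using f'[OF S[OF that]] has_derivative_linear by blast
    from has_derivative_compose[OF 1 f'[OF S[OF that]]] show ?thesis
      by (simp add: linear_cmul[OF 2])
  qed
  have "(\<phi> has_derivative (\<lambda>r. r * (f' (x + s *\<^sub>R u + h *\<^sub>R v) u - f' (x + s *\<^sub>R u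
      + 0 *\<^sub>R v) u))) (at s)"
    if "0 \<le> s" "s \<le> h" for s
    unfolding \<phi>_def right_diff_distrib
    by (intro has_derivative_diff d) (use that h in auto)
  then obtain s where s: "0 < s" "s < h"
    "\<phi> h - \<phi> 0 = (h - 0) * (f' (x + s *\<^sub>R u + h *\<^sub>R v) u - f' (x + s *\<^sub>R u + 0 *\<^sub>R v) u)"
    using mvt[of 0 h \<phi> "\<lambda>s r. r * (f' (x + s *\<^sub>R u + h *\<^sub>R v) u - f' (x + s *\<^sub>R u + 0 *\<^sub>R v) u)"] h
      has_derivative_at_withinI has_derivative_continuous_on by (smt (verit) atLeastAtMost_iff)
  obtain t where t: "0 < t" "t < h"
    "f' (x + s *\<^sub>R u + h *\<^sub>R v) u - f' (x + s *\<^sub>R u + 0 *\<^sub>R v) u = (h - 0) * f'' (x + s *\<^sub>R u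
        + t *\<^sub>R v) v"
    using mvt[of 0 h "\<lambda>t. f' (x + s *\<^sub>R u + t *\<^sub>R v) u" "\<lambda>t r. r * f'' (x + s *\<^sub>R u + t *\<^sub>R v) v"]
      h s dd[of s] has_derivative_at_withinI has_derivative_continuous_on
          by (smt (verit) atLeastAtMost_iff)
  show thesis
    by (rule that[of s t]) (use s t in \<open>auto simp: \<phi>_def algebra_simps\<close>)
qed

text \<open>The second difference of \<open>f\<close> is symmetric in \<open>u\<close> and
  \<open>v\<close>. Evaluated in both orders it gives two points near \<open>x\<close> where the two
  mixed derivatives coincide, which contradicts continuity if they differ at
  \<open>x\<close>.\<close>

lemma smooth_on_deriv_commute:
  fixes f :: "'a::real_normed_vector \<Rightarrow> real"
  assumes "open S" "smooth_on S f" "x \<in> S"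
  shows "frechet_derivative (\<lambda>y. frechet_derivative f (at y) u) (at x) v =
    frechet_derivative (\<lambda>y. frechet_derivative f (at y) v) (at x) u" (is "?p u v x = ?p v u x")
proof (rule ccontr)
  assume ne: "?p u v x \<noteq> ?p v u x"
  define e where "e = \<bar>?p u v x - ?p v u x\<bar> / 2"
  have e: "e > 0" using ne by (simp add: e_def)
  note 2 = smooth_on_deriv[OF assms(2)]
  have c: "isCont (\<lambda>x. ?p u v x) x" for u v
    using smooth_on_continuous[OF smooth_on_deriv[OF 2]] assms by
        (auto simp: continuous_on_eq_continuous_at)
  obtain d1 where d1: "d1 > 0" "\<And>y. dist y x < d1 \<Longrightarrow> dist (?p u v y) (?p u v x) < e"
    using c[of u v] e unfolding continuous_at_eps_delta by metis
  obtain d2 where d2: "d2 > 0" "\<And>y. dist y x < d2 \<Longrightarrow> dist (?p v u y) (?p v u x) < e"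
    using c[of v u] e unfolding continuous_at_eps_delta by metis
  obtain d3 where d3: "d3 > 0" "ball x d3 \<subseteq> S"
    using assms by (meson openE)
  define d where "d = min d1 (min d2 d3)"
  have d: "d > 0" using d1 d2 d3 by (simp add: d_def)
  \<comment> \<open>At this scale the whole parallelogram lies within distance \<open>d\<close> of
    \<open>x\<close>; the summand 1 makes the inequality strict and covers
    \<open>u = v = 0\<close>.\<close>
  define h where "h = d / (norm u + norm v + 1)"
  have h: "h > 0" using d by (simp add: h_def add_nonneg_pos)
  have near: "dist (x + s *\<^sub>R u + t *\<^sub>R v) x < d" if "0 \<le> s" "s \<le> h" "0 \<le> t" "t \<le> h" for s t
  proof -
    have "dist (x + s *\<^sub>R u + t *\<^sub>R v) x \<le> s * norm u + t * norm v"
      using norm_triangle_ineq[of "s *\<^sub>R u" "t *\<^sub>R v"] that by (simp add: dist_norm add.assoc)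
    also have "\<dots> \<le> h * norm u + h * norm v"
      using that by (intro add_mono mult_right_mono) auto
    also have "\<dots> < h * (norm u + norm v + 1)" using h by (simp add: algebra_simps)
    also have "\<dots> = d" using norm_ge_zero[of u] norm_ge_zero[of v] by
        (simp add: h_def add_nonneg_eq_0_iff)
    finally show ?thesis .
  qed
  have inS: "x + s *\<^sub>R u + t *\<^sub>R v \<in> S" if "0 \<le> s" "s \<le> h" "0 \<le> t" "t \<le> h" for s t
    using near[OF that] d3 by (auto simp: d_def dist_commute subset_iff)
  have inS': "x + s *\<^sub>R v + t *\<^sub>R u \<in> S" if "0 \<le> s" "s \<le> h" "0 \<le> t" "t \<le> h" for s t
    using inS[of t s] that by (simp add: algebra_simps)
  have f: "(f has_derivative frechet_derivative f (at y)) (at y)" if "y \<in> S" for y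
    using smooth_on_differentiable[OF assms(2,1) that] by (simp add: frechet_derivative_works)
  have f': "((\<lambda>y. frechet_derivative f (at y) w) has_derivative
      frechet_derivative (\<lambda>y. frechet_derivative f (at y) w) (at y)) (at y)" if "y \<in> S" for y w
    using smooth_on_differentiable[OF 2 assms(1) that] by (simp add: frechet_derivative_works)
  obtain s t where st: "0 \<le> s" "s \<le> h" "0 \<le> t" "t \<le> h"
    "f (x + h *\<^sub>R u + h *\<^sub>R v) - f (x + h *\<^sub>R u) - f (x + h *\<^sub>R v) + f x
      = h * h * ?p u v (x + s *\<^sub>R u + t *\<^sub>R v)"
    by (rule second_difference[where S = S and u = u and v = v, OF inS h f f'])
  obtain s' t' where st': "0 \<le> s'" "s' \<le> h" "0 \<le> t'" "t' \<le> h"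
    "f (x + h *\<^sub>R v + h *\<^sub>R u) - f (x + h *\<^sub>R v) - f (x + h *\<^sub>R u) + f x
      = h * h * ?p v u (x + s' *\<^sub>R v + t' *\<^sub>R u)"
    by (rule second_difference[where S = S and u = v and v = u, OF inS' h f f'])
  have "h * h * ?p u v (x + s *\<^sub>R u + t *\<^sub>R v) = h * h * ?p v u (x + s' *\<^sub>R v + t' *\<^sub>R u)"
    using st(5) st'(5) by (simp add: algebra_simps)
  then have eq: "?p u v (x + s *\<^sub>R u + t *\<^sub>R v) = ?p v u (x + t' *\<^sub>R u + s' *\<^sub>R v)"
    using h by (simp add: algebra_simps)
  have "dist (?p u v (x + s *\<^sub>R u + t *\<^sub>R v)) (?p u v x) < e"
    using d1(2) near[of s t] st by (simp add: d_def)
  moreover have "dist (?p v u (x + t' *\<^sub>R u + s' *\<^sub>R v)) (?p v u x) < e"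
    using d2(2) near[of t' s'] st' by (simp add: d_def)
  \<comment> \<open>Triangle inequality: no number is closer than half of the gap to both
    \<open>p\<close> and \<open>q\<close>.\<close>
  moreover have "\<bar>p - q\<bar> / 2 \<le> \<bar>a - p\<bar> \<or> \<bar>p - q\<bar> / 2 \<le> \<bar>a - q\<bar>" for a p q :: real
    by (simp add: abs_if) argo
  ultimately show False
    using eq unfolding e_def dist_real_def by (metis not_le)
qed

section \<open>Calculus in a chart\<close>

text \<open>\<open>W\<close> is kept apart from the chart domain because calculations are also made
  on chart overlaps and on neighbourhoods where a local section is defined.\<close>

locale chart_region =
  fixes c :: "('m, 'n::finite) chart" and W :: "'m set"
  assumes W_dom: "W \<subseteq> chart_dom c"
    and inj_coords: "inj_on (coords c) (chart_dom c)"
    and open_image: "open (coords c ` W)"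
begin

lemma chart_inv_coords: "x \<in> W \<Longrightarrow> chart_inv c (coords c x) = x"
  using W_dom inj_coords by (auto simp: chart_inv_def)

definition sm :: "('m \<Rightarrow> real) \<Rightarrow> bool" where
  "sm f \<longleftrightarrow> smooth_on (coords c ` W) (f \<circ> chart_inv c)"

lemma sm_cong: "(\<And>y. y \<in> W \<Longrightarrow> f y = h y) \<Longrightarrow> sm f \<longleftrightarrow> sm h"
  unfolding sm_def by (rule smooth_on_cong[OF open_image]) (auto simp: chart_inv_coords)

lemma sm_const: "sm (\<lambda>_. r)"
  by (simp add: sm_def comp_def smooth_on_const)

lemma sm_add: "sm f \<Longrightarrow> sm h \<Longrightarrow> sm (\<lambda>y. f y + h y)"
  using smooth_on_add[OF open_image] by (auto simp: sm_def comp_def)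

lemma sm_mult: "sm f \<Longrightarrow> sm h \<Longrightarrow> sm (\<lambda>y. f y * h y)"
  using smooth_on_mult[OF open_image] by (auto simp: sm_def comp_def)

lemma sm_minus: "sm f \<Longrightarrow> sm (\<lambda>y. - f y)"
  using sm_mult[OF sm_const[of "-1"], of f] by simp

lemma sm_diff: "sm f \<Longrightarrow> sm h \<Longrightarrow> sm (\<lambda>y. f y - h y)"
  using sm_add[OF _ sm_minus, of f h] by simp

lemma sm_inverse: "sm f \<Longrightarrow> (\<And>y. y \<in> W \<Longrightarrow> f y \<noteq> 0) \<Longrightarrow> sm (\<lambda>y. inverse (f y))"
  unfolding sm_def comp_def by (rule smooth_on_inverse[OF open_image]) (auto simp: chart_inv_coords)

lemma sm_divide: "sm f \<Longrightarrow> sm h \<Longrightarrow> (\<And>y. y \<in> W \<Longrightarrow> h y \<noteq> 0) \<Longrightarrow> sm (\<lambda>y. f y / h y)"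
  using sm_mult[OF _ sm_inverse] by (simp add: divide_inverse)

lemma sm_divide_const: "sm f \<Longrightarrow> sm (\<lambda>y. f y / r)"
  using sm_mult[OF _ sm_const[of "inverse r"]] by (simp add: divide_inverse)

lemma sm_power: "sm f \<Longrightarrow> sm (\<lambda>y. f y ^ k)"
  by (induction k) (auto intro: sm_const sm_mult)

lemma sm_sum: "(\<And>i. i \<in> I \<Longrightarrow> sm (f i)) \<Longrightarrow> sm (\<lambda>y. \<Sum>i\<in>I. f i y)"
  by (induction I rule: infinite_finite_induct) (auto intro: sm_const sm_add)

lemma sm_prod: "(\<And>i. i \<in> I \<Longrightarrow> sm (f i)) \<Longrightarrow> sm (\<lambda>y. \<Prod>i\<in>I. f i y)"
  by (induction I rule: infinite_finite_induct) (auto intro: sm_const sm_mult)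

lemma sm_pd: "sm f \<Longrightarrow> sm (pd c a f)"
proof -
  assume "sm f"
  then have "smooth_on (coords c ` W) (\<lambda>u. frechet_derivative (f \<circ> chart_inv c) (at u) (axis a 1))"
    unfolding sm_def by (rule smooth_on_deriv)
  then show ?thesis
    unfolding sm_def
    by (rule smooth_on_cong[OF open_image, THEN iffD1, rotated])
      (auto simp: pd_def chart_inv_coords)
qed

lemmas sm_intros =
  sm_const sm_add sm_mult sm_minus sm_diff sm_divide_const sm_power sm_sum sm_prod sm_pd

lemma sm_has_derivative:
  assumes "sm f" "x \<in> W"
  shows "((f \<circ> chart_inv c) has_derivative frechet_derivative (f \<circ> chart_inv c) (at (coords c x)))
    (at (coords c x))"
  using smooth_on_differentiable[OF assms(1)[unfolded sm_def] open_image] assms(2)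
  by (auto simp: frechet_derivative_works)

lemma pd_eqI:
  assumes "((f \<circ> chart_inv c) has_derivative f') (at (coords c x))"
  shows "pd c a f x = f' (axis a 1)"
  unfolding pd_def using frechet_derivative_at[OF assms] by simp

text \<open>Both functions satisfy the same \<open>has_derivative\<close> statements at the point,
  so the choice inside \<open>frechet_derivative\<close> is the same. This is how an identity valid
  on \<open>W\<close> gets differentiated.\<close>

lemma pd_cong:
  assumes "x \<in> W" "\<And>y. y \<in> W \<Longrightarrow> f y = h y"
  shows "pd c a f x = pd c a h x"
proof -
  have "((f \<circ> chart_inv c) has_derivative f') (at (coords c x)) \<longleftrightarrow>
      ((h \<circ> chart_inv c) has_derivative f') (at (coords c x))" for f'
    by (intro iffI; erule has_derivative_transform_within_open[OF _ open_image])
      (use assms in \<open>auto simp: chart_inv_coords\<close>)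
  then show ?thesis by (simp add: pd_def frechet_derivative_def)
qed

lemma pd_const: "pd c a (\<lambda>_. r) x = 0"
  by (simp add: pd_def comp_def)

lemma pd_add: "x \<in> W \<Longrightarrow> sm f \<Longrightarrow> sm h \<Longrightarrow> pd c a (\<lambda>y. f y + h y) x = pd c a f x + pd c a h x"
  by (subst pd_eqI[OF has_derivative_add[OF sm_has_derivative[of f] sm_has_derivative[of h],
          unfolded comp_def, folded comp_def[of "\<lambda>y. f y + h y" "chart_inv c"]]])
    (auto simp: pd_def comp_def)

lemma pd_mult:
  assumes "x \<in> W" "sm f" "sm h"
  shows "pd c a (\<lambda>y. f y * h y) x = pd c a f x * h x + f x * pd c a h x"
  by (subst pd_eqI[OF has_derivative_mult[OF sm_has_derivative[OF assms(2,1)] sm_has_derivative[OF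
      assms(3,1)],
          unfolded comp_def, folded comp_def[of "\<lambda>y. f y * h y" "chart_inv c"]]])
    (auto simp: pd_def comp_def chart_inv_coords assms)

lemma pd_cmult: "x \<in> W \<Longrightarrow> sm f \<Longrightarrow> pd c a (\<lambda>y. r * f y) x = r * pd c a f x"
  by (simp add: pd_mult sm_const pd_const)

lemma pd_minus: "x \<in> W \<Longrightarrow> sm f \<Longrightarrow> pd c a (\<lambda>y. - f y) x = - pd c a f x"
  using pd_cmult[of x f a "-1"] by simp

lemma pd_diff: "x \<in> W \<Longrightarrow> sm f \<Longrightarrow> sm h \<Longrightarrow> pd c a (\<lambda>y. f y - h y) x = pd c a f x - pd c a h x"
  using pd_add[of x f "\<lambda>y. - h y" a] by (simp add: sm_minus pd_minus)

lemma pd_divide_const: "x \<in> W \<Longrightarrow> sm f \<Longrightarrow> pd c a (\<lambda>y. f y / r) x = pd c a f x / r"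
  using pd_cmult[of x f a "inverse r"] by (simp add: divide_inverse mult.commute)

lemma pd_sum:
  "x \<in> W \<Longrightarrow> (\<And>i. i \<in> I \<Longrightarrow> sm (f i)) \<Longrightarrow> pd c a (\<lambda>y. \<Sum>i\<in>I. f i y) x = (\<Sum>i\<in>I. pd c a (f i) x)"
  by (induction I rule: infinite_finite_induct) (simp_all add: pd_const pd_add sm_sum)

lemma pd_divide:
  assumes "x \<in> W" "sm f" "sm h" "\<And>y. y \<in> W \<Longrightarrow> h y \<noteq> 0"
  shows "pd c a (\<lambda>y. f y / h y) x = (pd c a f x - f x / h x * pd c a h x) / h x"
proof -
  have q: "sm (\<lambda>y. f y / h y)" by (rule sm_divide[OF assms(2-4)])
  have "pd c a f x = pd c a (\<lambda>y. f y / h y * h y) x"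
    by (rule pd_cong[OF assms(1)]) (simp add: assms(4))
  then have "pd c a f x = pd c a (\<lambda>y. f y / h y) x * h x + f x / h x * pd c a h x"
    by (simp only: pd_mult[OF assms(1) q assms(3)])
  then show ?thesis using assms(4)[OF assms(1)] by simp
qed

lemmas pd_rules = pd_const pd_add pd_mult pd_minus pd_diff pd_divide_const pd_sum

lemma pd_commute:
  assumes "x \<in> W" "sm f"
  shows "pd c a (pd c b f) x = pd c b (pd c a f) x"
proof -
  let ?F = "f \<circ> chart_inv c" and ?u = "coords c x"
  have *: "pd c a (pd c b f) x =
      frechet_derivative (\<lambda>u. frechet_derivative ?F (at u) (axis b 1)) (at ?u) (axis a 1)" for a b
  proof -
    have d: "(\<lambda>u. frechet_derivative ?F (at u) (axis b 1)) differentiable at ?u"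
      using smooth_on_differentiable[OF smooth_on_deriv[OF assms(2)[unfolded sm_def]] open_image]
          assms(1)
      by blast
    have "frechet_derivative (\<lambda>u. frechet_derivative ?F (at u) (axis b 1)) (at ?u) =
        frechet_derivative (pd c b f \<circ> chart_inv c) (at ?u)"
      by (rule frechet_derivative_transform_within_open[OF d open_image])
        (use assms(1) in \<open>auto simp: pd_def chart_inv_coords\<close>)
    then show ?thesis by (simp add: pd_def[of c a])
  qed
  show ?thesis
    unfolding * by (rule smooth_on_deriv_commute[OF open_image assms(2)[unfolded sm_def]])
      (use assms(1) in auto)
qed

lemma sm_subset:
  assumes "sm f" "V \<subseteq> W" "open (coords c ` V)"
  shows "chart_region.sm c V f"
proof -
  interpret V: chart_region c V
    using W_dom inj_coords assms by unfold_locales auto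
  show ?thesis
    using assms(1,2) unfolding sm_def V.sm_def by (auto intro: smooth_on_subset)
qed

end

section \<open>Curvature in a chart\<close>

text \<open>The traces over the first and over the last pair contract the symmetric \<open>H\<close>
  with a skew pair and vanish. The other four agree up to sign, so one of them decides.\<close>

lemma totally_trace_free_iff:
  fixes H :: "real ^ 'n::finite ^ 'n"
  assumes H: "\<And>i j. H $ i $ j = H $ j $ i"
    and C1: "\<And>i j k l. C i j k l = - C j i k l" and C2: "\<And>i j k l. C i j k l = - C i j l k"
  shows "totally_trace_free H C \<longleftrightarrow> (\<forall>k l. (\<Sum>i\<in>UNIV. \<Sum>j\<in>UNIV. H $ i $ j * C i k j l) = 0)"
proof -
  have skew: "(\<Sum>i\<in>UNIV. \<Sum>j\<in>UNIV. H $ i $ j * X i j) = 0"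
    if "\<And>i j. X i j = - X j i" for X :: "'n \<Rightarrow> 'n \<Rightarrow> real"
  proof -
    have "(\<Sum>i\<in>UNIV. \<Sum>j\<in>UNIV. H $ i $ j * X i j) = (\<Sum>i\<in>UNIV. \<Sum>j\<in>UNIV. H $ j $ i * X j i)"
      by (rule sum.swap)
    also have "\<dots> = (\<Sum>i\<in>UNIV. \<Sum>j\<in>UNIV. - (H $ i $ j * X i j))"
      by (intro sum.cong refl) (use H that in \<open>metis minus_mult_right\<close>)
    finally show ?thesis by (simp add: sum_negf)
  qed
  have neg: "(\<Sum>i\<in>UNIV. \<Sum>j\<in>UNIV. H $ i $ j * X i j) = - (\<Sum>i\<in>UNIV. \<Sum>j\<in>UNIV. H $ i $ j * Y i j)"
    if "\<And>i j. X i j = - Y i j" for X Y :: "'n \<Rightarrow> 'n \<Rightarrow> real"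
    by (simp add: that sum_negf)
  show ?thesis
    unfolding totally_trace_free_def
    using skew[of "\<lambda>i j. C i j _ _", OF C1] skew[of "\<lambda>i j. C _ _ i j", OF C2]
      neg[of "\<lambda>i j. C i _ _ j" "\<lambda>i j. C i _ j _", OF C2]
      neg[of "\<lambda>i j. C _ i j _" "\<lambda>i j. C i _ j _", OF C1]
      neg[of "\<lambda>i j. C _ i _ j" "\<lambda>i j. C i _ _ j", OF C1]
    by auto
qed

lemma matrix_inv_invertible:
  fixes A :: "real ^ 'n::finite ^ 'n"
  assumes "invertible A"
  shows matrix_inv_right: "A ** matrix_inv A = mat 1" and matrix_inv_left: "matrix_inv A ** A = mat 1"
  using someI_ex[OF assms[unfolded invertible_def]] by (auto simp: matrix_inv_def)

lemma matrix_inv_eqI: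
  fixes A :: "real ^ 'n::finite ^ 'n"
  assumes "A ** B = mat 1"
  shows "matrix_inv A = B"
proof -
  have "invertible A" using assms by (metis invertible_def matrix_left_right_inverse)
  then have "matrix_inv A ** (A ** B) = B"
    by (simp add: matrix_mul_assoc matrix_inv_left)
  then show ?thesis by (simp add: assms)
qed

locale metric_region = chart_region c W
  for c :: "('m, 'n::finite) chart" and W +
  fixes g :: "('m, 'n) tensor2_field"
  assumes sm_g: "sm (\<lambda>y. g y c $ a $ b)"
    and g_sym: "y \<in> W \<Longrightarrow> g y c $ a $ b = g y c $ b $ a"
    and g_invertible: "y \<in> W \<Longrightarrow> invertible (g y c)"
    and dim: "CARD('n) \<ge> 3"
begin

section \<open>Raising, lowering and tracing with the metric\<close>

abbreviation "H \<equiv> inv_metric g c"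
abbreviation "\<Gamma> \<equiv> christoffel g c"
abbreviation "Rl \<equiv> riem_low g c"

lemma g_H: "y \<in> W \<Longrightarrow> (\<Sum>e\<in>UNIV. g y c $ a $ e * H y $ e $ b) = (if a = b then 1 else 0)"
  using matrix_inv_right[OF g_invertible[of y]]
  by (simp add: inv_metric_def matrix_matrix_mult_def mat_def vec_eq_iff)

lemma H_g: "y \<in> W \<Longrightarrow> (\<Sum>e\<in>UNIV. H y $ a $ e * g y c $ e $ b) = (if a = b then 1 else 0)"
  using matrix_inv_left[OF g_invertible[of y]]
  by (simp add: inv_metric_def matrix_matrix_mult_def mat_def vec_eq_iff)

lemma H_sym:
  assumes "y \<in> W"
  shows "H y $ a $ b = H y $ b $ a"
proof -
  have t: "transpose (g y c) = g y c" using g_sym[OF assms] by (simp add: transpose_def vec_eq_iff)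
  have "transpose (H y) ** g y c = transpose (g y c ** H y)"
    by (simp add: matrix_transpose_mul t)
  also have "\<dots> = mat 1" using matrix_inv_right[OF g_invertible[OF assms]] by (simp add: inv_metric_def)
  finally have "transpose (H y) ** (g y c ** H y) = H y" by (simp add: matrix_mul_assoc)
  then have "transpose (H y) = H y"
    using matrix_inv_right[OF g_invertible[OF assms]] by (simp add: inv_metric_def)
  then have "transpose (H y) $ a $ b = H y $ a $ b" by simp
  then show ?thesis by (simp add: transpose_def)
qed

text \<open>By Cramer's rule an entry of the inverse matrix is a quotient of two determinants, which
  are polynomials in smooth functions.\<close>

lemma sm_H: "sm (\<lambda>y. H y $ a $ b)"
proof -
  have sm_det: "sm (\<lambda>y. det ((\<chi> i j. M i j y) :: real ^ 'n ^ 'n))"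
      if "\<And>i j. sm (M i j)" for M :: "'n \<Rightarrow> 'n \<Rightarrow> 'm \<Rightarrow> real"
    unfolding det_def by (simp, intro sm_intros that)
  have d: "det (g y c) \<noteq> 0" if "y \<in> W" for y
    using g_invertible[OF that] by (simp add: invertible_det_nz)
  have "H y $ a $ b = det (\<chi> i j. if j = a then axis b 1 $ i else g y c $ i $ j) / det (g y c)"
    if "y \<in> W" for y
  proof -
    have "g y c *v (H y *v axis b 1) = axis b 1"
      using matrix_inv_right[OF g_invertible[OF that]]
      by (simp add: matrix_vector_mul_assoc inv_metric_def)
    then have "(H y *v axis b 1) $ a = (\<chi> k. det (\<chi> i j. if j
        = k then axis b 1 $ i else g y c $ i $ j) / det (g y c)) $ a"
      unfolding cramer[OF d[OF that]] by simp
    then show ?thesis by (simp add: matrix_vector_mult_basis column_def)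
  qed
  moreover have "sm (\<lambda>y. det (\<chi> i j. if j = a then axis b 1 $ i else g y c $ i $ j) / det (g y c))"
  proof (rule sm_divide)
    show "sm (\<lambda>y. det (\<chi> i j. if j = a then axis b 1 $ i else g y c $ i $ j))"
    proof (rule sm_det)
      show "sm (\<lambda>y. if j = a then axis b 1 $ i else g y c $ i $ j)" for i j
        by (cases "j = a") (simp_all add: sm_const sm_g)
    qed
    show "sm (\<lambda>y. det (g y c))"
      using sm_det[of "\<lambda>i j y. g y c $ i $ j"] sm_g by simp
  qed (rule d)
  ultimately show ?thesis by (simp cong: sm_cong)
qed

lemma lower_raise: "y \<in> W \<Longrightarrow> (\<Sum>k\<in>UNIV. g y c $ i $ k * (\<Sum>e\<in>UNIV. H y $ k $ e * X e)) = X i"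
proof -
  assume y: "y \<in> W"
  have "(\<Sum>k\<in>UNIV. g y c $ i $ k * (\<Sum>e\<in>UNIV. H y $ k $ e * X e)) =
      (\<Sum>e\<in>UNIV. (\<Sum>k\<in>UNIV. g y c $ i $ k * H y $ k $ e) * X e)"
    unfolding sum_distrib_left sum_distrib_right mult.assoc by (rule sum.swap)
  then show ?thesis by (simp add: g_H[OF y] if_distrib[of "\<lambda>z. z * _"] cong: if_cong)
qed

lemma trace_g: "y \<in> W \<Longrightarrow> (\<Sum>i\<in>UNIV. \<Sum>k\<in>UNIV. H y $ i $ k * (g y c $ i $ k * z)) = real CARD('n) * z"
proof -
  assume y: "y \<in> W"
  have "(\<Sum>i\<in>UNIV. \<Sum>k\<in>UNIV. H y $ i $ k * (g y c $ i $ k * z)) =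
      (\<Sum>i\<in>UNIV. (\<Sum>k\<in>UNIV. H y $ i $ k * g y c $ k $ i) * z)"
    unfolding sum_distrib_right by (intro sum.cong refl) (metis g_sym[OF y] mult.assoc)
  then show ?thesis by (simp add: H_g[OF y])
qed

lemma trace_g1:
  assumes y: "y \<in> W"
  shows "(\<Sum>i\<in>UNIV. \<Sum>k\<in>UNIV. H y $ i $ k * (g y c $ k $ b * X i)) = X b"
proof -
  have "(\<Sum>i\<in>UNIV. \<Sum>k\<in>UNIV. H y $ i $ k * (g y c $ k $ b * X i)) =
      (\<Sum>i\<in>UNIV. (\<Sum>k\<in>UNIV. H y $ i $ k * g y c $ k $ b) * X i)"
    by (simp add: sum_distrib_right mult.assoc)
  then show ?thesis by (simp add: H_g[OF y] if_distrib[of "\<lambda>z. z * _"] cong: if_cong)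
qed

lemma trace_g2:
  assumes y: "y \<in> W"
  shows "(\<Sum>i\<in>UNIV. \<Sum>k\<in>UNIV. H y $ i $ k * (g y c $ i $ b * X k)) = X b"
  by (subst sum.swap) (use trace_g1[OF y, of b X] in \<open>simp add: H_sym[OF y]\<close>)

text \<open>Christoffel symbols of the first kind, lowered index in front. They avoid the inverse
  metric, so differentiating them yields only second derivatives of \<open>g\<close>.\<close>

definition Cl :: "'n \<Rightarrow> 'n \<Rightarrow> 'n \<Rightarrow> 'm \<Rightarrow> real" where
  "Cl k a b y = (pd c a (\<lambda>y. g y c $ k $ b) y + pd c b (\<lambda>y. g y c $ a $ k) y
    - pd c k (\<lambda>y. g y c $ a $ b) y) / 2"

lemma christoffel_Cl: "\<Gamma> k a b y = (\<Sum>e\<in>UNIV. H y $ k $ e * Cl e a b y)"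
  by (simp add: christoffel_def Cl_def sum_divide_distrib)

lemma pd_g_sym: "y \<in> W \<Longrightarrow> pd c k (\<lambda>y. g y c $ a $ b) y = pd c k (\<lambda>y. g y c $ b $ a) y"
  by (rule pd_cong) (auto simp: g_sym)

lemma Cl_sym: "y \<in> W \<Longrightarrow> Cl k a b y = Cl k b a y"
  unfolding Cl_def by (simp add: pd_g_sym[of y k a b] pd_g_sym[of y a k b] pd_g_sym[of y b k a])

lemma christoffel_sym: "y \<in> W \<Longrightarrow> \<Gamma> k a b y = \<Gamma> k b a y"
  by (simp add: christoffel_Cl Cl_sym)

lemma sm_Cl: "sm (Cl k a b)"
  unfolding Cl_def[abs_def] by (intro sm_intros sm_g)

lemma sm_christoffel: "sm (\<Gamma> k a b)"
  unfolding christoffel_Cl[abs_def] by (intro sm_intros sm_H sm_Cl)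

lemma lower_christoffel: "y \<in> W \<Longrightarrow> (\<Sum>k\<in>UNIV. g y c $ i $ k * \<Gamma> k a b y) = Cl i a b y"
  unfolding christoffel_Cl by (rule lower_raise)

text \<open>The coordinate form of metric compatibility.\<close>

lemma pd_g: "y \<in> W \<Longrightarrow> pd c a (\<lambda>y. g y c $ k $ b) y = Cl k a b y + Cl b a k y"
  unfolding Cl_def by (simp add: pd_g_sym[of y a b k] pd_g_sym[of y k a b] pd_g_sym[of y b a k]
      field_simps)

section \<open>The Riemann tensor and its algebraic symmetries\<close>

lemma riem_eq: "riem g c a b k d x = pd c a (\<Gamma> k b d) x - pd c b (\<Gamma> k a d) x
    + (\<Sum>e\<in>UNIV. \<Gamma> k a e x * \<Gamma> e b d x) - (\<Sum>e\<in>UNIV. \<Gamma> k b e x * \<Gamma> e a d x)"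
  if x: "x \<in> W"
proof -
  \<comment> \<open>The coordinate field has constant components, so its covariant derivative
    consists of Christoffel symbols. In the second derivative the term with
    \<open>\<Gamma> e a b\<close> is symmetric in \<open>a\<close> and \<open>b\<close> and drops
    out of the commutator.\<close>
  have n: "nabla_vec g c i j (\<lambda>_. axis d 1) y = \<Gamma> j i d y" for i j y
    by (simp add: nabla_vec_def pd_const axis_def if_distrib[of "\<lambda>z. _ * z"] cong: if_cong)
  show ?thesis
    by (simp add: riem_def nabla2_vec_def nabla_11_def n christoffel_sym[OF x, of _ a b])
qed

text \<open>With the index lowered, the quadratic part is the bilinear form \<open>H\<close> on Christoffel symbols of
  the first kind, which makes all algebraic symmetries visible.\<close>

lemma riem_low_eq:
  assumes x: "x \<in> W"
  shows "Rl a b k d x = pd c a (Cl k b d) x - pd c b (Cl k a d) x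
    - (\<Sum>e\<in>UNIV. Cl e a k x * \<Gamma> e b d x) + (\<Sum>e\<in>UNIV. Cl e b k x * \<Gamma> e a d x)"
proof -
  \<comment> \<open>Differentiating \<open>lower_christoffel\<close> moves the derivative from
    \<Gamma> to \<open>Cl\<close>. Of the quadratic terms this creates, those with
    \<open>Cl k a e\<close> cancel against fact 2.\<close>
  have 1: "(\<Sum>e\<in>UNIV. g x c $ k $ e * pd c a (\<Gamma> e b d) x) =
      pd c a (Cl k b d) x - (\<Sum>e\<in>UNIV. (Cl k a e x + Cl e a k x) * \<Gamma> e b d x)" for a b
  proof -
    have "pd c a (Cl k b d) x = pd c a (\<lambda>y. \<Sum>e\<in>UNIV. g y c $ k $ e * \<Gamma> e b d y) x"
      by (rule pd_cong[OF x]) (simp add: lower_christoffel)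
    also have "\<dots> = (\<Sum>e\<in>UNIV. (Cl k a e x + Cl e a k x) * \<Gamma> e b d x + g x c $ k $ e * pd c a (\<Gamma> e b d) x)"
      using x by (simp add: pd_rules sm_intros sm_g sm_christoffel pd_g)
    finally show ?thesis by (simp add: sum.distrib)
  qed
  have 2: "(\<Sum>e\<in>UNIV. g x c $ k $ e * (\<Sum>f\<in>UNIV. \<Gamma> e a f x * \<Gamma> f b d x)) =
      (\<Sum>f\<in>UNIV. Cl k a f x * \<Gamma> f b d x)" for a b
  proof -
    have "(\<Sum>e\<in>UNIV. g x c $ k $ e * (\<Sum>f\<in>UNIV. \<Gamma> e a f x * \<Gamma> f b d x)) =
      (\<Sum>f\<in>UNIV. (\<Sum>e\<in>UNIV. g x c $ k $ e * \<Gamma> e a f x) * \<Gamma> f b d x)"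
      unfolding sum_distrib_left sum_distrib_right mult.assoc by (rule sum.swap)
    then show ?thesis by (simp add: lower_christoffel[OF x])
  qed
  have "Rl a b k d x = (\<Sum>e\<in>UNIV. g x c $ k $ e * pd c a (\<Gamma> e b d) x)
      - (\<Sum>e\<in>UNIV. g x c $ k $ e * pd c b (\<Gamma> e a d) x)
    + (\<Sum>e\<in>UNIV. g x c $ k $ e * (\<Sum>f\<in>UNIV. \<Gamma> e a f x * \<Gamma> f b d x))
    - (\<Sum>e\<in>UNIV. g x c $ k $ e * (\<Sum>f\<in>UNIV. \<Gamma> e b f x * \<Gamma> f a d x))"
    unfolding riem_low_def riem_eq[OF x]
    by (simp add: distrib_left right_diff_distrib sum.distrib sum_subtractf)
  then show ?thesis
    unfolding 1 2 by (simp add: distrib_right sum.distrib)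
qed

definition Bil :: "'n \<Rightarrow> 'n \<Rightarrow> 'n \<Rightarrow> 'n \<Rightarrow> 'm \<Rightarrow> real" where
  "Bil a k b d y = (\<Sum>e\<in>UNIV. Cl e a k y * \<Gamma> e b d y)"

lemma Bil_sym: "y \<in> W \<Longrightarrow> Bil a k b d y = Bil b d a k y"
  unfolding Bil_def christoffel_Cl sum_distrib_left
  by (subst sum.swap) (simp add: H_sym mult_ac)

lemma Bil_sym1: "y \<in> W \<Longrightarrow> Bil a k b d y = Bil k a b d y"
  by (simp add: Bil_def Cl_sym)

text \<open>The second derivative in \<open>a\<close> and \<open>b\<close> drops out because partial
  derivatives commute. In the remaining expression the symmetries can be compared term by
  term.\<close>

lemma riem_low_pd:
  assumes x: "x \<in> W"
  shows "Rl a b k d x = (pd c a (pd c d (\<lambda>y. g y c $ b $ k)) x - pd c a (pd c k (\<lambda>y. g y c $ b $ d)) x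
    - pd c b (pd c d (\<lambda>y. g y c $ a $ k)) x + pd c b (pd c k (\<lambda>y. g y c $ a $ d)) x) / 2
    - Bil a k b d x + Bil b k a d x"
  using x
  by (simp add: riem_low_eq[OF x] Bil_def Cl_def[abs_def] pd_rules sm_intros sm_g)
    (simp add: pd_commute[of x _ a b] sm_g field_simps)

lemma pd2_g_sym: "x \<in> W \<Longrightarrow> pd c a (pd c d (\<lambda>y. g y c $ b $ k)) x = pd c a (pd c d (\<lambda>y. g y c $ k $ b)) x"
  by (rule pd_cong) (auto intro: pd_g_sym)

lemma riem_low_skew1: "x \<in> W \<Longrightarrow> Rl a b k d x = - Rl b a k d x"
  by (simp add: riem_low_eq)

lemma riem_low_skew2: "x \<in> W \<Longrightarrow> Rl a b k d x = - Rl a b d k x"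
  by (simp add: riem_low_pd Bil_sym[of x a k b d] Bil_sym[of x b k a d] field_simps)

lemma Bil_sym2: "y \<in> W \<Longrightarrow> Bil a k b d y = Bil a k d b y"
  by (simp add: Bil_def christoffel_sym[of y _ b d])

text \<open>Read off from the expanded formula by reordering derivatives and the arguments of
  \<open>Bil\<close>, without passing through the cyclic identity.\<close>

lemma riem_low_pair:
  assumes x: "x \<in> W"
  shows "Rl a b k d x = Rl k d a b x"
proof -
  have "Bil k a d b x = Bil a k b d x" "Bil d a k b x = Bil b k a d x"
    by (metis Bil_sym1[OF x] Bil_sym2[OF x]) (metis Bil_sym[OF x] Bil_sym1[OF x] Bil_sym2[OF x])
  then show ?thesis
    unfolding riem_low_pd[OF x]
    by (simp add: pd_commute[OF x, of _ a d] pd_commute[OF x, of _ a k] pd_commute[OF x, of _ b d]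
        pd_commute[OF x, of _ b k] sm_g pd2_g_sym[OF x, of _ _ b k] pd2_g_sym[OF x, of _ _ b d]
        pd2_g_sym[OF x, of _ _ a k] pd2_g_sym[OF x, of _ _ a d])
qed

section \<open>Ricci tensor, traces of the Weyl tensor and the Schouten tensor\<close>

definition Ric :: "'n \<Rightarrow> 'n \<Rightarrow> 'm \<Rightarrow> real" where
  "Ric b d y = (\<Sum>i\<in>UNIV. \<Sum>k\<in>UNIV. H y $ i $ k * Rl i b k d y)"

lemma Ric_sym: "x \<in> W \<Longrightarrow> Ric b d x = Ric d b x"
  unfolding Ric_def by (subst sum.swap) (metis (no_types, lifting) H_sym riem_low_pair sum.cong)

lemma sm_riem: "sm (riem g c a b k d)"
proof -
  have "sm (\<lambda>x. pd c a (\<Gamma> k b d) x - pd c b (\<Gamma> k a d) x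
    + (\<Sum>e\<in>UNIV. \<Gamma> k a e x * \<Gamma> e b d x) - (\<Sum>e\<in>UNIV. \<Gamma> k b e x * \<Gamma> e a d x))"
    by (intro sm_intros sm_christoffel)
  then show ?thesis by (simp add: riem_eq cong: sm_cong)
qed

lemma sm_riem_low: "sm (Rl a b k d)"
  unfolding riem_low_def[abs_def] by (intro sm_intros sm_g sm_riem)

lemma sm_Ric: "sm (Ric b d)"
  unfolding Ric_def[abs_def] by (intro sm_intros sm_H sm_riem_low)

definition tr :: "('n \<Rightarrow> 'n \<Rightarrow> real) \<Rightarrow> 'm \<Rightarrow> real" where
  "tr X y = (\<Sum>i\<in>UNIV. \<Sum>k\<in>UNIV. H y $ i $ k * X i k)"

lemma tr_add: "tr (\<lambda>i k. X i k + Y i k) y = tr X y + tr Y y"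
  by (simp add: tr_def distrib_left sum.distrib)

lemma tr_cmult: "tr (\<lambda>i k. r * X i k) y = r * tr X y"
  by (simp add: tr_def sum_distrib_left mult_ac)

lemma tr_g: "y \<in> W \<Longrightarrow> tr (\<lambda>i k. g y c $ i $ k * r) y = real CARD('n) * r"
  by (simp add: tr_def trace_g)

text \<open>The Kulkarni-Nomizu product of \<open>g\<close> and \<open>P\<close>, in the index order
  of the curvature decomposition: the part of the Riemann tensor carried by the Schouten
  tensor.\<close>

definition kulkarni :: "('n \<Rightarrow> 'n \<Rightarrow> real) \<Rightarrow> 'n \<Rightarrow> 'n \<Rightarrow> 'n \<Rightarrow> 'n \<Rightarrow> 'm \<Rightarrow> real" where
  "kulkarni P a b k d x = g x c $ k $ a * P b d - g x c $ k $ b * P a d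
     + g x c $ d $ b * P a k - g x c $ d $ a * P b k"

lemma weyl_of_kulkarni: "weyl_of g c x P a b k d = Rl a b k d x - kulkarni (\<lambda>i j. P $ i $ j) a b k d x"
  by (simp add: weyl_of_def kulkarni_def)

text \<open>The four terms contribute \<open>n P\<close>, \<open>- P\<close>,
  \<open>(tr P) g\<close> and \<open>- P\<close>, hence the factor \<open>n - 2\<close>.\<close>

lemma trace_kulkarni:
  assumes x: "x \<in> W"
  shows "(\<Sum>i\<in>UNIV. \<Sum>k\<in>UNIV. H x $ i $ k * kulkarni P i b k d x) =
    (real CARD('n) - 2) * P b d + tr P x * g x c $ b $ d"
proof -
  have "H x $ i $ k * kulkarni P i b k d x = H x $ i $ k * (g x c $ i $ k * P b d)
      - H x $ i $ k * (g x c $ k $ b * P i d) + g x c $ b $ d * (H x $ i $ k * P i k)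
      - H x $ i $ k * (g x c $ i $ d * P b k)" for i k
    unfolding kulkarni_def g_sym[OF x, of k i] g_sym[OF x, of d b] g_sym[OF x, of d i]
    by (simp add: algebra_simps)
  then have "(\<Sum>i\<in>UNIV. \<Sum>k\<in>UNIV. H x $ i $ k * kulkarni P i b k d x) =
    (\<Sum>i\<in>UNIV. \<Sum>k\<in>UNIV. H x $ i $ k * (g x c $ i $ k * P b d))
    - (\<Sum>i\<in>UNIV. \<Sum>k\<in>UNIV. H x $ i $ k * (g x c $ k $ b * P i d))
    + g x c $ b $ d * tr P x
    - (\<Sum>i\<in>UNIV. \<Sum>k\<in>UNIV. H x $ i $ k * (g x c $ i $ d * P b k))"
    by (simp only: tr_def sum_distrib_left sum.distrib sum_subtractf)
  then show ?thesis
    by (simp only: trace_g[OF x] trace_g1[OF x] trace_g2[OF x]) (simp add: algebra_simps)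
qed

lemma weyl_trace_free_iff:
  assumes x: "x \<in> W" and P: "transpose P = P"
  shows "totally_trace_free (H x) (weyl_of g c x P) \<longleftrightarrow>
    (\<forall>b d. Ric b d x = (real CARD('n) - 2) * P $ b $ d + tr (\<lambda>i j. P $ i $ j) x * g x c $ b $ d)"
proof -
  have "totally_trace_free (H x) (weyl_of g c x P) \<longleftrightarrow>
    (\<forall>b d. (\<Sum>i\<in>UNIV. \<Sum>k\<in>UNIV. H x $ i $ k * weyl_of g c x P i b k d) = 0)"
  proof (rule totally_trace_free_iff)
    show "weyl_of g c x P i j k l = - weyl_of g c x P j i k l" for i j k l
      using riem_low_skew1[OF x, of i j] by (simp add: weyl_of_kulkarni kulkarni_def)
    show "weyl_of g c x P i j k l = - weyl_of g c x P i j l k" for i j k l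
      using riem_low_skew2[OF x, of i j k l] by (simp add: weyl_of_kulkarni kulkarni_def)
  qed (rule H_sym[OF x])
  moreover have "(\<Sum>i\<in>UNIV. \<Sum>k\<in>UNIV. H x $ i $ k * weyl_of g c x P i b k d) =
    Ric b d x - ((real CARD('n) - 2) * P $ b $ d + tr (\<lambda>i j. P $ i $ j) x * g x c $ b $ d)" for b d
    unfolding trace_kulkarni[OF x, of "\<lambda>i j. P $ i $ j", symmetric]
    by (simp only: weyl_of_kulkarni Ric_def right_diff_distrib sum_subtractf)
  ultimately show ?thesis by simp
qed

abbreviation "Sch a b y \<equiv> schouten g c y $ a $ b"
abbreviation "J \<equiv> J_trace g c"

definition "scal y = tr (\<lambda>b d. Ric b d y) y"

text \<open>A trace gives \<open>scal = 2 (n - 1) tr P\<close>, since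
  \<open>(n - 2) + n = 2 (n - 1)\<close>; then \<open>P\<close> can be solved for because
  \<open>n > 2\<close>.\<close>

lemma schouten_unique:
  assumes x: "x \<in> W" and P: "transpose P = P"
    and "\<And>b d. Ric b d x = (real CARD('n) - 2) * P $ b $ d + tr (\<lambda>i j. P $ i $ j) x * g x c $ b $ d"
  shows "P $ b $ d = (Ric b d x - scal x / (2 * (real CARD('n)
      - 1)) * g x c $ b $ d) / (real CARD('n) - 2)"
proof -
  let ?n = "real CARD('n)"
  have n: "?n > 2" using dim by linarith
  have "scal x = tr (\<lambda>b d. (?n - 2) * P $ b $ d + tr (\<lambda>i j. P $ i $ j) x * g x c $ b $ d) x"
    unfolding scal_def assms(3) ..
  also have "\<dots> = (?n - 2) * tr (\<lambda>i j. P $ i $ j) x + ?n * tr (\<lambda>i j. P $ i $ j) x"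
    using tr_g[OF x, of "tr (\<lambda>i j. P $ i $ j) x"]
    by (simp only: tr_add tr_cmult mult.commute[of "tr _ _" "_ $ _"])
  finally have "scal x / (2 * (?n - 1)) = tr (\<lambda>i j. P $ i $ j) x"
    using n by (simp add: field_simps)
  then show ?thesis using n by (simp add: assms(3)[of b d])
qed

text \<open>Evaluates the definite description in \<open>schouten\<close>. It serves both the
  explicit formula and the rescaled metric, where a solution of the Ricci equation is
  exhibited.\<close>

lemma schouten_eqI:
  assumes x: "x \<in> W" and P: "transpose P = P"
    and "\<And>b d. Ric b d x = (real CARD('n) - 2) * P $ b $ d + tr (\<lambda>i j. P $ i $ j) x * g x c $ b $ d"
  shows "schouten g c x = P"
  unfolding schouten_def
proof (rule the_equality)
  show "transpose P = P \<and> totally_trace_free (H x) (weyl_of g c x P)"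
    using weyl_trace_free_iff[OF x P] assms by simp
next
  fix Q assume "transpose Q = Q \<and> totally_trace_free (H x) (weyl_of g c x Q)"
  then show "Q = P"
    using schouten_unique[OF x, of Q] schouten_unique[OF x P assms(3)] weyl_trace_free_iff[OF x, of Q]
    by (simp add: vec_eq_iff)
qed

lemma schouten_eq:
  assumes x: "x \<in> W"
  shows "schouten g c x = (\<chi> b d. (Ric b d x - scal x / (2 * (real CARD('n)
      - 1)) * g x c $ b $ d) / (real CARD('n) - 2))"
    (is "_ = ?P")
proof (rule schouten_eqI[OF x])
  let ?n = "real CARD('n)"
  have n: "?n > 2" using dim by linarith
  show "transpose ?P = ?P"
    using Ric_sym[OF x] g_sym[OF x] by (simp add: transpose_def vec_eq_iff)
  have "tr (\<lambda>i j. ?P $ i $ j) x = tr (\<lambda>b d. 1 / (?n - 2) * Ric b d x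
      + g x c $ b $ d * (- (scal x / (2 * (?n - 1))) / (?n - 2))) x"
    by (rule arg_cong[of _ _ "\<lambda>f. tr f x"]) (simp add: fun_eq_iff diff_divide_distrib)
  also have "\<dots> = scal x / (?n - 2) - ?n * (scal x / (2 * (?n - 1))) / (?n - 2)"
    by (simp only: tr_add tr_cmult tr_g[OF x] scal_def) simp
  also have "\<dots> = scal x / (2 * (?n - 1))"
    using n by (simp add: divide_simps) (simp add: algebra_simps)
  finally show "Ric b d x = (?n - 2) * ?P $ b $ d + tr (\<lambda>i j. ?P $ i $ j) x * g x c $ b $ d" for b d
    using n by simp
qed

lemma sm_schouten: "sm (Sch a b)"
proof -
  have "sm (\<lambda>x. (Ric a b x - scal x / (2 * (real CARD('n) - 1)) * g x c $ a $ b) / (real CARD('n) - 2))"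
    unfolding scal_def tr_def by (intro sm_intros sm_Ric sm_H sm_g)
  then show ?thesis by (simp add: schouten_eq cong: sm_cong)
qed

lemma J_tr: "J x = tr (\<lambda>a b. Sch a b x) x"
  by (simp add: J_trace_def tr_def)

lemma sm_J: "sm J"
  unfolding J_trace_def[abs_def] by (intro sm_intros sm_H sm_schouten)

lemma schouten_sym: "x \<in> W \<Longrightarrow> Sch a b x = Sch b a x"
  by (simp add: schouten_eq Ric_sym[of x a b] g_sym[of x a b])

lemma Ric_schouten:
  assumes x: "x \<in> W"
  shows "Ric b d x = (real CARD('n) - 2) * Sch b d x + J x * g x c $ b $ d"
proof -
  have t: "transpose (schouten g c x) = schouten g c x"
    using schouten_sym[OF x] by (simp add: transpose_def vec_eq_iff)
  have "(real CARD('n) - 2) \<noteq> 0" using dim by linarith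
  have eq: "Sch b d x = (Ric b d x - scal x / (2 * (real CARD('n)
      - 1)) * g x c $ b $ d) / (real CARD('n) - 2)" for b d
    by (simp add: schouten_eq[OF x])
  let ?n = "real CARD('n)"
  have n: "?n > 2" using dim by linarith
  have "J x = tr (\<lambda>b d. 1 / (?n - 2) * Ric b d x + g x c $ b $ d * (- (scal x / (2 * (?n
      - 1))) / (?n - 2))) x"
    unfolding J_tr eq by (rule arg_cong[of _ _ "\<lambda>f. tr f x"]) (simp add: fun_eq_iff diff_divide_distrib)
  also have "\<dots> = scal x / (?n - 2) - ?n * (scal x / (2 * (?n - 1))) / (?n - 2)"
    by (simp only: tr_add tr_cmult tr_g[OF x] scal_def) simp
  also have "\<dots> = scal x / (2 * (?n - 1))"
    using n by (simp add: divide_simps) (simp add: algebra_simps)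
  finally show ?thesis using n by (simp add: eq)
qed

end

section \<open>The contracted Bianchi identity\<close>

lemma matrix_diff_ldistrib: "A ** (B - C) = A ** B - A ** (C :: real ^ 'k::finite ^ 'l::finite)"
  for A :: "real ^ 'l ^ 'j::finite"
  by (simp add: matrix_matrix_mult_def vec_eq_iff right_diff_distrib sum_subtractf)

lemma matrix_diff_rdistrib: "(A - B) ** C = A ** C - B ** (C :: real ^ 'k::finite ^ 'l::finite)"
  for A :: "real ^ 'l ^ 'j::finite"
  by (simp add: matrix_matrix_mult_def vec_eq_iff left_diff_distrib sum_subtractf)

lemma matrix_add_rdistrib: "(A + B) ** C = A ** C + B ** (C :: real ^ 'k::finite ^ 'l::finite)"
  for A :: "real ^ 'l ^ 'j::finite"
  by (simp add: matrix_matrix_mult_def vec_eq_iff distrib_right sum.distrib)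

context metric_region
begin

text \<open>The inverse metric is parallel: differentiate \<open>H g = 1\<close> and solve with
  \<open>H\<close>.\<close>

lemma pd_H:
  assumes x: "x \<in> W"
  shows "pd c a (\<lambda>y. H y $ i $ j) x =
    - (\<Sum>k\<in>UNIV. \<Gamma> i a k x * H x $ k $ j) - (\<Sum>k\<in>UNIV. \<Gamma> j a k x * H x $ i $ k)"
proof -
  have 1: "(\<Sum>e\<in>UNIV. pd c a (\<lambda>y. H y $ i $ e) x * g x c $ e $ k)
      = - (\<Gamma> i a k x + (\<Sum>e\<in>UNIV. H x $ i $ e * Cl k a e x))" for k
  proof -
    have "0 = pd c a (\<lambda>y. \<Sum>e\<in>UNIV. H y $ i $ e * g y c $ e $ k) x"
      by (subst pd_cong[OF x H_g]) (simp_all add: pd_const)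
    also have "\<dots> = (\<Sum>e\<in>UNIV. pd c a (\<lambda>y. H y $ i $ e) x * g x c $ e $ k
        + H x $ i $ e * (Cl e a k x + Cl k a e x))"
      using x by (simp add: pd_rules sm_intros sm_g sm_H pd_g)
    finally show ?thesis
      by (simp add: sum.distrib christoffel_Cl distrib_left)
  qed
  have "pd c a (\<lambda>y. H y $ i $ j) x =
      (\<Sum>e\<in>UNIV. pd c a (\<lambda>y. H y $ i $ e) x * (\<Sum>k\<in>UNIV. g x c $ e $ k * H x $ k $ j))"
    by (simp add: g_H[OF x] if_distrib[of "\<lambda>z. _ * z"] cong: if_cong)
  also have "\<dots> = (\<Sum>k\<in>UNIV. (\<Sum>e\<in>UNIV. pd c a (\<lambda>y. H y $ i $ e) x * g x c $ e $ k) * H x $ k $ j)"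
    unfolding sum_distrib_left sum_distrib_right mult.assoc by (rule sum.swap)
  also have "\<dots> = - (\<Sum>k\<in>UNIV. \<Gamma> i a k x * H x $ k $ j)
      - (\<Sum>k\<in>UNIV. \<Sum>e\<in>UNIV. H x $ i $ e * Cl k a e x * H x $ k $ j)"
    unfolding 1 by (simp add: distrib_right left_diff_distrib sum.distrib sum_negf sum_subtractf
        sum_distrib_right)
  also have "(\<Sum>k\<in>UNIV. \<Sum>e\<in>UNIV. H x $ i $ e * Cl k a e x * H x $ k $ j) =
      (\<Sum>e\<in>UNIV. \<Gamma> j a e x * H x $ i $ e)"
    unfolding christoffel_Cl sum_distrib_left sum_distrib_right
    by (subst sum.swap) (simp add: H_sym[OF x, of j] mult_ac)
  finally show ?thesis .
qed

section \<open>Covariant derivatives of tensor components and the Bianchi identity\<close>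

definition cov2 :: "'n \<Rightarrow> ('n \<Rightarrow> 'n \<Rightarrow> 'm \<Rightarrow> real) \<Rightarrow> 'n \<Rightarrow> 'n \<Rightarrow> 'm \<Rightarrow> real" where
  "cov2 a T i k x = pd c a (T i k) x - (\<Sum>e\<in>UNIV. \<Gamma> e a i x * T e k x) - (\<Sum>e\<in>UNIV. \<Gamma> e a k x * T i e x)"

text \<open>Tracing commutes with covariant differentiation because the inverse metric is parallel.
  \<open>T\<close> is any family of smooth functions, so the lemma also applies to curvature
  components with two further indices frozen.\<close>

lemma cov2_trace:
  assumes x: "x \<in> W" and T: "\<And>i k. sm (T i k)"
  shows "(\<Sum>i\<in>UNIV. \<Sum>k\<in>UNIV. H x $ i $ k * cov2 a T i k x) =
    pd c a (\<lambda>y. \<Sum>i\<in>UNIV. \<Sum>k\<in>UNIV. H y $ i $ k * T i k y) x"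
proof -
  have 1: "(\<Sum>i\<in>UNIV. \<Sum>k\<in>UNIV. H x $ i $ k * (\<Sum>e\<in>UNIV. \<Gamma> e a i x * T e k x)) =
      (\<Sum>i\<in>UNIV. \<Sum>k\<in>UNIV. (\<Sum>e\<in>UNIV. \<Gamma> i a e x * H x $ e $ k) * T i k x)" (is "?l = ?r")
  proof -
    have "?l = (\<Sum>i\<in>UNIV. \<Sum>e\<in>UNIV. \<Sum>k\<in>UNIV. \<Gamma> e a i x * H x $ i $ k * T e k x)"
      unfolding sum_distrib_left by (rule sum.cong[OF refl], subst sum.swap) (simp add: mult_ac)
    also have "\<dots> = (\<Sum>e\<in>UNIV. \<Sum>k\<in>UNIV. \<Sum>i\<in>UNIV. \<Gamma> e a i x * H x $ i $ k * T e k x)"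
      by (subst sum.swap, rule sum.cong[OF refl], rule sum.swap)
    finally show ?thesis by (simp add: sum_distrib_right)
  qed
  have 2: "(\<Sum>i\<in>UNIV. \<Sum>k\<in>UNIV. H x $ i $ k * (\<Sum>e\<in>UNIV. \<Gamma> e a k x * T i e x)) =
      (\<Sum>i\<in>UNIV. \<Sum>k\<in>UNIV. (\<Sum>e\<in>UNIV. \<Gamma> k a e x * H x $ i $ e) * T i k x)"
    unfolding sum_distrib_left sum_distrib_right
    by (rule sum.cong[OF refl], subst sum.swap) (simp add: mult_ac)
  have "pd c a (\<lambda>y. \<Sum>i\<in>UNIV. \<Sum>k\<in>UNIV. H y $ i $ k * T i k y) x =
      (\<Sum>i\<in>UNIV. \<Sum>k\<in>UNIV. pd c a (\<lambda>y. H y $ i $ k) x * T i k x + H x $ i $ k * pd c a (T i k) x)"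
    using x by (simp add: pd_rules sm_intros sm_H T)
  also have "\<dots> = (\<Sum>i\<in>UNIV. \<Sum>k\<in>UNIV. H x $ i $ k * pd c a (T i k) x)
     - (\<Sum>i\<in>UNIV. \<Sum>k\<in>UNIV. (\<Sum>e\<in>UNIV. \<Gamma> i a e x * H x $ e $ k) * T i k x)
     - (\<Sum>i\<in>UNIV. \<Sum>k\<in>UNIV. (\<Sum>e\<in>UNIV. \<Gamma> k a e x * H x $ i $ e) * T i k x)"
    by (simp add: pd_H[OF x] sum.distrib sum_subtractf sum_negf left_diff_distrib algebra_simps)
  also have "\<dots> = (\<Sum>i\<in>UNIV. \<Sum>k\<in>UNIV. H x $ i $ k * cov2 a T i k x)"
    unfolding 1[symmetric] 2[symmetric] cov2_def right_diff_distrib sum_subtractf by simp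
  finally show ?thesis ..
qed

lemma cov2_g_mult:
  assumes x: "x \<in> W" and f: "sm f"
  shows "cov2 a (\<lambda>i k y. f y * g y c $ i $ k) i k x = pd c a f x * g x c $ i $ k"
proof -
  have "(\<Sum>e\<in>UNIV. \<Gamma> e a i x * (f x * g x c $ e $ k)) = f x * Cl k a i x"
    unfolding lower_christoffel[OF x, symmetric] sum_distrib_left
    by (simp add: g_sym[OF x, of k] mult_ac)
  moreover have "(\<Sum>e\<in>UNIV. \<Gamma> e a k x * (f x * g x c $ i $ e)) = f x * Cl i a k x"
    unfolding lower_christoffel[OF x, symmetric] sum_distrib_left by (simp add: mult_ac)
  ultimately show ?thesis
    using x by (simp add: cov2_def pd_mult sm_g f pd_g algebra_simps)
qed

definition cov_riem :: "'n \<Rightarrow> 'n \<Rightarrow> 'n \<Rightarrow> 'n \<Rightarrow> 'n \<Rightarrow> 'm \<Rightarrow> real" where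
  "cov_riem a p q k d x = pd c a (Rl p q k d) x
    - (\<Sum>e\<in>UNIV. \<Gamma> e a p x * Rl e q k d x) - (\<Sum>e\<in>UNIV. \<Gamma> e a q x * Rl p e k d x)
    - (\<Sum>e\<in>UNIV. \<Gamma> e a k x * Rl p q e d x) - (\<Sum>e\<in>UNIV. \<Gamma> e a d x * Rl p q k e x)"

text \<open>With \<open>G p\<close> the connection matrices, the curvature is the curl of
  \<open>G\<close> plus a commutator, and \<open>DR\<close> is its derivative plus the commutator
  with \<open>G\<close>. This is the Bianchi identity of a vector bundle connection: the cyclic sum
  vanishes because partial derivatives commute and matrix products associate.\<close>

lemma bianchi_mixed:
  assumes x: "x \<in> W"
  defines "DR \<equiv> \<lambda>p q r. \<chi> i d. pd c p (riem g c q r i d) x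
    + (\<Sum>f\<in>UNIV. \<Gamma> i p f x * riem g c q r f d x) - (\<Sum>f\<in>UNIV. riem g c q r i f x * \<Gamma> f p d x)"
  shows "DR p q r + DR q r p + DR r p q = 0"
proof -
  define G where "G p = (\<chi> i d. \<Gamma> i p d x)" for p
  define dG where "dG p q = (\<chi> i d. pd c p (\<Gamma> i q d) x)" for p q
  define ddG where "ddG p q r = (\<chi> i d. pd c p (pd c q (\<Gamma> i r d)) x)" for p q r
  have R: "(\<chi> i d. riem g c q r i d x) = dG q r - dG r q + G q ** G r - G r ** G q" for q r
    by (simp add: riem_eq[OF x] vec_eq_iff G_def dG_def matrix_matrix_mult_def)
  have dR: "(\<chi> i d. pd c p (riem g c q r i d) x) = ddG p q r - ddG p r q
      + (dG p q ** G r + G q ** dG p r) - (dG p r ** G q + G r ** dG p q)" for p q r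
  proof -
    have "pd c p (riem g c q r i d) x = pd c p (\<lambda>x. pd c q (\<Gamma> i r d) x - pd c r (\<Gamma> i q d) x
      + (\<Sum>e\<in>UNIV. \<Gamma> i q e x * \<Gamma> e r d x) - (\<Sum>e\<in>UNIV. \<Gamma> i r e x * \<Gamma> e q d x)) x" for i d
      by (rule pd_cong[OF x riem_eq])
    then show ?thesis
      using x by (simp add: pd_rules sm_intros sm_christoffel vec_eq_iff G_def dG_def ddG_def
          matrix_matrix_mult_def sum.distrib)
  qed
  have dd: "ddG p q r = ddG q p r" for p q r
    by (simp add: ddG_def vec_eq_iff pd_commute[OF x sm_christoffel])
  have "DR p q r = (\<chi> i d. pd c p (riem g c q r i d) x) + G p ** (\<chi> i d. riem g c q r i d x)
      - (\<chi> i d. riem g c q r i d x) ** G p" for p q r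
    by (simp add: DR_def vec_eq_iff G_def matrix_matrix_mult_def)
  then show ?thesis
    unfolding R dR
    by (simp add: matrix_add_ldistrib matrix_add_rdistrib matrix_diff_ldistrib matrix_diff_rdistrib
        matrix_mul_assoc dd[of r p] dd[of q p] dd[of r q])
qed

text \<open>Lowering \<open>k\<close> passes through the derivative by metric compatibility. The
  Christoffel terms for \<open>p\<close>, \<open>q\<close>, \<open>r\<close> cancel in pairs in the
  cyclic sum because the connection is torsion-free and the curvature is skew.\<close>

lemma bianchi:
  assumes x: "x \<in> W"
  shows "cov_riem p q r k d x + cov_riem q r p k d x + cov_riem r p q k d x = 0"
proof -
  define DR where "DR p q r i = pd c p (riem g c q r i d) x
    + (\<Sum>f\<in>UNIV. \<Gamma> i p f x * riem g c q r f d x) - (\<Sum>f\<in>UNIV. riem g c q r i f x * \<Gamma> f p d x)" for p q r i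
  have z: "DR p q r i + DR q r p i + DR r p q i = 0" for i
    using bianchi_mixed[OF x, of p q r] by (simp add: vec_eq_iff DR_def)
  have *: "cov_riem p q r k d x = (\<Sum>i\<in>UNIV. g x c $ k $ i * DR p q r i)
    - (\<Sum>e\<in>UNIV. \<Gamma> e p q x * Rl e r k d x) - (\<Sum>e\<in>UNIV. \<Gamma> e p r x * Rl q e k d x)" for p q r
  proof -
    have 1: "pd c p (Rl q r k d) x = (\<Sum>i\<in>UNIV. Cl k p i x * riem g c q r i d x)
      + (\<Sum>i\<in>UNIV. Cl i p k x * riem g c q r i d x)
          + (\<Sum>i\<in>UNIV. g x c $ k $ i * pd c p (riem g c q r i d) x)"
      using x by (simp add: riem_low_def[abs_def] pd_rules sm_intros sm_g sm_riem pd_g sum.distrib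
          distrib_right)
    have 2: "(\<Sum>i\<in>UNIV. Cl k p i x * riem g c q r i d x) =
      (\<Sum>i\<in>UNIV. g x c $ k $ i * (\<Sum>f\<in>UNIV. \<Gamma> i p f x * riem g c q r f d x))"
      unfolding lower_christoffel[OF x, symmetric] sum_distrib_left sum_distrib_right
      by (subst sum.swap) (simp add: mult_ac)
    have 3: "(\<Sum>i\<in>UNIV. Cl i p k x * riem g c q r i d x) = (\<Sum>e\<in>UNIV. \<Gamma> e p k x * Rl q r e d x)"
      unfolding lower_christoffel[OF x, symmetric] sum_distrib_left sum_distrib_right riem_low_def
      by (subst sum.swap) (simp add: g_sym[OF x] mult_ac)
    have 4: "(\<Sum>i\<in>UNIV. g x c $ k $ i * (\<Sum>f\<in>UNIV. riem g c q r i f x * \<Gamma> f p d x)) =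
        (\<Sum>e\<in>UNIV. \<Gamma> e p d x * Rl q r k e x)"
      unfolding sum_distrib_left riem_low_def by (subst sum.swap) (simp add: mult_ac)
    show ?thesis
      unfolding cov_riem_def DR_def distrib_left right_diff_distrib sum.distrib sum_subtractf 1 2 3 4
      by simp
  qed
  have "(\<Sum>i\<in>UNIV. g x c $ k $ i * DR p q r i) + (\<Sum>i\<in>UNIV. g x c $ k $ i * DR q r p i)
      + (\<Sum>i\<in>UNIV. g x c $ k $ i * DR r p q i) = 0"
    unfolding sum.distrib[symmetric] distrib_left[symmetric] z by simp
  moreover have "(\<Sum>e\<in>UNIV. \<Gamma> e p q x * Rl r e k d x) = - (\<Sum>e\<in>UNIV. \<Gamma> e p q x * Rl e r k d x)" for p q r
    by (subst riem_low_skew1[OF x]) (simp add: sum_negf)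
  ultimately show ?thesis
    unfolding * by (simp add: christoffel_sym[OF x, of _ q p] christoffel_sym[OF x, of _ r p]
        christoffel_sym[OF x, of _ r q])
qed

lemma cov_riem_trace:
  assumes x: "x \<in> W"
  shows "(\<Sum>p\<in>UNIV. \<Sum>k\<in>UNIV. H x $ p $ k * cov_riem a p q k d x) = cov2 a Ric q d x"
proof -
  have 1: "cov_riem a p q k d x = cov2 a (\<lambda>p k. Rl p q k d) p k x
      - (\<Sum>e\<in>UNIV. \<Gamma> e a q x * Rl p e k d x) - (\<Sum>e\<in>UNIV. \<Gamma> e a d x * Rl p q k e x)" for p k
    by (simp add: cov_riem_def cov2_def)
  have 2: "(\<Sum>p\<in>UNIV. \<Sum>k\<in>UNIV. H x $ p $ k * (\<Sum>e\<in>UNIV. X e * Y e p k)) =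
      (\<Sum>e\<in>UNIV. X e * (\<Sum>p\<in>UNIV. \<Sum>k\<in>UNIV. H x $ p $ k * Y e p k))" for X and Y :: "'n \<Rightarrow> 'n \<Rightarrow> 'n \<Rightarrow> real"
  proof -
    have "(\<Sum>p\<in>UNIV. \<Sum>k\<in>UNIV. H x $ p $ k * (\<Sum>e\<in>UNIV. X e * Y e p k)) =
        (\<Sum>p\<in>UNIV. \<Sum>e\<in>UNIV. \<Sum>k\<in>UNIV. X e * (H x $ p $ k * Y e p k))"
      unfolding sum_distrib_left by (rule sum.cong[OF refl], subst sum.swap) (simp add: mult_ac)
    also have "\<dots> = (\<Sum>e\<in>UNIV. \<Sum>p\<in>UNIV. \<Sum>k\<in>UNIV. X e * (H x $ p $ k * Y e p k))"
      by (rule sum.swap)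
    finally show ?thesis by (simp add: sum_distrib_left)
  qed
  have "(\<Sum>p\<in>UNIV. \<Sum>k\<in>UNIV. H x $ p $ k * cov_riem a p q k d x) =
      pd c a (Ric q d) x - (\<Sum>e\<in>UNIV. \<Gamma> e a q x * Ric e d x) - (\<Sum>e\<in>UNIV. \<Gamma> e a d x * Ric q e x)"
    unfolding 1 right_diff_distrib sum_subtractf 2 cov2_trace[OF x, of "\<lambda>p k. Rl p q k d", OF
        sm_riem_low]
    by (simp add: Ric_def[abs_def])
  then show ?thesis by (simp add: cov2_def)
qed

lemma cov_riem_skew1: "x \<in> W \<Longrightarrow> cov_riem a p q k d x = - cov_riem a q p k d x"
proof -
  assume x: "x \<in> W"
  have "pd c a (Rl p q k d) x = pd c a (\<lambda>y. - Rl q p k d y) x"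
    by (rule pd_cong[OF x riem_low_skew1])
  then show ?thesis
    unfolding cov_riem_def using x
    by (simp add: pd_minus sm_riem_low riem_low_skew1[OF x, of p] riem_low_skew1[OF x, of _ q] sum_negf)
qed

lemma cov_riem_skew2: "x \<in> W \<Longrightarrow> cov_riem a p q k d x = - cov_riem a p q d k x"
proof -
  assume x: "x \<in> W"
  have "pd c a (Rl p q k d) x = pd c a (\<lambda>y. - Rl p q d k y) x"
    by (rule pd_cong[OF x riem_low_skew2])
  then show ?thesis
    unfolding cov_riem_def using x
    by (simp add: pd_minus sm_riem_low riem_low_skew2[OF x, of _ _ k] riem_low_skew2[OF x, of _ _ _
        d] sum_negf)
qed

text \<open>Here \<open>Ric = l g\<close>. Tracing the Bianchi identity twice turns its three
  summands into -1, -1 and \<open>n\<close> times the derivative of \<open>l\<close>, and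
  \<open>n - 2\<close> is not zero.\<close>

lemma einstein_J_const:
  assumes E: "\<And>y a b. y \<in> W \<Longrightarrow> Sch a b y = J y / real CARD('n) * g y c $ a $ b"
    and x: "x \<in> W"
  shows "pd c r J x = 0"
proof -
  let ?n = "real CARD('n)"
  have n: "?n \<ge> 3" using dim by linarith
  \<comment> \<open>\<open>P = (J / n) g\<close> in \<open>Ric = (n - 2) P + J g\<close> gives the
    factor \<open>(n - 2) / n + 1 = 2 (n - 1) / n\<close>.\<close>
  define l where "l y = (2 * (?n - 1) / ?n) * J y" for y
  have sm_l: "sm l" unfolding l_def[abs_def] by (intro sm_intros sm_J)
  have Ric: "Ric b d y = l y * g y c $ b $ d" if "y \<in> W" for b d y
  proof -
    have "(?n - 2) * (J y / ?n * z) + J y * z = (2 * (?n - 1) / ?n) * J y * z" for z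
      using n by (simp add: field_simps)
    then show ?thesis using Ric_schouten[OF that, of b d] by (simp add: E[OF that] l_def)
  qed
  have cov: "cov2 a Ric b d x = pd c a l x * g x c $ b $ d" for a b d
  proof -
    have "cov2 a Ric b d x = cov2 a (\<lambda>i k y. l y * g y c $ i $ k) b d x"
      unfolding cov2_def Ric[OF x] by (simp add: pd_cong[OF x Ric])
    then show ?thesis by (simp add: cov2_g_mult[OF x sm_l])
  qed
  have 1: "(\<Sum>q\<in>UNIV. \<Sum>d\<in>UNIV. H x $ q $ d * cov_riem p q r k d x) =
      - (pd c p l x * g x c $ r $ k)" for p k
    by (subst cov_riem_skew2[OF x]) (simp add: sum_negf cov_riem_trace[OF x] cov)
  have 2: "(\<Sum>p\<in>UNIV. \<Sum>k\<in>UNIV. H x $ p $ k * cov_riem q r p k d x) =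
      - (pd c q l x * g x c $ r $ d)" for q d
    by (subst cov_riem_skew1[OF x]) (simp add: sum_negf cov_riem_trace[OF x] cov)
  have 3: "(\<Sum>p\<in>UNIV. \<Sum>k\<in>UNIV. H x $ p $ k * cov_riem r p q k d x) = pd c r l x * g x c $ q $ d" for q d
    by (simp add: cov_riem_trace[OF x] cov)
  have t: "(\<Sum>q\<in>UNIV. \<Sum>d\<in>UNIV. H x $ q $ d * (pd c q l x * g x c $ r $ d)) = pd c r l x"
    using trace_g1[OF x, of r "\<lambda>q. pd c q l x"] by (simp add: g_sym[OF x, of r] mult_ac)
  have "0 = (\<Sum>q\<in>UNIV. \<Sum>d\<in>UNIV. H x $ q $ d * (\<Sum>p\<in>UNIV. \<Sum>k\<in>UNIV. H x $ p $ k *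
      (cov_riem p q r k d x + cov_riem q r p k d x + cov_riem r p q k d x)))"
    by (simp add: bianchi[OF x])
  also have "\<dots> = (\<Sum>q\<in>UNIV. \<Sum>d\<in>UNIV. H x $ q $ d * (\<Sum>p\<in>UNIV. \<Sum>k\<in>UNIV. H x $ p $ k * cov_riem p q r k d x))
      + (\<Sum>q\<in>UNIV. \<Sum>d\<in>UNIV. H x $ q $ d * - (pd c q l x * g x c $ r $ d))
      + (\<Sum>q\<in>UNIV. \<Sum>d\<in>UNIV. H x $ q $ d * (pd c r l x * g x c $ q $ d))"
    by (simp only: distrib_left sum.distrib 2 3)
  \<comment> \<open>In this summand \<open>p\<close> is the index of differentiation, so the trace
    over \<open>q\<close> and \<open>d\<close> must come first to produce the Ricci tensor.\<close>
  also have "(\<Sum>q\<in>UNIV. \<Sum>d\<in>UNIV. H x $ q $ d * (\<Sum>p\<in>UNIV. \<Sum>k\<in>UNIV. H x $ p $ k * cov_riem p q r k d x))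
      = (\<Sum>p\<in>UNIV. \<Sum>k\<in>UNIV. H x $ p $ k * (\<Sum>q\<in>UNIV. \<Sum>d\<in>UNIV. H x $ q $ d * cov_riem p q r k d x))"
  proof -
    have sw: "(\<Sum>q\<in>UNIV. \<Sum>d\<in>UNIV. \<Sum>p\<in>UNIV. \<Sum>k\<in>UNIV. F q d p k) =
        (\<Sum>p\<in>UNIV. \<Sum>k\<in>UNIV. \<Sum>q\<in>UNIV. \<Sum>d\<in>UNIV. F q d p k)" for F :: "'n \<Rightarrow> 'n \<Rightarrow> 'n \<Rightarrow> 'n \<Rightarrow> real"
    proof -
      have "(\<Sum>q\<in>UNIV. \<Sum>d\<in>UNIV. \<Sum>p\<in>UNIV. \<Sum>k\<in>UNIV. F q d p k) =
          (\<Sum>q\<in>UNIV. \<Sum>p\<in>UNIV. \<Sum>d\<in>UNIV. \<Sum>k\<in>UNIV. F q d p k)"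
        by (rule sum.cong[OF refl], rule sum.swap)
      also have "\<dots> = (\<Sum>p\<in>UNIV. \<Sum>q\<in>UNIV. \<Sum>d\<in>UNIV. \<Sum>k\<in>UNIV. F q d p k)"
        by (rule sum.swap)
      also have "\<dots> = (\<Sum>p\<in>UNIV. \<Sum>q\<in>UNIV. \<Sum>k\<in>UNIV. \<Sum>d\<in>UNIV. F q d p k)"
        by (rule sum.cong[OF refl], rule sum.cong[OF refl], rule sum.swap)
      also have "\<dots> = (\<Sum>p\<in>UNIV. \<Sum>k\<in>UNIV. \<Sum>q\<in>UNIV. \<Sum>d\<in>UNIV. F q d p k)"
        by (rule sum.cong[OF refl], rule sum.swap)
      finally show ?thesis .
    qed
    show ?thesis
      unfolding sum_distrib_left by (subst sw) (simp add: mult_ac)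
  qed
  also have "\<dots> = - pd c r l x"
    unfolding 1 by (simp add: sum_negf t)
  also have "(\<Sum>q\<in>UNIV. \<Sum>d\<in>UNIV. H x $ q $ d * - (pd c q l x * g x c $ r $ d)) = - pd c r l x"
    by (simp add: sum_negf t)
  also have "(\<Sum>q\<in>UNIV. \<Sum>d\<in>UNIV. H x $ q $ d * (pd c r l x * g x c $ q $ d)) = ?n * pd c r l x"
    using trace_g[OF x, of "pd c r l x"] by (simp add: mult_ac)
  finally have "(?n - 2) * pd c r l x = 0" by (simp add: algebra_simps)
  then have "pd c r l x = 0" using n by simp
  then have "(2 * (?n - 1) / ?n) * pd c r J x = 0"
    unfolding l_def[abs_def] using x by (simp only: pd_cmult sm_J)
  then show ?thesis using n by simp
qed

end

section \<open>Conformal change of the metric\<close>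

text \<open>\<sigma> stands for a conformal scale in the trivialisation by \<open>g\<close>. Its
  sign is free, since \<open>gh\<close> contains only its square.\<close>

locale conformal_region = metric_region c W g
  for c :: "('m, 'n::finite) chart" and W and g :: "('m, 'n) tensor2_field" +
  fixes \<sigma> :: "'m \<Rightarrow> real"
  assumes sm_sigma: "sm \<sigma>"
    and sigma_nz: "y \<in> W \<Longrightarrow> \<sigma> y \<noteq> 0"
begin

definition gh :: "('m, 'n) tensor2_field" where
  "gh = rescale (\<lambda>x. 1 / (\<sigma> x)\<^sup>2) g"

definition s :: "'m \<Rightarrow> real" where "s y = 1 / (\<sigma> y)\<^sup>2"

lemma gh_eq: "gh y c $ a $ b = s y * g y c $ a $ b"
  by (simp add: gh_def rescale_def s_def)

lemma sm_s: "sm s"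
  unfolding s_def[abs_def] by (rule sm_divide[OF sm_const sm_power[OF sm_sigma]]) (simp add: sigma_nz)

lemma s_sigma: "y \<in> W \<Longrightarrow> (\<sigma> y)\<^sup>2 * s y = 1"
  using sigma_nz[of y] by (simp add: s_def)

lemma inv_gh: "y \<in> W \<Longrightarrow> g y c ** matrix_inv (g y c) = mat 1 \<Longrightarrow>
    gh y c ** ((\<sigma> y)\<^sup>2 *\<^sub>R inv_metric g c y) = mat 1"
  using s_sigma[of y]
  by (simp add: gh_def rescale_def inv_metric_def s_def matrix_scalar_ac scalar_matrix_assoc
      flip: scalar_matrix_assoc)

text \<open>Supplies a second copy of all curvature results, for \<open>gh\<close> under the prefix
  \<open>hat\<close>, to be compared with the copy for \<open>g\<close>.\<close>

sublocale hat: metric_region c W gh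
proof
  show "sm (\<lambda>y. gh y c $ a $ b)" for a b
    unfolding gh_eq by (intro sm_intros sm_s sm_g)
  show "gh y c $ a $ b = gh y c $ b $ a" if "y \<in> W" for y a b
    by (simp add: gh_eq g_sym[OF that, of a b])
  show "invertible (gh y c)" if "y \<in> W" for y
    using inv_gh[OF that matrix_inv_right[OF g_invertible[OF that]]]
    by (metis invertible_def matrix_left_right_inverse)
qed (rule dim)

lemma hat_H: "y \<in> W \<Longrightarrow> inv_metric gh c y $ a $ b = (\<sigma> y)\<^sup>2 * H y $ a $ b"
  using matrix_inv_eqI[OF inv_gh[of y]] matrix_inv_right[OF g_invertible[of y]]
  by (simp add: inv_metric_def)

text \<open>\<open>v\<close> is minus the usual $\Upsilon_a = \nabla_a\log\Omega$, since $\Omega = \sigma^{-1}$; \<open>vr\<close> is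
  \<open>v\<close> with its index raised.\<close>

definition v :: "'n \<Rightarrow> 'm \<Rightarrow> real" where "v a y = pd c a \<sigma> y / \<sigma> y"
definition vr :: "'n \<Rightarrow> 'm \<Rightarrow> real" where "vr k y = (\<Sum>e\<in>UNIV. H y $ k $ e * v e y)"
definition vv :: "'m \<Rightarrow> real" where "vv y = (\<Sum>e\<in>UNIV. v e y * vr e y)"

lemma sm_v: "sm (v a)"
  unfolding v_def[abs_def] by (rule sm_divide[OF sm_pd[OF sm_sigma] sm_sigma sigma_nz])

lemma pd_v:
  assumes x: "x \<in> W"
  shows "pd c a (v b) x = pd c a (pd c b \<sigma>) x / \<sigma> x - v a x * v b x"
  unfolding v_def[abs_def]
  by (subst pd_divide[OF x sm_pd[OF sm_sigma] sm_sigma]) (simp_all add: sigma_nz diff_divide_distrib)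

lemma pd_v_sym: "x \<in> W \<Longrightarrow> pd c a (v b) x = pd c b (v a) x"
  by (simp add: pd_v pd_commute[of x \<sigma> a b] sm_sigma)

lemma pd_s:
  assumes x: "x \<in> W"
  shows "pd c a s x = - 2 * v a x * s x"
proof -
  have "pd c a s x = (0 - 1 / (\<sigma> x)\<^sup>2 * pd c a (\<lambda>y. \<sigma> y * \<sigma> y) x) / (\<sigma> x)\<^sup>2"
    unfolding s_def[abs_def]
    by (subst pd_divide[OF x]) (simp_all add: sm_const sm_mult sm_sigma sigma_nz pd_const
        power2_eq_square)
  then show ?thesis
    using x sigma_nz[OF x] by (simp add: pd_mult sm_sigma v_def s_def power2_eq_square field_simps)
qed

text \<open>The change of the Levi-Civita connection with its index lowered by \<open>g\<close>; the
  overall factor \<open>s\<close> of \<open>hat.Cl\<close> is split off.\<close>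

definition E :: "'n \<Rightarrow> 'n \<Rightarrow> 'n \<Rightarrow> 'm \<Rightarrow> real" where
  "E k a b y = - v a y * g y c $ k $ b - v b y * g y c $ k $ a + v k y * g y c $ a $ b"

section \<open>Connection and curvature of the rescaled metric\<close>

lemma hat_Cl:
  assumes x: "x \<in> W"
  shows "hat.Cl k a b x = s x * (Cl k a b x + E k a b x)"
proof -
  have "pd c i (\<lambda>y. gh y c $ j $ l) x = s x * (pd c i (\<lambda>y. g y c $ j $ l) x
      - 2 * v i x * g x c $ j $ l)" for i j l
    unfolding gh_eq using x by (simp add: pd_mult sm_s sm_g pd_s algebra_simps)
  note eq = this
  show ?thesis
    unfolding hat.Cl_def Cl_def E_def eq g_sym[OF x, of a k] by (simp add: field_simps)
qed

lemma hat_christoffel: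
  assumes x: "x \<in> W"
  shows "christoffel gh c k a b x = \<Gamma> k a b x
    - v a x * (if k = b then 1 else 0) - v b x * (if k = a then 1 else 0) + vr k x * g x c $ a $ b"
proof -
  have "christoffel gh c k a b x = (\<Sum>e\<in>UNIV. ((\<sigma> x)\<^sup>2 * s x) * (H x $ k $ e * (Cl e a b x + E e a b x)))"
    unfolding hat.christoffel_Cl hat_H[OF x] hat_Cl[OF x] by (simp add: mult_ac)
  also have "\<dots> = \<Gamma> k a b x + (\<Sum>e\<in>UNIV. H x $ k $ e * E e a b x)"
    by (simp add: s_sigma[OF x] christoffel_Cl distrib_left sum.distrib)
  also have "(\<Sum>e\<in>UNIV. H x $ k $ e * E e a b x) =
      - v a x * (\<Sum>e\<in>UNIV. H x $ k $ e * g x c $ e $ b) - v b x * (\<Sum>e\<in>UNIV. H x $ k $ e * g x c $ e $ a)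
      + vr k x * g x c $ a $ b"
    by (simp add: E_def vr_def sum_distrib_left sum_distrib_right distrib_left right_diff_distrib
        sum.distrib
        sum_subtractf sum_negf mult_ac)
  finally show ?thesis by (simp add: H_g[OF x])
qed

text \<open>The Christoffel part of the covariant derivative of \<open>v\<close>, which is
  \<open>pd c a (v b) - Wc a b\<close>.\<close>

definition Wc :: "'n \<Rightarrow> 'n \<Rightarrow> 'm \<Rightarrow> real" where
  "Wc a b y = (\<Sum>e\<in>UNIV. \<Gamma> e a b y * v e y)"

lemma Cl_vr: "x \<in> W \<Longrightarrow> (\<Sum>e\<in>UNIV. Cl e a b x * vr e x) = Wc a b x"
  unfolding Wc_def christoffel_Cl vr_def sum_distrib_left sum_distrib_right
  by (subst sum.swap) (simp add: H_sym mult_ac)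

lemma lower_vr: "x \<in> W \<Longrightarrow> (\<Sum>e\<in>UNIV. g x c $ k $ e * vr e x) = v k x"
  unfolding vr_def by (rule lower_raise)

text \<open>All new index sums are contracted here, so that the curvature formula becomes a
  polynomial identity in scalars.\<close>

lemma hat_Bil:
  assumes x: "x \<in> W"
  shows "(\<Sum>e\<in>UNIV. hat.Cl e a k x * christoffel gh c e b d x) = s x * (Bil a k b d x
    - v b x * (Cl d a k x + E d a k x) - v d x * (Cl b a k x + E b a k x)
    + g x c $ b $ d * (Wc a k x - 2 * v a x * v k x + vv x * g x c $ a $ k)
    - v a x * Cl k b d x - v k x * Cl a b d x + g x c $ a $ k * Wc b d x)"
proof -
  have E: "(\<Sum>e\<in>UNIV. E e a k x * Y e) = - v a x * (\<Sum>e\<in>UNIV. g x c $ k $ e * Y e)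
      - v k x * (\<Sum>e\<in>UNIV. g x c $ a $ e * Y e) + g x c $ a $ k * (\<Sum>e\<in>UNIV. Y e * v e x)" for Y
    unfolding sum_distrib_left sum_subtractf[symmetric] sum.distrib[symmetric]
  proof (rule sum.cong[OF refl])
    show "E e a k x * Y e = - v a x * (g x c $ k $ e * Y e) - v k x * (g x c $ a $ e * Y e)
        + g x c $ a $ k * (Y e * v e x)" for e
      unfolding E_def g_sym[OF x, of e k] g_sym[OF x, of e a] by (simp add: algebra_simps)
  qed
  have F: "(\<Sum>e\<in>UNIV. X e * (\<Gamma> e b d x - v b x * (if e = d then 1 else 0) - v d x * (if e
      = b then 1 else 0)
      + vr e x * g x c $ b $ d)) = (\<Sum>e\<in>UNIV. X e * \<Gamma> e b d x) - v b x * X d - v d x * X b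
      + g x c $ b $ d * (\<Sum>e\<in>UNIV. X e * vr e x)" for X
  proof -
    have "(\<Sum>e\<in>UNIV. X e * (\<Gamma> e b d x - v b x * (if e = d then 1 else 0) - v d x * (if e
        = b then 1 else 0)
      + vr e x * g x c $ b $ d)) = (\<Sum>e\<in>UNIV. X e * \<Gamma> e b d x) - (\<Sum>e\<in>UNIV. if e
          = d then v b x * X e else 0)
      - (\<Sum>e\<in>UNIV. if e = b then v d x * X e else 0) + (\<Sum>e\<in>UNIV. g x c $ b $ d * (X e * vr e x))"
      unfolding sum.distrib[symmetric] sum_subtractf[symmetric]
      by (rule sum.cong[OF refl]) (simp add: algebra_simps)
    then show ?thesis by (simp add: sum_distrib_left)
  qed
  have 1: "(\<Sum>e\<in>UNIV. (Cl e a k x + E e a k x) * \<Gamma> e b d x) = Bil a k b d x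
     - v a x * Cl k b d x - v k x * Cl a b d x + g x c $ a $ k * Wc b d x"
    unfolding distrib_right sum.distrib E lower_christoffel[OF x] by (simp add: Bil_def Wc_def)
  have 2: "(\<Sum>e\<in>UNIV. (Cl e a k x + E e a k x) * vr e x) =
     Wc a k x - 2 * v a x * v k x + vv x * g x c $ a $ k"
    unfolding distrib_right sum.distrib E lower_vr[OF x] Cl_vr[OF x] by (simp add: vv_def mult_ac)
  have "(\<Sum>e\<in>UNIV. hat.Cl e a k x * christoffel gh c e b d x) =
      s x * (\<Sum>e\<in>UNIV. (Cl e a k x + E e a k x) * (\<Gamma> e b d x - v b x * (if e = d then 1 else 0)
        - v d x * (if e = b then 1 else 0) + vr e x * g x c $ b $ d))"
    unfolding hat_Cl[OF x] hat_christoffel[OF x] sum_distrib_left mult.assoc ..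
  then show ?thesis unfolding F 1 2 by simp
qed

lemma pd_hat_Cl:
  assumes x: "x \<in> W"
  shows "pd c a (hat.Cl k b d) x = s x * (- 2 * v a x * (Cl k b d x + E k b d x) + pd c a (Cl k b d) x
    - (pd c a (v b) x * g x c $ k $ d + v b x * (Cl k a d x + Cl d a k x))
    - (pd c a (v d) x * g x c $ k $ b + v d x * (Cl k a b x + Cl b a k x))
    + (pd c a (v k) x * g x c $ b $ d + v k x * (Cl b a d x + Cl d a b x)))"
proof -
  have "pd c a (hat.Cl k b d) x = pd c a (\<lambda>y. s y * (Cl k b d y + E k b d y)) x"
    by (rule pd_cong[OF x hat_Cl])
  then show ?thesis
    unfolding E_def using x
    by (simp add: pd_rules sm_intros sm_s sm_Cl sm_v sm_g pd_g pd_s algebra_simps)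
qed

text \<open>With \<Upsilon> equal to \<open>- v\<close> this is the classical change of the Schouten
  tensor: minus the covariant derivative of \<Upsilon>, plus its tensor square, minus half its
  squared norm times \<open>g\<close>.\<close>

definition Q :: "'n \<Rightarrow> 'n \<Rightarrow> 'm \<Rightarrow> real" where
  "Q a b y = pd c a (v b) y - Wc a b y + v a y * v b y - vv y / 2 * g y c $ a $ b"

lemma Wc_sym: "x \<in> W \<Longrightarrow> Wc a b x = Wc b a x"
  by (simp add: Wc_def christoffel_sym[of x _ a b])

lemma Q_sym: "x \<in> W \<Longrightarrow> Q a b x = Q b a x"
  by (simp add: Q_def pd_v_sym[of x a b] Wc_sym[of x a b] g_sym[of x a b])

text \<open>Apart from the factor \<open>s\<close> due to lowering with \<open>gh\<close>, the
  curvature changes only by a Kulkarni-Nomizu product with \<open>g\<close>. This is the conformal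
  invariance of the Weyl tensor.\<close>

lemma hat_riem_low:
  assumes x: "x \<in> W"
  shows "riem_low gh c a b k d x = s x * (Rl a b k d x + kulkarni (\<lambda>i j. Q i j x) a b k d x)"
proof -
  \<comment> \<open>Each instance fixes one order for a symmetric pair of indices, so that equal
    terms become literally equal before the arithmetic.\<close>
  note sym = g_sym[OF x, of d k] g_sym[OF x, of d b] g_sym[OF x, of d a] g_sym[OF x, of k b]
    g_sym[OF x, of k a] g_sym[OF x, of b a] Cl_sym[OF x, of _ d k] Cl_sym[OF x, of _ d b]
    Cl_sym[OF x, of _ d a] Cl_sym[OF x, of _ k b] Cl_sym[OF x, of _ k a] Cl_sym[OF x, of _ b a]
    Wc_sym[OF x, of d k] Wc_sym[OF x, of d b] Wc_sym[OF x, of d a] Wc_sym[OF x, of k b]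
    Wc_sym[OF x, of k a] Wc_sym[OF x, of b a]
    pd_v_sym[OF x, of d k] pd_v_sym[OF x, of d b] pd_v_sym[OF x, of d a] pd_v_sym[OF x, of k b]
    pd_v_sym[OF x, of k a] pd_v_sym[OF x, of b a]
  show ?thesis
    unfolding hat.riem_low_eq[OF x] riem_low_eq[OF x] hat_Bil[OF x] pd_hat_Cl[OF x]
        Bil_def[symmetric] kulkarni_def Q_def E_def
    unfolding sym
    by (simp add: field_simps)
qed

lemma hat_tr: "x \<in> W \<Longrightarrow> hat.tr X x = (\<sigma> x)\<^sup>2 * tr X x"
  by (simp add: hat.tr_def tr_def hat_H sum_distrib_left mult_ac)

lemma hat_Ric:
  assumes x: "x \<in> W"
  shows "hat.Ric b d x = Ric b d x + (real CARD('n) - 2) * Q b d x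
      + tr (\<lambda>i j. Q i j x) x * g x c $ b $ d"
proof -
  have "hat.Ric b d x = (\<Sum>i\<in>UNIV. \<Sum>k\<in>UNIV. ((\<sigma> x)\<^sup>2 * s x) * (H x $ i $ k * (Rl i b k d x
      + kulkarni (\<lambda>i j. Q i j x) i b k d x)))"
    unfolding hat.Ric_def hat_H[OF x] hat_riem_low[OF x] by (simp add: mult_ac)
  also have "\<dots> = Ric b d x + (\<Sum>i\<in>UNIV. \<Sum>k\<in>UNIV. H x $ i $ k * kulkarni (\<lambda>i j. Q i j x) i b k d x)"
    by (simp add: s_sigma[OF x] distrib_left sum.distrib Ric_def)
  finally show ?thesis by (simp add: trace_kulkarni[OF x])
qed

text \<open>The trace scales by \<sigma>^2 and \<open>gh\<close> by its inverse, so
  \<open>(tr P) g\<close> has the same form for both metrics and \<open>P + Q\<close> solves the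
  Ricci equation of \<open>gh\<close>.\<close>

lemma hat_schouten:
  assumes x: "x \<in> W"
  shows "schouten gh c x = (\<chi> a b. Sch a b x + Q a b x)"
proof (rule hat.schouten_eqI[OF x])
  show "transpose (\<chi> a b. Sch a b x + Q a b x) = (\<chi> a b. Sch a b x + Q a b x)"
    using schouten_sym[OF x] Q_sym[OF x] by (simp add: transpose_def vec_eq_iff)
  show "hat.Ric b d x = (real CARD('n) - 2) * (\<chi> a b. Sch a b x + Q a b x) $ b $ d
      + hat.tr (\<lambda>i j. (\<chi> a b. Sch a b x + Q a b x) $ i $ j) x * gh x c $ b $ d" for b d
  proof -
    have "hat.tr (\<lambda>i j. Sch i j x + Q i j x) x * gh x c $ b $ d =
        ((\<sigma> x)\<^sup>2 * s x) * (tr (\<lambda>i j. Sch i j x + Q i j x) x * g x c $ b $ d)"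
      by (simp add: hat_tr[OF x] gh_eq mult_ac)
    also have "\<dots> = (J x + tr (\<lambda>i j. Q i j x) x) * g x c $ b $ d"
      by (simp only: s_sigma[OF x] tr_add J_tr mult_1)
    finally show ?thesis
      by (simp add: hat_Ric[OF x] Ric_schouten[OF x] algebra_simps)
  qed
qed

text \<open>In the paper's notation \<open>N\<close> is $\nabla_a\nabla_b\sigma$, \<open>\<rho>\<close> is the bottom slot of
  $\frac1nD\sigma$, and \<open>mu2\<close> is $\mu^a\mu_a$.\<close>

definition N :: "'n \<Rightarrow> 'n \<Rightarrow> 'm \<Rightarrow> real" where
  "N a b y = pd c a (pd c b \<sigma>) y - (\<Sum>e\<in>UNIV. \<Gamma> e a b y * pd c e \<sigma> y)"
definition \<rho> :: "'m \<Rightarrow> real" where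
  "\<rho> y = - (tr (\<lambda>a b. N a b y) y + J y * \<sigma> y) / real CARD('n)"
definition mu2 :: "'m \<Rightarrow> real" where
  "mu2 y = (\<Sum>a\<in>UNIV. \<Sum>b\<in>UNIV. H y $ a $ b * (pd c a \<sigma> y * pd c b \<sigma> y))"

section \<open>The Einstein condition as an equation for the scale\<close>

lemma vv_mu2: "vv y = mu2 y / (\<sigma> y)\<^sup>2"
  by (simp add: vv_def vr_def v_def mu2_def sum_distrib_left sum_divide_distrib power2_eq_square mult_ac)

text \<open>Differentiating \<open>v\<close>, the quotient of d\<sigma> by \<sigma>, yields a term
  \<open>- v v\<close> that cancels the tensor square in \<open>Q\<close>. Only the pure trace
  remains quadratic in the gradient.\<close>

lemma Q_N: "x \<in> W \<Longrightarrow> Q a b x = N a b x / \<sigma> x - vv x / 2 * g x c $ a $ b"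
  by (simp add: Q_def pd_v N_def Wc_def v_def sum_divide_distrib diff_divide_distrib)

lemma hat_J:
  assumes x: "x \<in> W"
  shows "J_trace gh c x = - real CARD('n) * (\<sigma> x * \<rho> x + mu2 x / 2)"
proof -
  let ?n = "real CARD('n)"
  have n: "?n > 0" using dim by linarith
  have "J_trace gh c x = (\<sigma> x)\<^sup>2 * (J x + tr (\<lambda>a b. 1 / \<sigma> x * N a b x + g x c $ a $ b * (- vv x / 2)) x)"
  proof -
    have "(\<lambda>a b. hat.Sch a b x) = (\<lambda>a b. Sch a b x + (1 / \<sigma> x * N a b x + g x c $ a $ b * (- vv x / 2)))"
      by (simp add: fun_eq_iff hat_schouten[OF x] Q_N[OF x])
    then show ?thesis unfolding hat.J_tr hat_tr[OF x] J_tr by (simp only: tr_add)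
  qed
  also have "\<dots> = (\<sigma> x)\<^sup>2 * J x + \<sigma> x * tr (\<lambda>a b. N a b x) x - ?n * mu2 x / 2"
    using sigma_nz[OF x] by (simp only: tr_add tr_cmult tr_g[OF x] vv_mu2)
        (simp add: field_simps power2_eq_square)
  also have "\<dots> = - ?n * (\<sigma> x * \<rho> x + mu2 x / 2)"
    using n by (simp add: \<rho>_def field_simps power2_eq_square)
  finally show ?thesis .
qed

text \<open>The gradient-squared terms of \<open>Q_N\<close> and \<open>hat_J\<close> cancel, and
  what is left is the middle equation divided by \<sigma>.\<close>

lemma einstein_at_iff:
  assumes x: "x \<in> W"
  shows "schouten gh c x - (J_trace gh c x / real CARD('n)) *\<^sub>R gh x c = 0 \<longleftrightarrow>
    (\<forall>a b. N a b x + g x c $ a $ b * \<rho> x + Sch a b x * \<sigma> x = 0)"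
proof -
  have n: "real CARD('n) > 0" using dim by linarith
  have "(schouten gh c x - (J_trace gh c x / real CARD('n)) *\<^sub>R gh x c) $ a $ b =
    (N a b x + g x c $ a $ b * \<rho> x + Sch a b x * \<sigma> x) / \<sigma> x" for a b
    using sigma_nz[OF x] n
    by (simp add: hat_schouten[OF x] hat_J[OF x] gh_eq s_def Q_N[OF x] vv_mu2 field_simps
        power2_eq_square)
  then show ?thesis using sigma_nz[OF x] by (simp add: vec_eq_iff)
qed

text \<open>Used for a parallel tractor: the trace of the middle equation forces its bottom slot to
  be that of \<sigma>.\<close>

lemma hessian_trace_determines:
  assumes x: "x \<in> W" and "\<And>a b. N a b x + g x c $ a $ b * r + Sch a b x * \<sigma> x = 0"
  shows "r = \<rho> x"
proof -
  have n: "real CARD('n) > 0" using dim by linarith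
  have "0 = tr (\<lambda>a b. N a b x + g x c $ a $ b * r + \<sigma> x * Sch a b x) x"
    using assms(2) by (simp add: mult.commute[of "\<sigma> x"] tr_def)
  also have "\<dots> = tr (\<lambda>a b. N a b x) x + real CARD('n) * r + J x * \<sigma> x"
    by (simp only: tr_add tr_cmult tr_g[OF x] J_tr) simp
  finally show ?thesis using n by (simp add: \<rho>_def field_simps)
qed

lemma sm_N: "sm (N a b)"
  unfolding N_def[abs_def] by (intro sm_intros sm_christoffel sm_sigma)

lemma sm_rho: "sm \<rho>"
  unfolding \<rho>_def[abs_def] tr_def by (intro sm_intros sm_H sm_N sm_J sm_sigma)

lemma sm_mu2: "sm mu2"
  unfolding mu2_def[abs_def] by (intro sm_intros sm_H sm_sigma)

text \<open>The scalar curvature of the Einstein metric is a constant multiple of the squared norm of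
  the tractor; differentiating gives the equation for the bottom slot.\<close>

lemma einstein_bottom_slot:
  assumes E: "\<And>y a b. y \<in> W \<Longrightarrow> N a b y + g y c $ a $ b * \<rho> y + Sch a b y * \<sigma> y = 0"
    and x: "x \<in> W"
  shows "pd c a \<rho> x = (\<Sum>b\<in>UNIV. Sch a b x * (\<Sum>e\<in>UNIV. H x $ b $ e * pd c e \<sigma> x))"
proof -
  let ?n = "real CARD('n)"
  have n: "?n > 0" using dim by linarith
  have "hat.Sch a b y = J_trace gh c y / ?n * gh y c $ a $ b" if "y \<in> W" for a b y
  proof -
    have "schouten gh c y = (J_trace gh c y / ?n) *\<^sub>R gh y c"
      using einstein_at_iff[OF that] E[OF that] by simp
    then show ?thesis by simp
  qed
  then have "0 = pd c a (J_trace gh c) x"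
    using hat.einstein_J_const[OF _ x] by simp
  also have "\<dots> = pd c a (\<lambda>y. (- ?n) * (\<sigma> y * \<rho> y + mu2 y / 2)) x"
    by (rule pd_cong[OF x hat_J])
  also have "\<dots> = - ?n * (pd c a \<sigma> x * \<rho> x + \<sigma> x * pd c a \<rho> x + pd c a mu2 x / 2)"
    using x by (simp only: pd_cmult pd_add pd_mult pd_divide_const sm_intros sm_sigma sm_rho sm_mu2)
  finally have 1: "\<sigma> x * pd c a \<rho> x = - pd c a \<sigma> x * \<rho> x - pd c a mu2 x / 2"
    using n by simp
  \<comment> \<open>\<open>mu2\<close> is the trace of the tensor square of d\<sigma>, so
    \<open>cov2_trace\<close> replaces its derivative by the covariant one, in which
    \<open>N\<close> appears.\<close>
  have 2: "pd c a mu2 x = (\<Sum>b\<in>UNIV. \<Sum>d\<in>UNIV. H x $ b $ d * (N a b x * pd c d \<sigma> x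
      + pd c b \<sigma> x * N a d x))"
  proof -
    have "pd c a mu2 x = (\<Sum>b\<in>UNIV. \<Sum>d\<in>UNIV. H x $ b $ d * cov2 a (\<lambda>b d y. pd c b \<sigma> y * pd c d \<sigma> y) b
        d x)"
      unfolding mu2_def[abs_def] by (rule cov2_trace[OF x, symmetric]) (intro sm_intros sm_sigma)
    moreover have "cov2 a (\<lambda>b d y. pd c b \<sigma> y * pd c d \<sigma> y) b d x =
        N a b x * pd c d \<sigma> x + pd c b \<sigma> x * N a d x" for b d
      using x by (simp add: cov2_def pd_mult sm_intros sm_sigma N_def sum_distrib_left sum_distrib_right
          algebra_simps)
    ultimately show ?thesis by simp
  qed
  have 3: "(\<Sum>b\<in>UNIV. \<Sum>d\<in>UNIV. H x $ b $ d * (pd c b \<sigma> x * N a d x)) =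
      (\<Sum>b\<in>UNIV. \<Sum>d\<in>UNIV. H x $ b $ d * (N a b x * pd c d \<sigma> x))"
    by (subst sum.swap) (simp add: H_sym[OF x] mult_ac)
  have N: "N a b x = - \<rho> x * g x c $ a $ b - \<sigma> x * Sch a b x" for b
    using E[OF x, of a b] by (simp add: algebra_simps)
  have "pd c a mu2 x / 2 = (\<Sum>b\<in>UNIV. \<Sum>d\<in>UNIV. H x $ b $ d * (N a b x * pd c d \<sigma> x))"
    unfolding 2 distrib_left sum.distrib 3 by simp
  \<comment> \<open>The middle equation is inserted for \<open>N\<close>. Its \<open>g\<close> part
    cancels the term with \<rho> in fact 1, and its \<open>Sch\<close> part is the right-hand
    side.\<close>
  also have "\<dots> = - \<rho> x * (\<Sum>b\<in>UNIV. g x c $ a $ b * (\<Sum>d\<in>UNIV. H x $ b $ d * pd c d \<sigma> x))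
     - \<sigma> x * (\<Sum>b\<in>UNIV. Sch a b x * (\<Sum>d\<in>UNIV. H x $ b $ d * pd c d \<sigma> x))"
    unfolding N by (simp add: sum_distrib_left algebra_simps sum.distrib sum_subtractf sum_negf)
  also have "(\<Sum>b\<in>UNIV. g x c $ a $ b * (\<Sum>d\<in>UNIV. H x $ b $ d * pd c d \<sigma> x)) = pd c a \<sigma> x"
    by (rule lower_raise[OF x])
  finally have 4: "pd c a mu2 x / 2 = - \<rho> x * pd c a \<sigma> x
      - \<sigma> x * (\<Sum>b\<in>UNIV. Sch a b x * (\<Sum>d\<in>UNIV. H x $ b $ d * pd c d \<sigma> x))" .
  have "\<sigma> x * pd c a \<rho> x = \<sigma> x * (\<Sum>b\<in>UNIV. Sch a b x * (\<Sum>d\<in>UNIV. H x $ b $ d * pd c d \<sigma> x))"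
    unfolding 1 4 by simp
  then show ?thesis using sigma_nz[OF x] by simp
qed

end

section \<open>Tractors\<close>

lemma has_signature_invertible:
  assumes "has_signature p Q"
  shows "invertible Q"
proof -
  obtain B and d :: "'a \<Rightarrow> real" where "invertible B" and d: "\<And>i. d i = 1 \<or> d i = -1"
    and eq: "transpose B ** Q ** B = (\<chi> i j. if i = j then d i else 0)"
    using assms unfolding has_signature_def by blast
  have "det (transpose B ** Q ** B) = (\<Prod>i\<in>UNIV. d i)"
    unfolding eq by (subst det_diagonal) auto
  also have "\<dots> \<noteq> 0" using d by (metis (no_types, lifting) finite prod_zero_iff zero_neq_neg_one
      zero_neq_one)
  finally show ?thesis by (auto simp: det_mul invertible_det_nz)
qed

locale conformal_manifold =
  fixes A :: "('m::{t2_space,second_countable_topology}, 'n::finite) chart set"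
    and G :: "('m, 'n) tensor2_field set"
  assumes dim: "CARD('n) \<ge> 3"
    and atlas: "smooth_atlas A"
    and conf: "conformal_class A G"
begin

section \<open>Charts, transition maps and change of coordinates\<close>

lemma chart_region:
  assumes c: "c \<in> A" and V: "open V" "V \<subseteq> chart_dom c"
  shows "chart_region c V"
proof
  have h: "homeomorphism (chart_dom c) (coords c ` chart_dom c) (coords c) (chart_inv c)"
    and o: "open (chart_dom c)" "open (coords c ` chart_dom c)"
    using atlas c by (auto simp: smooth_atlas_def)
  show "inj_on (coords c) (chart_dom c)"
    using h by (auto simp: homeomorphism_def intro: inj_on_inverseI)
  have "openin (top_of_set (coords c ` chart_dom c)) (coords c ` V)"
    using V o by (intro homeomorphism_imp_open_map[OF h]) (auto simp: openin_open_eq)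
  then show "open (coords c ` V)" using o by (simp add: openin_open_eq)
qed (use V in auto)

lemma open_chart_dom: "c \<in> A \<Longrightarrow> open (chart_dom c)"
  using atlas by (auto simp: smooth_atlas_def)

lemma chart_region_Int: "c \<in> A \<Longrightarrow> open V \<Longrightarrow> chart_region c (chart_dom c \<inter> V)"
  by (rule chart_region) (auto simp: open_chart_dom open_Int)

lemma ex_chart: "\<exists>c. c \<in> charts_at A x"
proof -
  have "(\<Union>c\<in>A. chart_dom c) = UNIV" using atlas unfolding smooth_atlas_def by blast
  then show ?thesis unfolding charts_at_def by blast
qed

lemma charts_atD: "c \<in> charts_at A x \<Longrightarrow> c \<in> A" "c \<in> charts_at A x \<Longrightarrow> x \<in> chart_dom c"
  by (auto simp: charts_at_def)

lemma smooth_fn_sm: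
  assumes "smooth_fn A V f" "c \<in> A" "open V"
  shows "chart_region.sm c (chart_dom c \<inter> V) f"
  using assms by (simp add: chart_region.sm_def chart_region_Int smooth_fn_def)

lemma smooth_fn_iff:
  assumes "open V"
  shows "smooth_fn A V f \<longleftrightarrow> (\<forall>c\<in>A. chart_region.sm c (chart_dom c \<inter> V) f)"
  using assms by (simp add: chart_region.sm_def chart_region_Int smooth_fn_def)

lemma smooth_transition:
  assumes c: "c \<in> A" and d: "d \<in> A" and V: "open V" "V \<subseteq> chart_dom c" "V \<subseteq> chart_dom d"
  shows "smooth_on (coords c ` V) (coords d \<circ> chart_inv c)"
  by (rule smooth_on_subset[of "coords c ` (chart_dom c \<inter> chart_dom d)"])
    (use atlas c d V in \<open>auto simp: smooth_atlas_def\<close>)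

lemma sm_transfer:
  assumes c: "c \<in> A" and d: "d \<in> A" and V: "open V" "V \<subseteq> chart_dom c" "V \<subseteq> chart_dom d"
    and f: "chart_region.sm d V f"
  shows "chart_region.sm c V f"
proof -
  interpret c: chart_region c V using c V by (intro chart_region)
  interpret d: chart_region d V using d V by (intro chart_region)
  have "smooth_on (coords c ` V) (\<lambda>u. (f \<circ> chart_inv d) ((coords d \<circ> chart_inv c) u))"
    by (rule smooth_on_compose[OF c.open_image d.open_image _ f[unfolded d.sm_def]
        smooth_transition[OF c d V]])
      (auto simp: c.chart_inv_coords)
  then show ?thesis
    unfolding c.sm_def
    by (rule smooth_on_cong[OF c.open_image, THEN iffD1, rotated])
      (auto simp: c.chart_inv_coords d.chart_inv_coords)
qed

lemma sm_coords:
  assumes c: "c \<in> A" and d: "d \<in> A" and V: "open V" "V \<subseteq> chart_dom c" "V \<subseteq> chart_dom d"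
  shows "chart_region.sm c V (\<lambda>y. coords d y $ i)"
proof -
  interpret c: chart_region c V using c V by (intro chart_region)
  show ?thesis
    using smooth_on_component[OF c.open_image smooth_transition[OF c d V], of i]
    by (simp add: c.sm_def comp_def)
qed

lemma pd_chain:
  assumes c: "c \<in> A" and d: "d \<in> A" and V: "open V" "V \<subseteq> chart_dom c" "V \<subseteq> chart_dom d"
    and f: "chart_region.sm d V f" and x: "x \<in> V"
  shows "pd c a f x = (\<Sum>i\<in>UNIV. pd c a (\<lambda>y. coords d y $ i) x * pd d i f x)"
proof -
  interpret c: chart_region c V using c V by (intro chart_region)
  interpret d: chart_region d V using d V by (intro chart_region)
  let ?t = "coords d \<circ> chart_inv c" and ?u = "coords c x"
  have tx: "?t ?u = coords d x" using x by (simp add: c.chart_inv_coords)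
  have t: "(?t has_derivative frechet_derivative ?t (at ?u)) (at ?u)"
    using smooth_on_differentiable[OF smooth_transition[OF c d V] c.open_image] x
    by (auto simp: frechet_derivative_works)
  have F: "(f \<circ> chart_inv d) differentiable (at (?t ?u))"
    unfolding tx using d.sm_has_derivative[OF f x] by (auto simp: differentiable_def)
  have "((f \<circ> chart_inv c) has_derivative (\<lambda>v. \<Sum>i\<in>UNIV. frechet_derivative (f \<circ> chart_inv d) (at
      (?t ?u)) (axis i 1) *
      (frechet_derivative ?t (at ?u) v $ i))) (at ?u)"
    by (rule has_derivative_transform_within_open[OF has_derivative_compose_axis[OF t F] c.open_image])
      (use x in \<open>auto simp: c.chart_inv_coords d.chart_inv_coords\<close>)
  from c.pd_eqI[OF this, unfolded tx] have "pd c a f x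
      = (\<Sum>i\<in>UNIV. pd d i f x * (frechet_derivative ?t (at ?u) (axis a 1) $ i))"
    by (simp add: pd_def)
  moreover have "pd c a (\<lambda>y. coords d y $ i) x = frechet_derivative ?t (at ?u) (axis a 1) $ i" for i
    by (rule c.pd_eqI)
      (use bounded_linear.has_derivative[OF bounded_linear_vec_nth t, of i] in \<open>simp add: comp_def\<close>)
  ultimately show ?thesis by (simp add: mult.commute)
qed

text \<open>Differentiating the chain rule again produces second derivatives of the transition map,
  each multiplied by a first derivative of \<open>f\<close>, which \<open>crit\<close> makes
  zero.\<close>

lemma hessian_transform:
  assumes c: "c \<in> A" and d: "d \<in> A" and V: "open V" "V \<subseteq> chart_dom c" "V \<subseteq> chart_dom d"
    and f: "chart_region.sm d V f" and x: "x \<in> V" and crit: "\<And>i. pd d i f x = 0"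
  shows "pd c a (pd c b f) x = (\<Sum>i\<in>UNIV. \<Sum>j\<in>UNIV.
    pd c a (\<lambda>y. coords d y $ i) x * pd c b (\<lambda>y. coords d y $ j) x * pd d i (pd d j f) x)"
proof -
  interpret c: chart_region c V using c V by (intro chart_region)
  interpret d: chart_region d V using d V by (intro chart_region)
  note t = sm_coords[OF c d V]
  have s: "c.sm (pd d j f)" for j by (rule sm_transfer[OF c d V d.sm_pd[OF f]])
  have "pd c a (pd c b f) x = pd c a (\<lambda>x. \<Sum>j\<in>UNIV. pd c b (\<lambda>y. coords d y $ j) x * pd d j f x) x"
    by (rule c.pd_cong[OF x pd_chain[OF c d V f]])
  also have "\<dots> = (\<Sum>j\<in>UNIV. pd c b (\<lambda>y. coords d y $ j) x * pd c a (pd d j f) x)"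
    using x by (simp add: c.pd_rules c.sm_intros t s crit)
  also have "\<dots> = (\<Sum>j\<in>UNIV. \<Sum>i\<in>UNIV.
      pd c a (\<lambda>y. coords d y $ i) x * pd c b (\<lambda>y. coords d y $ j) x * pd d i (pd d j f) x)"
    by (simp add: pd_chain[OF c d V d.sm_pd[OF f] x] sum_distrib_left mult_ac)
  also have "\<dots> = (\<Sum>i\<in>UNIV. \<Sum>j\<in>UNIV.
      pd c a (\<lambda>y. coords d y $ i) x * pd c b (\<lambda>y. coords d y $ j) x * pd d i (pd d j f) x)"
    by (rule sum.swap)
  finally show ?thesis .
qed

text \<open>\<open>smooth_fn\<close> asks for smoothness in every chart of the atlas; the transition
  maps reduce this to one chart covering the set.\<close>

lemma smooth_fn_of_chart:
  assumes c: "c \<in> A" and f: "chart_region.sm c (chart_dom c) f" and eq: "\<And>y. y \<in> chart_dom c \<Longrightarrow> h y = f y"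
  shows "smooth_fn A (chart_dom c) h"
  unfolding smooth_fn_iff[OF open_chart_dom[OF c]]
proof
  fix d assume d: "d \<in> A"
  interpret c: chart_region c "chart_dom c" using c by (intro chart_region open_chart_dom) auto
  let ?V = "chart_dom d \<inter> chart_dom c"
  have V: "open ?V" using c d by (intro open_Int open_chart_dom)
  interpret cV: chart_region c ?V using c V by (intro chart_region) auto
  interpret d: chart_region d ?V using d V by (intro chart_region) auto
  have "cV.sm f" by (rule c.sm_subset[OF f]) (auto intro: cV.open_image)
  then have "d.sm f" using V by (intro sm_transfer[OF d c]) auto
  then show "d.sm h" by (subst d.sm_cong[of h f]) (auto simp: eq)
qed

lemma smooth_fn_subset: "smooth_fn A V f \<Longrightarrow> U \<subseteq> V \<Longrightarrow> smooth_fn A U f"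
  unfolding smooth_fn_def by (blast intro: smooth_on_subset)

lemma smooth_fn_mult:
  assumes "open V" "smooth_fn A V f" "smooth_fn A V h"
  shows "smooth_fn A V (\<lambda>y. f y * h y)"
  using assms(2,3) unfolding smooth_fn_iff[OF assms(1)]
  by (auto intro: chart_region.sm_mult chart_region_Int assms(1))

lemma smooth_fn_diff:
  assumes "open V" "smooth_fn A V f" "smooth_fn A V h"
  shows "smooth_fn A V (\<lambda>y. f y - h y)"
  using assms(2,3) unfolding smooth_fn_iff[OF assms(1)]
  by (auto intro: chart_region.sm_diff chart_region_Int assms(1))

section \<open>Metrics of the class and differences of densities\<close>

lemma rescale_in_class:
  assumes "g \<in> G" "pos_smooth A \<Omega>"
  shows "rescale (\<lambda>y. (\<Omega> y)\<^sup>2) g \<in> G"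
proof -
  obtain g0 where G: "G = {rescale (\<lambda>x. (\<Omega> x)\<^sup>2) g0 | \<Omega>. pos_smooth A \<Omega>}"
    using conf by (auto simp: conformal_class_def)
  obtain \<Omega>' where O: "pos_smooth A \<Omega>'" "g = rescale (\<lambda>x. (\<Omega>' x)\<^sup>2) g0"
    using assms(1) G by auto
  have "rescale (\<lambda>y. (\<Omega> y)\<^sup>2) g = rescale (\<lambda>y. (\<Omega> y * \<Omega>' y)\<^sup>2) g0"
    by (simp add: O(2) rescale_def power_mult_distrib)
  moreover have "pos_smooth A (\<lambda>y. \<Omega> y * \<Omega>' y)"
    using assms(2) O(1) by (simp add: pos_smooth_def smooth_fn_mult)
  ultimately show ?thesis
    unfolding G mem_Collect_eq by (intro exI[of _ "\<lambda>y. \<Omega> y * \<Omega>' y"] conjI)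
qed

lemma metric_region:
  assumes c: "c \<in> A" and g: "g \<in> G" and V: "open V"
  shows "metric_region c (chart_dom c \<inter> V) g"
proof -
  obtain g0 where met: "metric A g0" and G: "G = {rescale (\<lambda>x. (\<Omega> x)\<^sup>2) g0 | \<Omega>. pos_smooth A \<Omega>}"
    using conf by (auto simp: conformal_class_def)
  obtain \<Omega> where O: "pos_smooth A \<Omega>" "g = rescale (\<lambda>x. (\<Omega> x)\<^sup>2) g0"
    using g G by auto
  have eq: "g y c $ a $ b = (\<Omega> y)\<^sup>2 * g0 y c $ a $ b" for y a b
    by (simp add: O(2) rescale_def)
  have pos: "\<Omega> y > 0" for y using O(1) by (simp add: pos_smooth_def)
  let ?V = "chart_dom c \<inter> V"
  have o: "open ?V" using c V by (intro open_Int open_chart_dom)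
  interpret c0: chart_region c "chart_dom c" using c by (intro chart_region open_chart_dom) auto
  interpret V: chart_region c ?V using c V by (rule chart_region_Int)
  have ch: "c \<in> charts_at A y" if "y \<in> ?V" for y using that c by (auto simp: charts_at_def)
  show ?thesis
  proof
    fix a b
    have "smooth_fn A (chart_dom c) (\<lambda>x. g0 x c $ a $ b)" using met c by (auto simp: metric_def)
    then have "c0.sm (\<lambda>x. g0 x c $ a $ b)"
      using smooth_fn_sm[OF _ c open_chart_dom[OF c]] by force
    then have 1: "V.sm (\<lambda>x. g0 x c $ a $ b)"
      by (rule c0.sm_subset) (auto intro: V.open_image)
    have "c0.sm \<Omega>" using smooth_fn_sm[OF _ c open_UNIV, of \<Omega>] O(1) by (simp add: pos_smooth_def)
    then have "V.sm \<Omega>" by (rule c0.sm_subset) (auto intro: V.open_image)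
    then show "V.sm (\<lambda>y. g y c $ a $ b)"
      unfolding eq by (intro V.sm_intros 1)
  next
    fix y a b assume y: "y \<in> ?V"
    have "transpose (g0 y c) = g0 y c" using met ch[OF y] by (auto simp: metric_def)
    then have "transpose (g0 y c) $ b $ a = g0 y c $ b $ a" by simp
    then show "g y c $ a $ b = g y c $ b $ a" by (simp add: eq transpose_def)
  next
    fix y assume y: "y \<in> ?V"
    obtain p where "has_signature p (g0 y c)"
      using met ch[OF y] unfolding metric_def by blast
    then obtain B where B: "g0 y c ** B = mat 1"
      using has_signature_invertible invertible_def by blast
    have "g y c ** ((1 / (\<Omega> y)\<^sup>2) *\<^sub>R B) = mat 1"
      using pos[of y] B
      by (simp add: O(2) rescale_def matrix_scalar_ac scalar_matrix_assoc flip: scalar_matrix_assoc)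
    then show "invertible (g y c)" by (metis invertible_def matrix_left_right_inverse)
  qed (rule dim)
qed

lemma metric_region_chart: "c \<in> A \<Longrightarrow> g \<in> G \<Longrightarrow> metric_region c (chart_dom c) g"
  using metric_region[OF _ _ open_UNIV] by simp

lemma density_section_sm:
  assumes "density_section A G 1 V s" "open V" "g \<in> G" "c \<in> A"
  shows "chart_region.sm c (chart_dom c \<inter> V) (\<lambda>y. s y g)"
  using assms by (intro smooth_fn_sm) (auto simp: density_section_def)

text \<open>The difference that occurs in \<open>tractor_rel\<close>. Restriction to
  \<open>G\<close> keeps it extensional, as required of a density.\<close>

definition diff :: "('m, 'n) density \<Rightarrow> ('m, 'n) density \<Rightarrow> ('m, 'n) density" where
  "diff s1 s2 = (\<lambda>y. \<lambda>g\<in>G. s1 y g - s2 y g)"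

lemma diff_apply: "g \<in> G \<Longrightarrow> diff s1 s2 y g = s1 y g - s2 y g"
  by (simp add: diff_def)

lemma diff_section:
  assumes V: "open V" and s: "density_section A G 1 V s1" "density_section A G 1 V s2"
  shows "density_section A G 1 V (diff s1 s2)"
  unfolding density_section_def
proof (intro conjI ballI)
  fix x assume "x \<in> V"
  then show "diff s1 s2 x \<in> density_at A G 1 x"
    using s rescale_in_class
    by (auto simp: density_section_def density_at_def diff_apply right_diff_distrib)
      (auto simp: diff_def)
next
  fix g assume "g \<in> G"
  then show "smooth_fn A V (\<lambda>x. diff s1 s2 x g)"
    using s by (auto simp: diff_apply density_section_def intro: smooth_fn_diff[OF V])
qed

lemma local_pair:
  assumes "s1 \<in> local_sections A G x" "s2 \<in> local_sections A G x"
  obtains V where "open V" "x \<in> V" "density_section A G 1 V s1" "density_section A G 1 V s2"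
proof -
  obtain V1 V2 where "open V1" "x \<in> V1" "density_section A G 1 V1 s1"
    "open V2" "x \<in> V2" "density_section A G 1 V2 s2"
    using assms by (auto simp: local_sections_def)
  then show thesis
    by (intro that[of "V1 \<inter> V2"]) (auto simp: density_section_def intro: smooth_fn_subset)
qed

lemma diff_local:
  assumes "s1 \<in> local_sections A G x" "s2 \<in> local_sections A G x"
  shows "diff s1 s2 \<in> local_sections A G x"
proof -
  obtain V where "open V" "x \<in> V" "density_section A G 1 V s1" "density_section A G 1 V s2"
    using local_pair[OF assms] .
  then show ?thesis using diff_section by (auto simp: local_sections_def)
qed

section \<open>The triple of a density as a complete invariant of its tractor\<close>

lemma laplacian_eq:
  "laplacian g c f x = (\<Sum>a\<in>UNIV. \<Sum>b\<in>UNIV. inv_metric g c x $ a $ b *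
     (pd c a (pd c b f) x - (\<Sum>e\<in>UNIV. christoffel g c e a b x * pd c e f x)))"
  by (simp add: laplacian_def nabla_covec_def)

lemma pd_diff_section:
  assumes s: "s1 \<in> local_sections A G x" "s2 \<in> local_sections A G x" and g: "g \<in> G"
    and c: "c \<in> charts_at A x"
  shows "pd c a (\<lambda>y. diff s1 s2 y g) x = pd c a (\<lambda>y. s1 y g) x - pd c a (\<lambda>y. s2 y g) x"
    and "pd c a (pd c b (\<lambda>y. diff s1 s2 y g)) x =
      pd c a (pd c b (\<lambda>y. s1 y g)) x - pd c a (pd c b (\<lambda>y. s2 y g)) x"
proof -
  obtain V where V: "open V" "x \<in> V" and s: "density_section A G 1 V s1" "density_section A G 1 V s2"
    using local_pair[OF s] .
  let ?V = "chart_dom c \<inter> V"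
  interpret V: chart_region c ?V using c V by (auto intro: chart_region_Int dest: charts_atD)
  have x: "x \<in> ?V" using V c by (auto dest: charts_atD)
  have sm: "V.sm (\<lambda>y. s1 y g)" "V.sm (\<lambda>y. s2 y g)"
    using s V g c by (auto intro: density_section_sm dest: charts_atD)
  have 1: "pd c a (\<lambda>y. diff s1 s2 y g) z = pd c a (\<lambda>y. s1 y g) z - pd c a (\<lambda>y. s2 y g) z"
    if "z \<in> ?V" for a z
    using that by (simp add: diff_apply[OF g] V.pd_diff sm)
  then show "pd c a (\<lambda>y. diff s1 s2 y g) x = pd c a (\<lambda>y. s1 y g) x - pd c a (\<lambda>y. s2 y g) x"
    using x by simp
  have "pd c a (pd c b (\<lambda>y. diff s1 s2 y g)) x =
      pd c a (\<lambda>z. pd c b (\<lambda>y. s1 y g) z - pd c b (\<lambda>y. s2 y g) z) x"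
    by (rule V.pd_cong[OF x 1])
  then show "pd c a (pd c b (\<lambda>y. diff s1 s2 y g)) x =
      pd c a (pd c b (\<lambda>y. s1 y g)) x - pd c a (pd c b (\<lambda>y. s2 y g)) x"
    using x by (simp add: V.pd_diff V.sm_pd sm)
qed

text \<open>Once the 1-jet of the difference vanishes, the Christoffel terms of its Laplacian and
  the term with \<open>J\<close> disappear. So the triple detects jets exactly up to trace-free
  Hessians.\<close>

lemma D_triple_eq_iff:
  assumes s: "s1 \<in> local_sections A G x" "s2 \<in> local_sections A G x" and g: "g \<in> G"
    and c: "c \<in> charts_at A x"
  shows "D_triple g c x s1 = D_triple g c x s2 \<longleftrightarrow>
    diff s1 s2 x g = 0 \<and> (\<forall>a. pd c a (\<lambda>y. diff s1 s2 y g) x = 0) \<and>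
    (\<Sum>a\<in>UNIV. \<Sum>b\<in>UNIV. inv_metric g c x $ a $ b * pd c a (pd c b (\<lambda>y. diff s1 s2 y g)) x) = 0"
proof -
  have n: "real CARD('n) \<noteq> 0" using dim by linarith
  let ?u = "\<lambda>y. diff s1 s2 y g"
  have lap: "laplacian g c (\<lambda>y. s1 y g) x - laplacian g c (\<lambda>y. s2 y g) x = laplacian g c ?u x"
    unfolding laplacian_eq pd_diff_section[OF s g c]
    by (simp only: right_diff_distrib sum_subtractf)
  show ?thesis
  proof (cases "diff s1 s2 x g = 0 \<and> (\<forall>a. pd c a ?u x = 0)")
    case True
    then have e: "s1 x g = s2 x g" "\<And>a. pd c a (\<lambda>y. s1 y g) x = pd c a (\<lambda>y. s2 y g) x"
      using pd_diff_section(1)[OF s g c] by (simp_all add: diff_apply[OF g])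
    have "laplacian g c ?u x =
        (\<Sum>a\<in>UNIV. \<Sum>b\<in>UNIV. inv_metric g c x $ a $ b * pd c a (pd c b ?u) x)"
      using True by (simp add: laplacian_eq)
    moreover have "D_triple g c x s1 = D_triple g c x s2 \<longleftrightarrow>
        laplacian g c (\<lambda>y. s1 y g) x = laplacian g c (\<lambda>y. s2 y g) x"
      using n by (simp add: D_triple_def e)
    ultimately show ?thesis using True lap by auto
  next
    case False
    then show ?thesis
      using pd_diff_section(1)[OF s g c] by (auto simp: D_triple_def diff_apply[OF g] vec_eq_iff)
  qed
qed

lemma jet2_refl: "s \<in> local_sections A G x \<Longrightarrow> s \<in> jet2 A G x s"
  by (simp add: jet2_def)

lemma jet2_local: "s' \<in> jet2 A G x s \<Longrightarrow> s' \<in> local_sections A G x"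
  by (simp add: jet2_def)

lemma D_triple_jet2:
  assumes "s' \<in> jet2 A G x s" "g \<in> G" "c \<in> charts_at A x"
  shows "D_triple g c x s' = D_triple g c x s"
proof -
  have "s' x g = s x g" "\<And>a. pd c a (\<lambda>y. s' y g) x = pd c a (\<lambda>y. s y g) x"
    "\<And>a b. pd c a (pd c b (\<lambda>y. s' y g)) x = pd c a (pd c b (\<lambda>y. s y g)) x"
    using assms by (auto simp: jet2_def)
  then show ?thesis by (simp add: D_triple_def laplacian_eq)
qed

text \<open>The Hessian of a density with vanishing 1-jet at \<open>x\<close>, as an element of
  $\mathcal{E}_{(ab)}[1]$; it is a tensor because the 1-jet vanishes.\<close>

definition hess :: "'m \<Rightarrow> ('m, 'n) density \<Rightarrow> ('m, 'n) tensor2_field \<Rightarrow> ('m, 'n) tensor2" where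
  "hess x u = (\<lambda>g\<in>G. \<lambda>c. if c \<in> charts_at A x then \<chi> a b. pd c a (pd c b (\<lambda>y. u y g)) x else 0)"

lemma hess_tf_sym:
  assumes u: "u \<in> local_sections A G x"
    and 0: "\<And>g c. g \<in> G \<Longrightarrow> c \<in> charts_at A x \<Longrightarrow> u x g = 0"
    and 1: "\<And>g c a. g \<in> G \<Longrightarrow> c \<in> charts_at A x \<Longrightarrow> pd c a (\<lambda>y. u y g) x = 0"
    and 2: "\<And>g c. g \<in> G \<Longrightarrow> c \<in> charts_at A x \<Longrightarrow>
      (\<Sum>a\<in>UNIV. \<Sum>b\<in>UNIV. inv_metric g c x $ a $ b * pd c a (pd c b (\<lambda>y. u y g)) x) = 0"
  shows "hess x u \<in> tf_sym_at A G 1 x"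
proof -
  obtain V where V: "open V" "x \<in> V" and s: "density_section A G 1 V u"
    using u by (auto simp: local_sections_def)
  have reg: "chart_region c (chart_dom c \<inter> V)" "x \<in> chart_dom c \<inter> V" if "c \<in> charts_at A x" for c
    using that V by (auto intro: chart_region_Int dest: charts_atD)
  have sm: "chart_region.sm c (chart_dom c \<inter> V) (\<lambda>y. u y g)" if "c \<in> charts_at A x" "g \<in> G" for c g
    using that V s by (auto intro: density_section_sm dest: charts_atD)
  have tensor: "hess x u g \<in> tensor2_at A x" if g: "g \<in> G" for g
    unfolding tensor2_at_def
  proof (intro CollectI conjI allI impI ballI)
    fix c d a b assume c: "c \<in> charts_at A x" and d: "d \<in> charts_at A x"
    let ?V = "chart_dom d \<inter> V" and ?U = "chart_dom c \<inter> (chart_dom d \<inter> V)"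
    have U: "open ?U" using c d V by (auto intro!: open_Int open_chart_dom dest: charts_atD)
    have "chart_region.sm d ?U (\<lambda>y. u y g)"
      using chart_region.sm_subset[OF reg(1)[OF d] sm[OF d g], of ?U]
        chart_region[OF charts_atD(1)[OF d] U] by (auto dest: chart_region.open_image)
    from hessian_transform[OF charts_atD(1)[OF c] charts_atD(1)[OF d] U _ _ this _ 1[OF g d], of a b]
    show "hess x u g c $ a $ b = (\<Sum>i\<in>UNIV. \<Sum>j\<in>UNIV. pd c a (\<lambda>y. coords d y $ i) x *
        pd c b (\<lambda>y. coords d y $ j) x * hess x u g d $ i $ j)"
      using c d g reg(2)[OF c] reg(2)[OF d] by (auto simp: hess_def)
  qed (simp add: hess_def g)
  have sym: "transpose (hess x u g c) = hess x u g c" if "g \<in> G" "c \<in> charts_at A x" for g c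
    using chart_region.pd_commute[OF reg(1) reg(2) sm] that by
        (simp add: hess_def transpose_def vec_eq_iff)
  \<comment> \<open>In the Leibniz rule for the product of \<Omega> and \<open>u\<close>, every term
    with a derivative of \<Omega> contains the value or the gradient of \<open>u\<close> at
    \<open>x\<close>, both zero; hence the Hessian has weight 1.\<close>
  have scale: "hess x u (rescale (\<lambda>y. (\<Omega> y)\<^sup>2) g) = (\<lambda>c. (\<Omega> x powr 1) *\<^sub>R hess x u g c)"
    if g: "g \<in> G" and O: "pos_smooth A \<Omega>" for g \<Omega>
  proof
    fix c
    let ?g = "rescale (\<lambda>y. (\<Omega> y)\<^sup>2) g"
    have g': "?g \<in> G" by (rule rescale_in_class[OF g O])
    show "hess x u ?g c = (\<Omega> x powr 1) *\<^sub>R hess x u g c"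
    proof (cases "c \<in> charts_at A x")
      case c: True
      interpret V: chart_region c "chart_dom c \<inter> V" by (rule reg(1)[OF c])
      note x = reg(2)[OF c]
      have "smooth_fn A V \<Omega>" using O by (auto simp: pos_smooth_def intro: smooth_fn_subset)
      then have smO: "V.sm \<Omega>" using V c by (auto intro: smooth_fn_sm dest: charts_atD)
      note smu = sm[OF c g]
      have pos: "\<Omega> y > 0" for y using O by (simp add: pos_smooth_def)
      have e: "u y ?g = \<Omega> y * u y g" if "y \<in> chart_dom c \<inter> V" for y
      proof -
        have "u y \<in> density_at A G 1 y" using s that by (simp add: density_section_def)
        then have "u y ?g = \<Omega> y powr 1 * u y g" using g O by (simp add: density_at_def)
        then show ?thesis using pos[of y] by simp
      qed
      have e1: "pd c b (\<lambda>y. u y ?g) z = pd c b \<Omega> z * u z g + \<Omega> z * pd c b (\<lambda>y. u y g) z"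
        if z: "z \<in> chart_dom c \<inter> V" for b z
        using V.pd_cong[OF z e, where a = b] V.pd_mult[OF z smO smu] by simp
      have "pd c a (pd c b (\<lambda>y. u y ?g)) x = \<Omega> x * pd c a (pd c b (\<lambda>y. u y g)) x" for a b
      proof -
        have "pd c a (pd c b (\<lambda>y. u y ?g)) x =
            pd c a (\<lambda>z. pd c b \<Omega> z * u z g + \<Omega> z * pd c b (\<lambda>y. u y g) z) x"
          by (rule V.pd_cong[OF x e1])
        then show ?thesis
          using x 0[OF g c] 1[OF g c] by (simp add: V.pd_rules V.sm_intros smO smu)
      qed
      then show ?thesis using c g g' pos[of x] by (simp add: hess_def vec_eq_iff)
    qed (use g g' in \<open>simp add: hess_def\<close>)
  qed
  show ?thesis
    unfolding tf_sym_at_def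
  proof (intro CollectI conjI ballI allI impI tensor sym scale)
    show "(\<Sum>a\<in>UNIV. \<Sum>b\<in>UNIV. inv_metric g c x $ a $ b * hess x u g c $ a $ b) = 0"
      if "g \<in> G" "c \<in> charts_at A x" for g c
      using 2[OF that] that by (simp add: hess_def)
  qed (auto simp: hess_def)
qed

text \<open>Turns the quotient by trace-free Hessians into agreement of triples, which makes the
  definite description in \<open>split_tractor\<close> meaningful.\<close>

lemma tractor_rel_iff:
  assumes s: "s1 \<in> local_sections A G x" "s2 \<in> local_sections A G x"
  shows "(jet2 A G x s1, jet2 A G x s2) \<in> tractor_rel A G x \<longleftrightarrow>
    (\<forall>g\<in>G. \<forall>c\<in>charts_at A x. D_triple g c x s1 = D_triple g c x s2)" (is "?l \<longleftrightarrow> ?r")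
proof
  assume ?l
  then obtain t1 t2 S where t: "t1 \<in> jet2 A G x s1" "t2 \<in> jet2 A G x s2"
    and S: "S \<in> tf_sym_at A G 1 x" and eq: "jet2 A G x (diff t1 t2) = jet_incl A G x S"
    unfolding tractor_rel_def diff_def by auto
  note tl = jet2_local[OF t(1)] jet2_local[OF t(2)]
  have u: "diff t1 t2 \<in> jet_incl A G x S"
    using jet2_refl[OF diff_local[OF tl]] eq by simp
  show ?r
  proof (intro ballI)
    fix g c assume g: "g \<in> G" and c: "c \<in> charts_at A x"
    have "D_triple g c x t1 = D_triple g c x t2"
      unfolding D_triple_eq_iff[OF tl g c] using u S g c by (simp add: jet_incl_def tf_sym_at_def)
    then show "D_triple g c x s1 = D_triple g c x s2"
      by (simp add: D_triple_jet2[OF t(1) g c] D_triple_jet2[OF t(2) g c])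
  qed
next
  assume r: ?r
  let ?u = "diff s1 s2"
  have u: "diff s1 s2 x g = 0 \<and> (\<forall>a. pd c a (\<lambda>y. diff s1 s2 y g) x = 0) \<and>
    (\<Sum>a\<in>UNIV. \<Sum>b\<in>UNIV. inv_metric g c x $ a $ b * pd c a (pd c b (\<lambda>y. diff s1 s2 y g)) x) = 0"
    if "g \<in> G" "c \<in> charts_at A x" for g c
    using r that D_triple_eq_iff[OF s that] by blast
  \<comment> \<open>The tensor that identifies the two jets is the Hessian of the
    difference.\<close>
  have "hess x ?u \<in> tf_sym_at A G 1 x"
    by (rule hess_tf_sym[OF diff_local[OF s]]) (use u in auto)
  moreover have "jet2 A G x ?u = jet_incl A G x (hess x ?u)"
    unfolding jet2_def jet_incl_def using u by (auto simp: hess_def)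
  ultimately show ?l
    using s jet2_refl[OF s(1)] jet2_refl[OF s(2)]
    unfolding tractor_rel_def J2_at_def diff_def by blast
qed

definition tractor_class :: "'m \<Rightarrow> ('m, 'n) density \<Rightarrow> ('m, 'n) tractor" where
  "tractor_class x s = tractor_rel A G x `` {jet2 A G x s}"

lemma tractor_at_iff: "t \<in> tractor_at A G x \<longleftrightarrow> (\<exists>s\<in>local_sections A G x. t = tractor_class x s)"
  by (auto simp: tractor_at_def quotient_def J2_at_def tractor_class_def)

text \<open>The classes are compared element by element through \<open>tractor_rel_iff\<close>;
  agreement of triples is visibly transitive, which takes the place of a proof that
  \<open>tractor_rel\<close> is an equivalence relation.\<close>

lemma tractor_class_eqI:
  assumes s: "s1 \<in> local_sections A G x" "s2 \<in> local_sections A G x"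
    and "\<And>g c. g \<in> G \<Longrightarrow> c \<in> charts_at A x \<Longrightarrow> D_triple g c x s1 = D_triple g c x s2"
  shows "tractor_class x s1 = tractor_class x s2"
proof -
  have "(jet2 A G x s1, j) \<in> tractor_rel A G x \<longleftrightarrow> (jet2 A G x s2, j) \<in> tractor_rel A G x" for j
  proof (cases "j \<in> J2_at A G x")
    case True
    then obtain s3 where "s3 \<in> local_sections A G x" "j = jet2 A G x s3" by (auto simp: J2_at_def)
    then show ?thesis using tractor_rel_iff s assms(3) by simp
  qed (auto simp: tractor_rel_def)
  then show ?thesis by (auto simp: tractor_class_def)
qed

lemma split_tractor_tractor_class:
  assumes s: "s \<in> local_sections A G x" and g: "g \<in> G" and c: "c \<in> charts_at A x"
  shows "split_tractor g c x (tractor_class x s) = D_triple g c x s"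
proof -
  have 1: "D_triple g c x s' = D_triple g c x s" if s': "s' \<in> \<Union>(tractor_class x s)" for s'
  proof -
    obtain j where j: "s' \<in> j" "(jet2 A G x s, j) \<in> tractor_rel A G x"
      using s' by (auto simp: tractor_class_def)
    then obtain t where t: "t \<in> local_sections A G x" "j = jet2 A G x t"
      by (auto simp: tractor_rel_def J2_at_def)
    show ?thesis
    proof -
      have "s' \<in> jet2 A G x t" using j t by simp
      then have "D_triple g c x s' = D_triple g c x t" by (rule D_triple_jet2[OF _ g c])
      moreover have "D_triple g c x s = D_triple g c x t"
        using tractor_rel_iff[OF s t(1)] j(2) g c unfolding t(2) by blast
      ultimately show ?thesis by simp
    qed
  qed
  \<comment> \<open>The class is inhabited by \<open>s\<close> itself, which makes the common value
    unique.\<close>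
  have 2: "s \<in> \<Union>(tractor_class x s)"
    using tractor_rel_iff[OF s s] jet2_refl[OF s] by (auto simp: tractor_class_def)
  show ?thesis
    unfolding split_tractor_def
  proof (rule the_equality)
    show "\<forall>s'\<in>\<Union>(tractor_class x s). D_triple g c x s' = D_triple g c x s" using 1 by blast
    show "r = D_triple g c x s" if "\<forall>s'\<in>\<Union>(tractor_class x s). D_triple g c x s' = r" for r
      using bspec[OF that 2] by (rule sym)
  qed
qed

lemma thomas_D_tractor_class: "thomas_D A G s x = tractor_class x s"
  by (simp add: thomas_D_def tractor_class_def)

text \<open>An equality of functions of all metrics: off \<open>G\<close> both sides are
  \<open>undefined\<close>, since a density is extensional.\<close>

lemma X_proj_tractor_class:
  assumes s: "s \<in> local_sections A G x"
  shows "X_proj A G x (tractor_class x s) = s x"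
proof
  fix g
  obtain V where "x \<in> V" "density_section A G 1 V s" using s by (auto simp: local_sections_def)
  then have ext: "s x \<in> extensional G" by (auto simp: density_section_def density_at_def)
  show "X_proj A G x (tractor_class x s) g = s x g"
  proof (cases "g \<in> G")
    case g: True
    obtain c where c: "c \<in> charts_at A x" using ex_chart by blast
    have e: "slot_top (split_tractor g c x (tractor_class x s)) = s x g" if "c \<in> charts_at A x" for c
      by (simp add: split_tractor_tractor_class[OF s g that] D_triple_def slot_top_def)
    have "(THE r. \<forall>c\<in>charts_at A x. slot_top (split_tractor g c x (tractor_class x s)) = r) = s x g"
    proof (rule the_equality)
      show "r = s x g" if "\<forall>c\<in>charts_at A x. slot_top (split_tractor g c x (tractor_class x s))
          = r" for r
        using bspec[OF that c] e[OF c] by simp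
    qed (use e in blast)
    then show ?thesis using g by (simp add: X_proj_def)
  qed (use ext in \<open>auto simp: X_proj_def extensional_def\<close>)
qed

section \<open>The correspondence between Einstein scales and parallel tractors\<close>

lemma global_local: "density_section A G 1 UNIV s \<Longrightarrow> s \<in> local_sections A G x"
  by (auto simp: local_sections_def)

lemma conformal_region:
  assumes "conformal_scale A G \<sigma>" "c \<in> A" "g \<in> G"
  shows "conformal_region c (chart_dom c) g (\<lambda>y. \<sigma> y g)"
proof -
  interpret metric_region c "chart_dom c" g using assms by (intro metric_region_chart)
  show ?thesis
  proof
    show "sm (\<lambda>y. \<sigma> y g)"
      using density_section_sm[of UNIV \<sigma> g c] assms by (simp add: conformal_scale_def)
    show "\<sigma> y g \<noteq> 0" for y
      using assms by (auto simp: conformal_scale_def nowhere_vanishing_def)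
  qed
qed

lemma D_triple_eq:
  assumes "conformal_scale A G \<sigma>" "c \<in> A" "g \<in> G"
  shows "D_triple g c y \<sigma> =
    (\<sigma> y g, (\<chi> a. pd c a (\<lambda>y. \<sigma> y g) y), conformal_region.\<rho> c g (\<lambda>y. \<sigma> y g) y)"
proof -
  interpret conformal_region c "chart_dom c" g "\<lambda>y. \<sigma> y g" using assms by (rule conformal_region)
  show ?thesis by (simp add: D_triple_def \<rho>_def tr_def N_def laplacian_eq)
qed

lemma einstein_scale_iff:
  "einstein_scale A G \<sigma> \<longleftrightarrow> conformal_scale A G \<sigma> \<and>
    (\<forall>g\<in>G. \<forall>x. \<forall>c\<in>charts_at A x. \<forall>a b. conformal_region.N c g (\<lambda>y. \<sigma> y g) a b x
      + g x c $ a $ b * conformal_region.\<rho> c g (\<lambda>y. \<sigma> y g) x + schouten g c x $ a $ b * \<sigma> x g = 0)"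
proof -
  have "schouten (scale_metric \<sigma> g) c x - (J_trace (scale_metric \<sigma> g) c x / real CARD('n)) *\<^sub>R
      scale_metric \<sigma> g x c = 0
    \<longleftrightarrow> (\<forall>a b. conformal_region.N c g (\<lambda>y. \<sigma> y g) a b x
      + g x c $ a $ b * conformal_region.\<rho> c g (\<lambda>y. \<sigma> y g) x + schouten g c x $ a $ b * \<sigma> x g = 0)"
    if "conformal_scale A G \<sigma>" "g \<in> G" "c \<in> charts_at A x" for g x c
  proof -
    interpret conformal_region c "chart_dom c" g "\<lambda>y. \<sigma> y g"
      using that by (auto intro: conformal_region dest: charts_atD)
    have "gh = scale_metric \<sigma> g" by (simp add: gh_def scale_metric_def)
    then show ?thesis using einstein_at_iff[OF charts_atD(2)[OF that(3)]] by simp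
  qed
  then show ?thesis unfolding einstein_scale_def einstein_def by blast
qed

lemma einstein_scale_parallel:
  assumes E: "einstein_scale A G \<sigma>"
  shows "thomas_D A G \<sigma> \<in> scale_tractors A G" and "X_contr A G (thomas_D A G \<sigma>) = \<sigma>"
proof -
  have \<sigma>: "conformal_scale A G \<sigma>" using E by (simp add: einstein_scale_def)
  then have sec: "density_section A G 1 UNIV \<sigma>" by (simp add: conformal_scale_def)
  note loc = global_local[OF sec]
  show X: "X_contr A G (thomas_D A G \<sigma>) = \<sigma>"
    by (simp add: X_contr_def thomas_D_tractor_class X_proj_tractor_class[OF loc])
  let ?I = "thomas_D A G \<sigma>"
  have split: "split_tractor g c y (?I y) =
      (\<sigma> y g, (\<chi> a. pd c a (\<lambda>y. \<sigma> y g) y), conformal_region.\<rho> c g (\<lambda>y. \<sigma> y g) y)"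
    if "g \<in> G" "c \<in> A" "y \<in> chart_dom c" for g c y
    using that by (simp add: thomas_D_tractor_class split_tractor_tractor_class[OF loc]
        charts_at_def D_triple_eq[OF \<sigma>])
  have "tractor_section A G ?I"
    unfolding tractor_section_def
  proof (intro conjI allI ballI)
    show "?I x \<in> tractor_at A G x" for x using loc by (auto simp: tractor_at_iff thomas_D_tractor_class)
  next
    fix g c a assume g: "g \<in> G" and c: "c \<in> A"
    interpret conformal_region c "chart_dom c" g "\<lambda>y. \<sigma> y g" using \<sigma> c g by (rule conformal_region)
    show "smooth_fn A (chart_dom c) (\<lambda>x. slot_top (split_tractor g c x (?I x)))"
      by (rule smooth_fn_of_chart[OF c sm_sigma]) (simp add: split[OF g c] slot_top_def)
    show "smooth_fn A (chart_dom c) (\<lambda>x. slot_mid (split_tractor g c x (?I x)) $ a)"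
      by (rule smooth_fn_of_chart[OF c sm_pd[OF sm_sigma]]) (simp add: split[OF g c] slot_mid_def)
    show "smooth_fn A (chart_dom c) (\<lambda>x. slot_bot (split_tractor g c x (?I x)))"
      by (rule smooth_fn_of_chart[OF c sm_rho]) (simp add: split[OF g c] slot_bot_def)
  qed
  moreover have "tractor_nabla g c a ?I x = (0, 0, 0)"
      if g: "g \<in> G" and cx: "c \<in> charts_at A x" for g c a x
  proof -
    have c: "c \<in> A" and x: "x \<in> chart_dom c" using cx by (auto dest: charts_atD)
    interpret conformal_region c "chart_dom c" g "\<lambda>y. \<sigma> y g" using \<sigma> c g by (rule conformal_region)
    \<comment> \<open>The equation is recorded on the whole chart domain because
      \<open>einstein_bottom_slot\<close> differentiates it.\<close>
    have N: "N a b y + g y c $ a $ b * \<rho> y + Sch a b y * \<sigma> y g = 0" if "y \<in> chart_dom c" for a b y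
    proof -
      have "c \<in> charts_at A y" using c that by (simp add: charts_at_def)
      then show ?thesis using E[unfolded einstein_scale_iff] g by blast
    qed
    note split = split[OF g c]
    \<comment> \<open>The slots equal these functions throughout the chart domain, so they may be
      exchanged under the derivative.\<close>
    have top: "pd c a (\<lambda>y. slot_top (split_tractor g c y (?I y))) x = pd c a (\<lambda>y. \<sigma> y g) x"
      by (rule pd_cong[OF x]) (simp add: split slot_top_def)
    have mid: "pd c a (\<lambda>y. slot_mid (split_tractor g c y (?I y)) $ b) x
        = pd c a (pd c b (\<lambda>y. \<sigma> y g)) x" for b
      by (rule pd_cong[OF x]) (simp add: split slot_mid_def)
    have bot: "pd c a (\<lambda>y. slot_bot (split_tractor g c y (?I y))) x = pd c a \<rho> x"
      by (rule pd_cong[OF x]) (simp add: split slot_bot_def)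
    have "nabla_covec g c a b (\<lambda>y. slot_mid (split_tractor g c y (?I y))) x = N a b x" for b
      unfolding nabla_covec_def mid N_def by (simp add: split[OF x] slot_mid_def)
    then show ?thesis
      unfolding tractor_nabla_def Let_def top bot
      using N[OF x] einstein_bottom_slot[OF N x, of a]
      by (simp add: split[OF x] slot_top_def slot_mid_def slot_bot_def vec_eq_iff)
  qed
  ultimately show "?I \<in> scale_tractors A G"
    using \<sigma> by (simp add: scale_tractors_def parallel_tractor_def X conformal_scale_def)
qed

lemma parallel_einstein_scale:
  assumes I: "I \<in> scale_tractors A G"
  shows "einstein_scale A G (X_contr A G I)" and "thomas_D A G (X_contr A G I) = I"
proof -
  define \<sigma> where "\<sigma> = X_contr A G I"
  have sec: "tractor_section A G I" and nz: "nowhere_vanishing G \<sigma>"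
    and par: "\<And>g x c a. g \<in> G \<Longrightarrow> c \<in> charts_at A x \<Longrightarrow> tractor_nabla g c a I x = (0, 0, 0)"
    using I by (auto simp: scale_tractors_def parallel_tractor_def \<sigma>_def)
  have "\<exists>s. s \<in> local_sections A G x \<and> I x = tractor_class x s" for x
    using sec by (auto simp: tractor_section_def tractor_at_iff)
  \<comment> \<open>A representative is chosen separately at every point, with no relation between
    neighbouring choices. Smoothness of \<sigma> therefore has to come from the top slot of the
    section.\<close>
  then obtain s where s: "\<And>x. s x \<in> local_sections A G x" and Is: "\<And>x. I x = tractor_class x (s x)"
    by metis
  have \<sigma>s: "\<sigma> x = s x x" for x
    by (simp add: \<sigma>_def X_contr_def Is X_proj_tractor_class[OF s])
  have split: "split_tractor g c x (I x) = D_triple g c x (s x)" if "g \<in> G" "c \<in> charts_at A x" for g c x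
    unfolding Is by (rule split_tractor_tractor_class[OF s that])
  have top: "slot_top (split_tractor g c x (I x)) = \<sigma> x g" if "g \<in> G" "c \<in> A" "x \<in> chart_dom c" for g c x
    using that by (simp add: split charts_at_def D_triple_def slot_top_def \<sigma>s)
  have "smooth_fn A UNIV (\<lambda>x. \<sigma> x g)" if g: "g \<in> G" for g
    unfolding smooth_fn_iff[OF open_UNIV]
  proof
    fix c assume c: "c \<in> A"
    interpret chart_region c "chart_dom c" using c by (intro chart_region open_chart_dom) auto
    have "smooth_fn A (chart_dom c) (\<lambda>x. slot_top (split_tractor g c x (I x)))"
      using sec g c by (auto simp: tractor_section_def)
    from smooth_fn_sm[OF this c open_chart_dom[OF c]]
    have "sm (\<lambda>x. slot_top (split_tractor g c x (I x)))" by simp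
    then show "chart_region.sm c (chart_dom c \<inter> UNIV) (\<lambda>x. \<sigma> x g)"
      by (simp add: top[OF g c] cong: sm_cong)
  qed
  moreover have "\<sigma> x \<in> density_at A G 1 x" for x
    using s[of x] by (auto simp: \<sigma>s local_sections_def density_section_def)
  ultimately have dens: "density_section A G 1 UNIV \<sigma>" by (simp add: density_section_def)
  then have \<sigma>: "conformal_scale A G \<sigma>" using nz by (simp add: conformal_scale_def)
  have key: "(\<forall>a b. conformal_region.N c g (\<lambda>y. \<sigma> y g) a b x
      + g x c $ a $ b * conformal_region.\<rho> c g (\<lambda>y. \<sigma> y g) x + schouten g c x $ a $ b * \<sigma> x g = 0)
      \<and> D_triple g c x \<sigma> = D_triple g c x (s x)" if g: "g \<in> G" and cx: "c \<in> charts_at A x" for g c x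
  proof -
    have c: "c \<in> A" and x: "x \<in> chart_dom c" using cx by (auto dest: charts_atD)
    interpret conformal_region c "chart_dom c" g "\<lambda>y. \<sigma> y g" using \<sigma> c g by (rule conformal_region)
    let ?\<mu> = "\<lambda>y. slot_mid (split_tractor g c y (I y))"
    let ?r = "slot_bot (split_tractor g c x (I x))"
    have ch: "c \<in> charts_at A y" if "y \<in> chart_dom c" for y using that c by (simp add: charts_at_def)
    \<comment> \<open>The top slot of the parallel equation, on the whole chart domain so that it
      can be differentiated again in the middle slot.\<close>
    have mid: "?\<mu> y $ a = pd c a (\<lambda>y. \<sigma> y g) y" if y: "y \<in> chart_dom c" for a y
    proof -
      have "pd c a (\<lambda>y. slot_top (split_tractor g c y (I y))) y = pd c a (\<lambda>y. \<sigma> y g) y"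
        by (rule pd_cong[OF y top[OF g c]])
      then show ?thesis using par[OF g ch[OF y], of a] by (simp add: tractor_nabla_def Let_def)
    qed
    have N: "nabla_covec g c a b ?\<mu> x = N a b x" for a b
    proof -
      have "pd c a (\<lambda>y. ?\<mu> y $ b) x = pd c a (pd c b (\<lambda>y. \<sigma> y g)) x"
        by (rule pd_cong[OF x mid])
      then show ?thesis by (simp add: nabla_covec_def N_def mid[OF x])
    qed
    have eq: "N a b x + g x c $ a $ b * ?r + Sch a b x * \<sigma> x g = 0" for a b
      using par[OF g cx, of a] by (simp add: tractor_nabla_def Let_def N top[OF g c x] vec_eq_iff)
    have r: "?r = \<rho> x" by (rule hessian_trace_determines[OF x eq])
    have "D_triple g c x \<sigma> = (\<sigma> x g, ?\<mu> x, ?r)"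
      by (simp add: D_triple_eq[OF \<sigma> c g] r mid[OF x] vec_eq_iff)
    also have "\<dots> = split_tractor g c x (I x)"
      using top[OF g c x] by (simp add: slot_top_def slot_mid_def slot_bot_def prod_eq_iff)
    finally show ?thesis using eq[unfolded r] by (simp add: split[OF g cx])
  qed
  show "einstein_scale A G (X_contr A G I)"
    unfolding \<sigma>_def[symmetric] einstein_scale_iff using \<sigma> key by blast
  \<comment> \<open>At each point \<sigma> and the local representative share their triple, hence
    define the same tractor although their 2-jets may differ.\<close>
  have "tractor_class x \<sigma> = tractor_class x (s x)" for x
    by (rule tractor_class_eqI[OF global_local[OF dens] s]) (use key in blast)
  then show "thomas_D A G (X_contr A G I) = I"
    by (simp add: fun_eq_iff \<sigma>_def[symmetric] thomas_D_tractor_class Is)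
qed

end

theorem theorem2p1:
  fixes A :: "('m::{t2_space,second_countable_topology}, 'n::finite) chart set"
    and G :: "('m, 'n) tensor2_field set"
  assumes "CARD('n) \<ge> 3"
    and "smooth_atlas A"
    and "conformal_class A G"
  shows "bij_betw (thomas_D A G) (einstein_scales A G) (scale_tractors A G) \<and>
         bij_betw (X_contr A G) (scale_tractors A G) (einstein_scales A G) \<and>
         (\<forall>\<sigma>\<in>einstein_scales A G. X_contr A G (thomas_D A G \<sigma>) = \<sigma>) \<and>
         (\<forall>I\<in>scale_tractors A G. thomas_D A G (X_contr A G I) = I)"
proof -
  interpret conformal_manifold A G using assms by unfold_locales
  have D: "thomas_D A G \<sigma> \<in> scale_tractors A G" "X_contr A G (thomas_D A G \<sigma>) = \<sigma>"
    if "\<sigma> \<in> einstein_scales A G" for \<sigma>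
    using einstein_scale_parallel that by (auto simp: einstein_scales_def)
  have X: "X_contr A G I \<in> einstein_scales A G" "thomas_D A G (X_contr A G I) = I"
    if "I \<in> scale_tractors A G" for I
    using parallel_einstein_scale that by (auto simp: einstein_scales_def)
  have "bij_betw (thomas_D A G) (einstein_scales A G) (scale_tractors A G)"
    by (rule bij_betw_byWitness[where f' = "X_contr A G"]) (use D X in auto)
  moreover have "bij_betw (X_contr A G) (scale_tractors A G) (einstein_scales A G)"
    by (rule bij_betw_byWitness[where f' = "thomas_D A G"]) (use D X in auto)
  ultimately show ?thesis using D X by blast
qed

end
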